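(* Fix $\alpha\ge 0$ and a probability distribution $\mu$ on $[0,1]$ with $\mathbb{P}(\xi=0)<1$ and $\mathbb{P}(\xi=1)<1$ for $\xi\sim\mu$. Let $\{\mathcal{T}(n):n\ge 1\}$ be the delayed preferential attachment trees described in the context (macroscopic delay, attachment weight $\deg+\alpha$). Then $\mathcal{T}(n)$ converges in the expected fringe sense to $\varpi_{\mathrm{Mac},\alpha}$, i.e. for every finite rooted tree $\mathbf{t}$ (up to root-preserving isomorphism), $$\mathbb{E}\Big[\frac1n\#\{v\in\mathcal{T}(n): f_0(v,\mathcal{T}(n))\simeq \mathbf{t}\}\Big]\longrightarrow \varpi_{\mathrm{Mac},\alpha}(\mathbf{t})\quad (n\to\infty).$$ In particular, writing $N_k(n)$ for the number of vertices $v$ of $\mathcal{T}(n)$ with $\deg(v,n)=k$, for every $k\ge 1$, $$\mathbb{E}\Big(\frac{N_k(n)}{n}\Big)\to \mathbb{P}\Big(\sum_{j=1}^{k-1}\mathscr{E}_{j-1\leadsto j}\le T_1<\sum_{j=1}^{k}\mathscr{E}_{j-1\leadsto j}\Big)=:p_{\mathrm{Mac},\alpha}(k),$$ where $T_1\sim\mathrm{Exp}(1)$ is independent of $\{\mathscr{E}_{j-1\leadsto j}\}_{j\ge1}$.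
   Context: Model: Let $\xi\sim\mu$. Build random rooted trees: $\mathcal{T}(1)$ is a single vertex $v_1$ (the root); $\mathcal{T}(2)$ has vertices $v_1,v_2$ and an edge from $v_2$ to its parent $v_1$; set $\mathcal{T}(0):=\mathcal{T}(1)$. For $j\ge i$, $\deg(v_i,j)$ is the degree of $v_i$ in $\mathcal{T}(j)$ (equal to its number of children $+1$ for non-root vertices, and to its number of children for the root), with the convention $\deg(v_i,i)=1$ for all $i$. For $n\ge2$, given $\mathcal{T}(n)$, a new vertex $v_{n+1}$ arrives, an independent delay $\xi_{n+1}\sim\mu$ is drawn, and $v_{n+1}$ becomes a child of a vertex $v$ of $\mathcal{T}(\lfloor n-n\xi_{n+1}\rfloor)$ chosen with probability proportional to $\deg(v,\lfloor n-n\xi_{n+1}\rfloor)+\alpha$. Limit objects: let $\eta:=-\log(1-\xi)\in[0,\infty]$ ($\eta=\infty$ iff $\xi=1$) with law $F_\eta$, and $h(x):=\frac{1}{2+\alpha}\int_{[0,x]}e^u\,dF_\eta(u)$. Define $\mathscr{E}_{0\leadsto1},\mathscr{E}_{1\leadsto2},\dots$ recursively: with $\sigma_0=0$, $\sigma_i=\sum_{j=1}^i\mathscr{E}_{j-1\leadsto j}$, conditionally on $\mathscr{E}_{0\leadsto1},\dots,\mathscr{E}_{i-1\leadsto i}$ the variable $\mathscr{E}_{i\leadsto i+1}\in(0,\infty]$ has hazard rate $x\mapsto \sum_{j=0}^i h(x+\sigma_i-\sigma_j)+\alpha h(x+\sigma_i)$, $x\ge0$ (i.e. $\mathbb{P}(\mathscr{E}_{i\leadsto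 i+1}>s\mid\text{past})=\exp(-\int_0^s(\cdot)\,dx)$). Let $\mathrm{BP}_{\mathrm{Mac},\alpha}$ be the continuous-time branching process started from one individual at time $0$ in which an individual born at time $b$ has children at times $b+\sigma_1,b+\sigma_2,\dots$, using independent copies of the sequence $(\mathscr{E}_{i-1\leadsto i})_{i\ge1}$ for different individuals. With $T_1\sim\mathrm{Exp}(1)$ independent, $\varpi_{\mathrm{Mac},\alpha}$ is the law of the genealogical tree of $\mathrm{BP}_{\mathrm{Mac},\alpha}(T_1)$, a random finite rooted tree considered up to root-preserving isomorphism. Fringe: for a finite rooted tree and vertex $v$, $f_0(v,\cdot)$ denotes the subtree consisting of $v$ and all its descendants, rooted at $v$. *)

theory Defs
  imports "HOL-Probability.Probability" "HOL-Library.Multiset"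
begin

text \<open>A node is the multiset of its children subtrees; equality of values of this
  type is exactly root-preserving isomorphism of finite rooted (unordered) trees.\<close>
datatype rtree = Node "rtree multiset"

text \<open>A list ps of length n-1 codes a tree on vertices 0..n-1 (vertex k is v_(k+1));
  for k \<ge> 1 the parent of vertex k is ps!(k-1) (which is < k). The vertices 0..m-1
  form T(m).\<close>

definition rtrees :: "nat \<Rightarrow> nat list set" where
  "rtrees n = {ps. length ps = n - 1 \<and> (\<forall>j<length ps. ps ! j \<le> j)}"

text \<open>Degree of vertex k in T(m) (m \<ge> k+1): number of children (+1 if not the root),
  with the convention deg(v_i,i)=1 and T(0)=T(1).\<close>
definition deg :: "nat list \<Rightarrow> nat \<Rightarrow> nat \<Rightarrow> nat" where
  "deg ps k m = (if m \<le> 1 then 1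
      else card {j \<in> {1..<m}. ps ! (j - 1) = k} + (if k = 0 then 0 else 1))"

text \<open>Given the current tree ps with n = length ps + 1 vertices (n \<ge> 2), the probability
  that v_(n+1) attaches to vertex v: average over the delay \<xi> ~ \<mu> of the choice in
  T(floor(n - n \<xi>)) with probability proportional to deg + \<alpha>.\<close>
definition attach_prob :: "real measure \<Rightarrow> real \<Rightarrow> nat list \<Rightarrow> nat \<Rightarrow> real" where
  "attach_prob \<mu> \<alpha> ps v =
     (let n = length ps + 1 in
      \<Sum>m\<in>{0..n}. measure \<mu> {\<xi>. nat \<lfloor>real n - real n * \<xi>\<rfloor> = m} *
        (if v < max 1 m
         then (real (deg ps v m) + \<alpha>) / (\<Sum>u<max 1 m. (real (deg ps u m) + \<alpha>))
         else 0))"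

fun tprob :: "real measure \<Rightarrow> real \<Rightarrow> nat \<Rightarrow> nat list \<Rightarrow> real" where
  "tprob \<mu> \<alpha> 0 ps = (if ps = [] then 1 else 0)"
| "tprob \<mu> \<alpha> (Suc 0) ps = (if ps = [] then 1 else 0)"
| "tprob \<mu> \<alpha> (Suc (Suc 0)) ps = (if ps = [0] then 1 else 0)"
| "tprob \<mu> \<alpha> (Suc (Suc (Suc n))) ps =
     (if length ps = Suc (Suc n)
      then tprob \<mu> \<alpha> (Suc (Suc n)) (butlast ps) * attach_prob \<mu> \<alpha> (butlast ps) (last ps)
      else 0)"

definition children :: "nat list \<Rightarrow> nat \<Rightarrow> nat list" where
  "children ps k = filter (\<lambda>j. ps ! (j - 1) = k) [1..<length ps + 1]"

primrec fr :: "nat \<Rightarrow> nat list \<Rightarrow> nat \<Rightarrow> rtree" where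
  "fr 0 ps k = Node {#}"
| "fr (Suc f) ps k = Node (mset (map (fr f ps) (children ps k)))"

text \<open>Fringe subtree f_0(v,T) at vertex k (fuel = number of vertices exceeds the depth).\<close>
definition fringe :: "nat list \<Rightarrow> nat \<Rightarrow> rtree" where
  "fringe ps k = fr (length ps + 1) ps k"

text \<open>h(x) = 1/(2+\<alpha>) \<integral>_[0,x] e^u dF_\<eta>(u), with \<eta> = -log(1-\<xi>) (\<eta> = \<infinity> iff \<xi> = 1).\<close>
definition hfun :: "real measure \<Rightarrow> real \<Rightarrow> real \<Rightarrow> real" where
  "hfun \<mu> \<alpha> x = 1 / (2 + \<alpha>) *
     (\<integral>\<xi>. (if \<xi> < 1 \<and> - ln (1 - \<xi>) \<le> x then exp (- ln (1 - \<xi>)) else 0) \<partial>\<mu>)"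

text \<open>Hazard of E_(i\<leadsto>i+1) given sg j = \<sigma>_j for j \<le> i.\<close>
definition hazard :: "real measure \<Rightarrow> real \<Rightarrow> (nat \<Rightarrow> real) \<Rightarrow> nat \<Rightarrow> real \<Rightarrow> real" where
  "hazard \<mu> \<alpha> sg i x = (\<Sum>j\<le>i. hfun \<mu> \<alpha> (x + sg i - sg j)) + \<alpha> * hfun \<mu> \<alpha> (x + sg i)"

text \<open>Individuals are Ulam-Harris labels (nat lists); e u i is E_(i\<leadsto>i+1) of individual u.
  sig e u k = \<sigma>_k of individual u.\<close>
definition sig :: "(nat list \<Rightarrow> nat \<Rightarrow> ereal) \<Rightarrow> nat list \<Rightarrow> nat \<Rightarrow> ereal" where
  "sig e u k = (\<Sum>j<k. e u j)"

text \<open>Birth time: the root is born at 0; the child u@[i] is born at birth u + \<sigma>_(i+1).\<close>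
definition birth :: "(nat list \<Rightarrow> nat \<Rightarrow> ereal) \<Rightarrow> nat list \<Rightarrow> ereal" where
  "birth e u = (\<Sum>k<length u. sig e (take k u) (u ! k + 1))"

definition pop :: "(nat list \<Rightarrow> nat \<Rightarrow> ereal) \<Rightarrow> real \<Rightarrow> nat list set" where
  "pop e T = {u. birth e u \<le> ereal T}"

primrec gt :: "nat \<Rightarrow> (nat list \<Rightarrow> nat \<Rightarrow> ereal) \<Rightarrow> real \<Rightarrow> nat list \<Rightarrow> rtree" where
  "gt 0 e T u = Node {#}"
| "gt (Suc f) e T u =
     Node (mset (map (\<lambda>i. gt f e T (u @ [i])) (sorted_list_of_set {i. birth e (u @ [i]) \<le> ereal T})))"

text \<open>Genealogical tree of the process at time T (meaningful when pop e T is finite).\<close>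
definition gen_tree :: "(nat list \<Rightarrow> nat \<Rightarrow> ereal) \<Rightarrow> real \<Rightarrow> rtree" where
  "gen_tree e T = gt (Suc (card (pop e T))) e T []"

definition past_alg :: "'a measure \<Rightarrow> (nat list \<Rightarrow> nat \<Rightarrow> 'a \<Rightarrow> ereal) \<Rightarrow> nat list \<Rightarrow> nat \<Rightarrow> 'a measure" where
  "past_alg M E u i = sigma (space M) {E u j -` A \<inter> space M | j A. j < i \<and> A \<in> sets borel}"

end

theory Submission
  imports Defs "HOL-Real_Asymp.Real_Asymp"
begin

text \<open>The descendants of a vertex v evolve autonomously: given T(m), the probability that
  the next vertex attaches to a descendant w of v depends only on the arrival times of w and of
  the children of w. Up to an error of order 1/v^2 per step, distinct descendants of v acquire
  children independently, so the probability that the fringe of v in T(n) is a given planar tree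
  differs by at most a constant times n/v^2 from a nested sum over arrival times. In the
  logarithmic time t = log(m/n) this is a nested Riemann sum, which converges by dominated
  convergence to a nested integral over the hazard rates of the limit process, and a uniformly
  chosen v has -t asymptotically Exp(1). The same nested integral is the probability that the
  branching process, run for an Exp(1) time, has the given planar genealogy: the law of each gap
  given the past has a density, and distinct individuals are independent. Finally, a rooted tree
  has finitely many planar versions.\<close>

subsection \<open>Match probabilities for independent families\<close>

text \<open>The predicted match probability of a vertex is a product of factors belonging to
  distinct descendants, and one arrival changes at most one factor. Treating the factors as
  independent therefore only adds products of two small increments; this is the whole difference
  between the tree and independent families. Patterns are planar because the nested sums run over
  increasing arrival times: the i-th child to arrive is matched with the i-th subpattern. The
  function h is monotone but jumps where the delay has atoms, so rates converge only outside a
  countable set of times, and survival functions may fail to be differentiable. Hence sums are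
  rewritten exactly as integrals of step functions, and the mass of the first-event density is
  computed from a quadratic estimate. On the limit side the conditional laws are given for each
  fixed s up to a null set; they are used only after integration against weights measurable in the
  past, where such null sets disappear. The root has no edge to a parent and obeys another degree
  rule, but it is one vertex among n.\<close>

text \<open>Planar trees with the children in order of birth. The leaf Any stands for an arbitrary subtree,
  so that a condition on the number of children is a pattern Tree [Any, ..., Any].\<close>

datatype pattern = Any | Tree "pattern list"

definition delayed_size :: "nat \<Rightarrow> real \<Rightarrow> nat" where
  "delayed_size m \<xi> = nat \<lfloor>real m - real m * \<xi>\<rfloor>"

locale macro_delay =
  fixes \<mu> :: "real measure" and \<alpha> :: real
  assumes alpha: "0 \<le> \<alpha>"
    and mu_prob: "prob_space \<mu>"
    and mu_borel [measurable_cong]: "sets \<mu> = sets borel"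
    and mu_supp: "measure \<mu> {0..1} = 1"
begin

sublocale mu: prob_space \<mu>
  by (rule mu_prob)

lemma space_mu [simp]: "space \<mu> = UNIV"
  using sets_eq_imp_space_eq[OF mu_borel] by simp

lemma prob_mu_UNIV [simp]: "measure \<mu> UNIV = 1"
  using mu.prob_space by simp

lemma AE_mu: "AE \<xi> in \<mu>. 0 \<le> \<xi> \<and> \<xi> \<le> 1"
proof -
  have "AE \<xi> in \<mu>. \<xi> \<in> {0..1}"
    using mu_supp by (subst mu.AE_in_set_eq_1) (auto simp: mu_borel)
  then show ?thesis by simp
qed

lemma delayed_size_measurable [measurable]: "delayed_size m \<in> measurable \<mu> (count_space UNIV)"
  unfolding delayed_size_def by measurable

lemma delayed_size_le: "0 \<le> \<xi> \<Longrightarrow> delayed_size m \<xi> \<le> m"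
  unfolding delayed_size_def by (simp add: nat_le_iff floor_le_iff) (smt (verit) mult_nonneg_nonneg of_nat_0_le_iff)

text \<open>A tree with k \<ge> 2 vertices has total weight 2(k - 1) + \<alpha> k = (2 + \<alpha>) k
  - 2, see \<open>sum_deg\<close>. So this is the mean, over the delay, of the probability carried
  by one unit of weight, on the event that the vertex w is already present in the delayed tree. A
  non-root vertex owes one such unit to itself (the edge to its parent) and one to each visible
  child.\<close>

definition attach_kernel :: "nat \<Rightarrow> nat \<Rightarrow> real" where
  "attach_kernel m w = (\<integral>\<xi>. (if w < delayed_size m \<xi> then 1 / ((2 + \<alpha>) * real (delayed_size m \<xi>) - 2) else 0) \<partial>\<mu>)"

text \<open>The list consists of a vertex followed by its children. The minimum with 1 has no effect on
  lists coming from a tree, see attach_rate_eq.\<close>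

definition attach_rate :: "nat \<Rightarrow> nat list \<Rightarrow> real" where
  "attach_rate m xs = min 1 ((\<Sum>w\<leftarrow>xs. attach_kernel m w) + \<alpha> * attach_kernel m (hd xs))"

text \<open>In a process where each vertex acquires its children independently of the others: the probability
  that the vertex hd xs, whose other entries are its children at time m, has exactly length Gs
  further children by time n, weighted with the values of Gs at their arrival times.\<close>

primrec forest_prob :: "nat \<Rightarrow> (nat \<Rightarrow> real) list \<Rightarrow> nat \<Rightarrow> nat list \<Rightarrow> real" where
  "forest_prob n [] m xs = (\<Prod>l=m..<n. 1 - attach_rate l xs)"
| "forest_prob n (G # Gs) m xs =
    (\<Sum>k=m..<n. (\<Prod>l=m..<k. 1 - attach_rate l xs) * attach_rate k xs * (G k * forest_prob n Gs (Suc k) (xs @ [k])))"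

primrec match_prob :: "nat \<Rightarrow> pattern \<Rightarrow> nat \<Rightarrow> real" where
  "match_prob n Any = (\<lambda>w. 1)"
| "match_prob n (Tree ts) = (\<lambda>w. forest_prob n (map (match_prob n) ts) (Suc w) [w])"

text \<open>A vertex w is visible only in trees of size k \<ge> w + 1, whose total weight is at
  least 2k - 2 \<ge> 2w. The bound is free of k and hence of the delay; every estimate of order 1/v
  below comes from it.\<close>

lemma attach_kernel_bounds:
  assumes "1 \<le> w"
  shows "0 \<le> (if w < k then 1 / ((2 + \<alpha>) * real k - 2) else 0)"
    and "(if w < k then 1 / ((2 + \<alpha>) * real k - 2) else 0) \<le> 1 / (2 * real w)"
proof -
  have *: "2 * real w \<le> (2 + \<alpha>) * real k - 2" if "w < k"
  proof -
    have "real w + 1 \<le> real k" using that by linarith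
    moreover have "0 \<le> \<alpha> * real k" using alpha by simp
    ultimately show ?thesis by (simp add: algebra_simps)
  qed
  show "0 \<le> (if w < k then 1 / ((2 + \<alpha>) * real k - 2) else 0)"
    using * assms by (auto intro!: divide_nonneg_nonneg)
  show "(if w < k then 1 / ((2 + \<alpha>) * real k - 2) else 0) \<le> 1 / (2 * real w)"
    using * assms by (auto intro!: divide_left_mono)
qed

lemma attach_kernel_integrable:
  assumes "1 \<le> w"
  shows "integrable \<mu> (\<lambda>\<xi>. if w < delayed_size m \<xi> then 1 / ((2 + \<alpha>) * real (delayed_size m \<xi>) - 2) else 0)"
  by (rule mu.integrable_const_bound[where B="1 / (2 * real w)"])
     (use attach_kernel_bounds[OF assms] in \<open>auto simp del: divide_le_eq_1 split del: if_split\<close>)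

lemma attach_kernel_nonneg: "1 \<le> w \<Longrightarrow> 0 \<le> attach_kernel m w"
  unfolding attach_kernel_def by (rule integral_nonneg_AE) (use attach_kernel_bounds in auto)

lemma attach_kernel_le:
  assumes "1 \<le> w" shows "attach_kernel m w \<le> 1 / (2 * real w)"
proof -
  have "attach_kernel m w \<le> (\<integral>\<xi>. 1 / (2 * real w) \<partial>\<mu>)"
    unfolding attach_kernel_def by (rule integral_mono[OF attach_kernel_integrable[OF assms]]) (use attach_kernel_bounds[OF assms] in auto)
  then show ?thesis by simp
qed

lemma attach_ratio_bounds:
  assumes "xs \<noteq> []" "\<forall>w\<in>set xs. v \<le> w" "1 \<le> v"
  shows "0 \<le> (\<Sum>w\<leftarrow>xs. attach_kernel m w) + \<alpha> * attach_kernel m (hd xs)"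
    and "(\<Sum>w\<leftarrow>xs. attach_kernel m w) + \<alpha> * attach_kernel m (hd xs) \<le> (real (length xs) + \<alpha>) / (2 * real v)"
proof -
  have le: "attach_kernel m w \<le> 1 / (2 * real v)" if "v \<le> w" for w
  proof -
    have "attach_kernel m w \<le> 1 / (2 * real w)" using attach_kernel_le that assms(3) by simp
    also have "\<dots> \<le> 1 / (2 * real v)" using that assms(3) by (auto intro!: divide_left_mono)
    finally show ?thesis .
  qed
  have hd: "v \<le> hd xs" using assms by simp
  have "0 \<le> (\<Sum>w\<leftarrow>xs. attach_kernel m w)"
    using assms(2,3) by (intro sum_list_nonneg) (auto intro!: attach_kernel_nonneg)
  then show "0 \<le> (\<Sum>w\<leftarrow>xs. attach_kernel m w) + \<alpha> * attach_kernel m (hd xs)"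
    using alpha attach_kernel_nonneg[of "hd xs" m] hd assms(3) by auto
  have "(\<Sum>w\<leftarrow>xs. attach_kernel m w) \<le> (\<Sum>w\<leftarrow>xs. 1 / (2 * real v))"
    by (rule sum_list_mono) (use assms(2) le in auto)
  also have "\<dots> = real (length xs) / (2 * real v)"
    by (simp add: sum_list_triv)
  finally have "(\<Sum>w\<leftarrow>xs. attach_kernel m w) + \<alpha> * attach_kernel m (hd xs) \<le> real (length xs) / (2 * real v) + \<alpha> * (1 / (2 * real v))"
    using mult_left_mono[OF le[OF hd] alpha] by linarith
  then show "(\<Sum>w\<leftarrow>xs. attach_kernel m w) + \<alpha> * attach_kernel m (hd xs) \<le> (real (length xs) + \<alpha>) / (2 * real v)"
    by (simp add: add_divide_distrib)
qed

lemma attach_rate_bounds: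
  assumes "xs \<noteq> []" "\<forall>w\<in>set xs. v \<le> w" "1 \<le> v"
  shows "0 \<le> attach_rate m xs" "attach_rate m xs \<le> 1"
    and "attach_rate m xs \<le> (real (length xs) + \<alpha>) / (2 * real v)"
  using attach_ratio_bounds[OF assms, of m] by (auto simp: attach_rate_def)

text \<open>For independent trials with success probabilities \<open>a l\<close>, the terms on the
  left are the probabilities that the first success is at k.\<close>

lemma sum_first_success:
  fixes a :: "nat \<Rightarrow> real"
  assumes "m \<le> n"
  shows "(\<Sum>k=m..<n. (\<Prod>l=m..<k. 1 - a l) * a k) = 1 - (\<Prod>l=m..<n. 1 - a l)"
  using assms by (induction n rule: dec_induct) (auto simp: algebra_simps)

text \<open>The arrival time of the next child has at most total mass 1 by
  \<open>sum_first_success\<close>, and everything it is weighted with lies in [0,1]. The values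
  \<open>G k\<close> are read only at arrival times k \<ge> v; restricting the hypothesis to these
  admits \<open>match_prob\<close>, which is controlled only from 1 on.\<close>

lemma forest_prob_bounds:
  assumes "xs \<noteq> []" "\<forall>w\<in>set xs. v \<le> w" "1 \<le> v" "v \<le> m"
    and "\<forall>G\<in>set Gs. \<forall>k\<ge>v. 0 \<le> G k \<and> G k \<le> 1"
  shows "0 \<le> forest_prob n Gs m xs \<and> forest_prob n Gs m xs \<le> 1"
  using assms
proof (induction Gs arbitrary: m xs)
  case Nil
  note b = attach_rate_bounds[OF Nil(1-3)]
  show ?case using b by (auto intro!: prod_nonneg prod_le_1)
next
  case (Cons G Gs)
  note b = attach_rate_bounds[OF Cons.prems(1-3)]
  have IH: "0 \<le> forest_prob n Gs (Suc k) (xs @ [k]) \<and> forest_prob n Gs (Suc k) (xs @ [k]) \<le> 1" if "m \<le> k" for k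
    by (rule Cons.IH) (use Cons.prems that in auto)
  have G: "0 \<le> G k * forest_prob n Gs (Suc k) (xs @ [k]) \<and> G k * forest_prob n Gs (Suc k) (xs @ [k]) \<le> 1" if "m \<le> k" for k
    using IH[OF that] Cons.prems(4,5) that by (auto intro!: mult_le_one)
  have p: "0 \<le> (\<Prod>l=m..<k. 1 - attach_rate l xs)" for k
    using b by (intro prod_nonneg) auto
  have nn: "0 \<le> forest_prob n (G # Gs) m xs"
    unfolding forest_prob.simps by (intro sum_nonneg mult_nonneg_nonneg[OF mult_nonneg_nonneg[OF p b(1)]]) (use G in auto)
  show ?case
  proof (cases "m \<le> n")
    case True
    have "forest_prob n (G # Gs) m xs \<le> (\<Sum>k=m..<n. (\<Prod>l=m..<k. 1 - attach_rate l xs) * attach_rate k xs)"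
      unfolding forest_prob.simps
    proof (rule sum_mono)
      fix k assume "k \<in> {m..<n}"
      then show "(\<Prod>l=m..<k. 1 - attach_rate l xs) * attach_rate k xs * (G k * forest_prob n Gs (Suc k) (xs @ [k]))
         \<le> (\<Prod>l=m..<k. 1 - attach_rate l xs) * attach_rate k xs"
        using G[of k] mult_nonneg_nonneg[OF p[of k] b(1)[of k]] by (intro mult_left_le) auto
    qed
    also have "\<dots> \<le> 1" unfolding sum_first_success[OF True] using p by simp
    finally show ?thesis using nn by simp
  next
    case False
    then show ?thesis by simp
  qed
qed

lemma match_prob_bounds: "1 \<le> w \<Longrightarrow> 0 \<le> match_prob n S w \<and> match_prob n S w \<le> 1"
proof (induction S arbitrary: w)
  case (Tree ts)
  show ?case unfolding match_prob.simps
    by (rule forest_prob_bounds[where v=w]) (use Tree in auto)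
qed simp

text \<open>First-step analysis: either nothing attaches at time m, or m becomes the next child.
  This turns the recursion over children into one over time, as needed for the comparison with the
  tree process.\<close>

lemma forest_prob_step:
  assumes "m < n"
  shows "forest_prob n [] m xs = (1 - attach_rate m xs) * forest_prob n [] (Suc m) xs"
    and "forest_prob n (G # Gs) m xs = (1 - attach_rate m xs) * forest_prob n (G # Gs) (Suc m) xs
           + attach_rate m xs * (G m * forest_prob n Gs (Suc m) (xs @ [m]))"
proof -
  have split: "{m..<n} = insert m {Suc m..<n}" using assms by auto
  have P: "(\<Prod>l=m..<k. 1 - attach_rate l xs) = (1 - attach_rate m xs) * (\<Prod>l=Suc m..<k. 1 - attach_rate l xs)" if "m < k" for k
    using that by (simp add: prod.atLeast_Suc_lessThan)
  show "forest_prob n [] m xs = (1 - attach_rate m xs) * forest_prob n [] (Suc m) xs" using P[OF assms] by simp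
  have "(\<Sum>k=Suc m..<n. (\<Prod>l=m..<k. 1 - attach_rate l xs) * attach_rate k xs * (G k * forest_prob n Gs (Suc k) (xs @ [k])))
     = (1 - attach_rate m xs) * forest_prob n (G # Gs) (Suc m) xs"
    unfolding forest_prob.simps sum_distrib_left using P by (intro sum.cong) (auto simp: mult.assoc)
  then show "forest_prob n (G # Gs) m xs = (1 - attach_rate m xs) * forest_prob n (G # Gs) (Suc m) xs
           + attach_rate m xs * (G m * forest_prob n Gs (Suc m) (xs @ [m]))"
    using assms by (simp add: sum.atLeast_Suc_lessThan)
qed

end

subsection \<open>One step of the tree process\<close>

text \<open>F p is the value of a quantity after the next vertex attaches to p, x its value if the
  attachment is outside D, and z its current value. The last condition says that the expected
  new value is z up to second order. The constants are chosen such that they multiply when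
  quantities with disjoint D are multiplied, see one_step_mult.\<close>

definition one_step :: "(nat \<Rightarrow> real) \<Rightarrow> nat \<Rightarrow> nat set \<Rightarrow> real \<Rightarrow> real \<Rightarrow> (nat \<Rightarrow> real) \<Rightarrow> real \<Rightarrow> real \<Rightarrow> bool" where
  "one_step w m D \<Gamma> \<epsilon> F x z \<longleftrightarrow>
     (\<forall>p<m. 0 \<le> F p \<and> F p \<le> 1) \<and> 0 \<le> x \<and> x \<le> 1 \<and> 0 \<le> z \<and> z \<le> 1 \<and>
     (\<forall>p<m. p \<notin> D \<longrightarrow> F p = x) \<and>
     (\<Sum>p<m. w p * \<bar>F p - x\<bar>) \<le> (\<Gamma> - 1) / 2 * \<epsilon> \<and>
     \<bar>x + (\<Sum>p<m. w p * (F p - x)) - z\<bar> \<le> (\<Gamma> - 1) / 2 * \<epsilon>\<^sup>2"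

lemma one_step_mono:
  assumes "one_step w m D \<Gamma> \<epsilon> F x z" "D \<subseteq> D'" "\<Gamma> \<le> \<Gamma>'" "0 \<le> \<epsilon>"
  shows "one_step w m D' \<Gamma>' \<epsilon> F x z"
proof -
  have "(\<Gamma> - 1) / 2 * \<epsilon> \<le> (\<Gamma>' - 1) / 2 * \<epsilon>" "(\<Gamma> - 1) / 2 * \<epsilon>\<^sup>2 \<le> (\<Gamma>' - 1) / 2 * \<epsilon>\<^sup>2"
    using assms(3,4) by (auto intro!: mult_right_mono)
  then show ?thesis using assms(1,2) unfolding one_step_def by fastforce
qed

lemma one_step_const: "0 \<le> x \<Longrightarrow> x \<le> 1 \<Longrightarrow> one_step w m D 1 \<epsilon> (\<lambda>_. x) x x"
  unfolding one_step_def by simp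

text \<open>Since D1 and D2 are disjoint, every attachment leaves one of the factors at its value x1
  or x2, so the mean increment of the product is exactly d1 * x2 + x1 * d2. The product of the two
  predictions also contains d1 * d2, which is of second order.\<close>

lemma one_step_mult:
  assumes n1: "one_step w m D1 \<Gamma>1 \<epsilon> F1 x1 z1" and n2: "one_step w m D2 \<Gamma>2 \<epsilon> F2 x2 z2"
    and disj: "D1 \<inter> D2 = {}" and w: "\<And>p. 0 \<le> w p"
    and G: "1 \<le> \<Gamma>1" "1 \<le> \<Gamma>2" and e: "0 \<le> \<epsilon>" "\<epsilon> \<le> 1"
  shows "one_step w m (D1 \<union> D2) (\<Gamma>1 * \<Gamma>2) \<epsilon> (\<lambda>p. F1 p * F2 p) (x1 * x2) (z1 * z2)"
proof -
  note n1' = n1[unfolded one_step_def] and n2' = n2[unfolded one_step_def]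
  define d1 where "d1 = (\<Sum>p<m. w p * (F1 p - x1))"
  define d2 where "d2 = (\<Sum>p<m. w p * (F2 p - x2))"
  define A1 where "A1 = (\<Gamma>1 - 1) / 2 * \<epsilon>"
  define A2 where "A2 = (\<Gamma>2 - 1) / 2 * \<epsilon>"
  have A: "0 \<le> A1" "0 \<le> A2" using G e by (auto simp: A1_def A2_def)
  have S1: "(\<Sum>p<m. w p * \<bar>F1 p - x1\<bar>) \<le> A1" and S2: "(\<Sum>p<m. w p * \<bar>F2 p - x2\<bar>) \<le> A2"
    and E1: "\<bar>x1 + d1 - z1\<bar> \<le> A1 * \<epsilon>" and E2: "\<bar>x2 + d2 - z2\<bar> \<le> A2 * \<epsilon>"
    using n1' n2' by (auto simp: A1_def A2_def d1_def d2_def power2_eq_square)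
  have split: "F1 p * F2 p - x1 * x2 = (F1 p - x1) * x2 + x1 * (F2 p - x2)" if "p < m" for p
    using n1' n2' disj that by (cases "p \<in> D1") (auto simp: algebra_simps)
  have "\<bar>d1\<bar> \<le> (\<Sum>p<m. \<bar>w p * (F1 p - x1)\<bar>)" unfolding d1_def by (rule sum_abs)
  also have "\<dots> \<le> A1" using S1 w by (simp add: abs_mult)
  finally have d1: "\<bar>d1\<bar> \<le> A1" .
  have "\<bar>d2\<bar> \<le> (\<Sum>p<m. \<bar>w p * (F2 p - x2)\<bar>)" unfolding d2_def by (rule sum_abs)
  also have "\<dots> \<le> A2" using S2 w by (simp add: abs_mult)
  finally have d2: "\<bar>d2\<bar> \<le> A2" .
  have "(\<Sum>p<m. w p * \<bar>F1 p * F2 p - x1 * x2\<bar>) \<le> (\<Sum>p<m. w p * \<bar>F1 p - x1\<bar> + w p * \<bar>F2 p - x2\<bar>)"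
  proof (rule sum_mono)
    fix p assume "p \<in> {..<m}"
    then have p: "p < m" by simp
    have "\<bar>F1 p * F2 p - x1 * x2\<bar> \<le> \<bar>(F1 p - x1) * x2\<bar> + \<bar>x1 * (F2 p - x2)\<bar>"
      unfolding split[OF p] by (rule abs_triangle_ineq)
    also have "\<dots> \<le> \<bar>F1 p - x1\<bar> + \<bar>F2 p - x2\<bar>"
      using n1' n2' by (auto simp: abs_mult intro!: add_mono mult_left_le mult_left_le_one_le)
    finally have "w p * \<bar>F1 p * F2 p - x1 * x2\<bar> \<le> w p * (\<bar>F1 p - x1\<bar> + \<bar>F2 p - x2\<bar>)"
      using w by (intro mult_left_mono) auto
    then show "w p * \<bar>F1 p * F2 p - x1 * x2\<bar> \<le> w p * \<bar>F1 p - x1\<bar> + w p * \<bar>F2 p - x2\<bar>"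
      by (simp add: algebra_simps)
  qed
  also have "\<dots> \<le> A1 + A2" using S1 S2 by (simp add: sum.distrib)
  also have "\<dots> \<le> (\<Gamma>1 * \<Gamma>2 - 1) / 2 * \<epsilon>"
  proof -
    have "0 \<le> (\<Gamma>1 - 1) * (\<Gamma>2 - 1) * \<epsilon>" using G e by simp
    then show ?thesis unfolding A1_def A2_def by (simp add: field_simps)
  qed
  finally have first: "(\<Sum>p<m. w p * \<bar>F1 p * F2 p - x1 * x2\<bar>) \<le> (\<Gamma>1 * \<Gamma>2 - 1) / 2 * \<epsilon>" .
  have "(\<Sum>p<m. w p * (F1 p * F2 p - x1 * x2)) = (\<Sum>p<m. w p * (F1 p - x1) * x2 + x1 * (w p * (F2 p - x2)))"
  proof (intro sum.cong refl)
    fix p assume "p \<in> {..<m}"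
    then have "p < m" by simp
    show "w p * (F1 p * F2 p - x1 * x2) = w p * (F1 p - x1) * x2 + x1 * (w p * (F2 p - x2))"
      unfolding split[OF \<open>p < m\<close>] by (simp add: algebra_simps)
  qed
  also have "\<dots> = d1 * x2 + x1 * d2"
    unfolding d1_def d2_def by (simp add: sum.distrib sum_distrib_left sum_distrib_right)
  finally have eq: "(\<Sum>p<m. w p * (F1 p * F2 p - x1 * x2)) = d1 * x2 + x1 * d2" .
  have "x1 * x2 + (d1 * x2 + x1 * d2) - z1 * z2
      = x1 * (x2 + d2 - z2) + d1 * (x2 + d2 - z2) - d1 * d2 + (x1 + d1 - z1) * z2"
    by (simp add: algebra_simps)
  also have "\<bar>\<dots>\<bar> \<le> \<bar>x1 * (x2 + d2 - z2)\<bar> + \<bar>d1 * (x2 + d2 - z2)\<bar> + \<bar>d1 * d2\<bar> + \<bar>(x1 + d1 - z1) * z2\<bar>"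
    by linarith
  also have "\<dots> \<le> A2 * \<epsilon> + A1 * (A2 * \<epsilon>) + A1 * A2 + A1 * \<epsilon>"
  proof (intro add_mono)
    have "\<bar>x1\<bar> * \<bar>x2 + d2 - z2\<bar> \<le> 1 * (A2 * \<epsilon>)" using n1' E2 by (intro mult_mono) auto
    then show "\<bar>x1 * (x2 + d2 - z2)\<bar> \<le> A2 * \<epsilon>" by (simp add: abs_mult)
    show "\<bar>d1 * (x2 + d2 - z2)\<bar> \<le> A1 * (A2 * \<epsilon>)"
      unfolding abs_mult using d1 E2 A by (intro mult_mono) auto
    show "\<bar>d1 * d2\<bar> \<le> A1 * A2"
      unfolding abs_mult using d1 d2 A by (intro mult_mono) auto
    have "\<bar>x1 + d1 - z1\<bar> * \<bar>z2\<bar> \<le> (A1 * \<epsilon>) * 1" using n2' E1 A e by (intro mult_mono) auto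
    then show "\<bar>(x1 + d1 - z1) * z2\<bar> \<le> A1 * \<epsilon>" by (simp add: abs_mult)
  qed
  \<comment> \<open>The two cross terms together are at most 2 * A1 * A2 = (\<Gamma>1 - 1) *
    (\<Gamma>2 - 1) / 2 times the square of \<epsilon>, exactly what completes the linear terms to
    \<Gamma>1 * \<Gamma>2 - 1. This is the origin of the factor 1/2 in
    \<open>one_step\<close>.\<close>
  also have "\<dots> \<le> (\<Gamma>1 * \<Gamma>2 - 1) / 2 * \<epsilon>\<^sup>2"
  proof -
    have "A1 * (A2 * \<epsilon>) = A1 * A2 * \<epsilon>" by simp
    also have "\<dots> \<le> A1 * A2" using A e by (intro mult_left_le) auto
    finally have "A2 * \<epsilon> + A1 * (A2 * \<epsilon>) + A1 * A2 + A1 * \<epsilon> \<le> A2 * \<epsilon> + 2 * (A1 * A2) + A1 * \<epsilon>" by simp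
    also have "\<dots> = (\<Gamma>1 * \<Gamma>2 - 1) / 2 * \<epsilon>\<^sup>2"
      unfolding A1_def A2_def by (simp add: field_simps power2_eq_square)
    finally show ?thesis .
  qed
  finally have second: "\<bar>x1 * x2 + (\<Sum>p<m. w p * (F1 p * F2 p - x1 * x2)) - z1 * z2\<bar> \<le> (\<Gamma>1 * \<Gamma>2 - 1) / 2 * \<epsilon>\<^sup>2"
    unfolding eq .
  show ?thesis unfolding one_step_def
    using n1' n2' first second by (auto intro!: mult_nonneg_nonneg mult_le_one)
qed

lemma one_step_expectation:
  assumes "one_step w m D \<Gamma> \<epsilon> F x z" "(\<Sum>p<m. w p) = 1"
  shows "\<bar>(\<Sum>p<m. w p * F p) - z\<bar> \<le> (\<Gamma> - 1) / 2 * \<epsilon>\<^sup>2"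
proof -
  have "(\<Sum>p<m. w p * F p) = x + (\<Sum>p<m. w p * (F p - x))"
    using assms(2) by (simp add: right_diff_distrib sum_subtractf flip: sum_distrib_right)
  then show ?thesis using assms(1) by (simp add: one_step_def)
qed

section \<open>Children and descendants in recursive trees\<close>

lemma set_children: "set (children ps v) = {j \<in> {1..length ps}. ps ! (j - 1) = v}"
  by (auto simp: children_def)

lemma distinct_children: "distinct (children ps v)"
  by (simp add: children_def)

lemma children_snoc:
  "children (ps @ [p]) v = children ps v @ (if p = v then [Suc (length ps)] else [])"
proof -
  have "filter (\<lambda>j. (ps @ [p]) ! (j - 1) = v) [1..<length ps + 1] = filter (\<lambda>j. ps ! (j - 1) = v) [1..<length ps + 1]"
    by (rule filter_cong) (auto simp: nth_append)
  then show ?thesis unfolding children_def by (simp add: nth_append)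
qed

lemma rtrees_length: "ps \<in> rtrees m \<Longrightarrow> 1 \<le> m \<Longrightarrow> Suc (length ps) = m"
  by (auto simp: rtrees_def)

lemma rtrees_parent: "ps \<in> rtrees m \<Longrightarrow> 1 \<le> j \<Longrightarrow> j \<le> length ps \<Longrightarrow> ps ! (j - 1) < j"
  unfolding rtrees_def by (cases j) (auto simp: less_Suc_eq_le)

lemma children_bounds:
  assumes "ps \<in> rtrees m" "1 \<le> m" "w \<in> set (children ps v)"
  shows "v < w" "w < m"
  using assms rtrees_parent[of ps m w] rtrees_length[of ps m] by (auto simp: set_children)

lemma children_fresh: "ps \<in> rtrees m \<Longrightarrow> 1 \<le> m \<Longrightarrow> children ps m = []"
  using children_bounds[of ps m _ m] by (metis list.set_intros(1) neq_Nil_conv not_less_iff_gr_or_eq)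

definition parent_rel :: "nat list \<Rightarrow> (nat \<times> nat) set" where
  "parent_rel ps = {(j, ps ! (j - 1)) | j. 1 \<le> j \<and> j \<le> length ps}"

definition descendants :: "nat list \<Rightarrow> nat \<Rightarrow> nat set" where
  "descendants ps v = {u. (u, v) \<in> (parent_rel ps)\<^sup>*}"

lemma descendants_self: "v \<in> descendants ps v"
  by (simp add: descendants_def)

lemma child_parent_rel: "w \<in> set (children ps v) \<longleftrightarrow> (w, v) \<in> parent_rel ps"
  by (auto simp: set_children parent_rel_def)

lemma descendants_child: "w \<in> set (children ps v) \<Longrightarrow> descendants ps w \<subseteq> descendants ps v"
  by (auto simp: child_parent_rel descendants_def)

lemma descendants_ge:
  assumes "ps \<in> rtrees m" "u \<in> descendants ps v"
  shows "v \<le> u"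
proof -
  have "(u, v) \<in> (parent_rel ps)\<^sup>*" using assms(2) by (simp add: descendants_def)
  then show ?thesis
    by (induction rule: rtrancl_induct) (use rtrees_parent[OF assms(1)] in \<open>fastforce simp: parent_rel_def\<close>)+
qed

text \<open>Parents are unique, so of two ancestors of one vertex one descends from the other. If
  one child of v descended from another, the path would pass through v, although labels decrease
  strictly towards the root.\<close>

lemma descendants_siblings_disjoint:
  assumes ps: "ps \<in> rtrees m" and c: "c \<in> set (children ps v)" "c' \<in> set (children ps v)" "c \<noteq> c'"
  shows "descendants ps c \<inter> descendants ps c' = {}"
proof (rule ccontr)
  assume "\<not> ?thesis"
  then obtain u where u: "(u, c) \<in> (parent_rel ps)\<^sup>*" "(u, c') \<in> (parent_rel ps)\<^sup>*"
    by (auto simp: descendants_def)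
  have sv: "single_valued (parent_rel ps)" by (auto simp: single_valued_def parent_rel_def)
  have no: False if "(a, b) \<in> (parent_rel ps)\<^sup>*" "a \<noteq> b" "a \<in> set (children ps v)" "b \<in> set (children ps v)" for a b
  proof -
    from that(1,2) obtain y where y: "(a, y) \<in> parent_rel ps" "(y, b) \<in> (parent_rel ps)\<^sup>*"
      by (meson converse_rtranclE)
    moreover have "y = v" using y(1) that(3) sv by (auto simp: child_parent_rel single_valued_def)
    ultimately have "b \<le> v" using descendants_ge[OF ps, of v b] by (simp add: descendants_def)
    moreover have "v < b" using that(4) rtrees_parent[OF ps, of b] by (auto simp: set_children)
    ultimately show False by simp
  qed
  from single_valued_confluent[OF sv u] show False using no c by blast
qed

lemma vertex_notin_descendants_child:
  assumes "ps \<in> rtrees m" "1 \<le> m" "c \<in> set (children ps v)"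
  shows "v \<notin> descendants ps c"
  using descendants_ge[OF assms(1), of v c] children_bounds[OF assms] by auto

lemma bij_betw_rtrees_Suc:
  assumes "1 \<le> m"
  shows "bij_betw (\<lambda>(ps, p). ps @ [p]) (rtrees m \<times> {..<m}) (rtrees (Suc m))"
proof (rule bij_betwI[where g="\<lambda>qs. (butlast qs, last qs)"])
  show "(\<lambda>(ps, p). ps @ [p]) \<in> rtrees m \<times> {..<m} \<rightarrow> rtrees (Suc m)"
    using assms by (auto simp: rtrees_def nth_append less_Suc_eq)
  show "(\<lambda>qs. (butlast qs, last qs)) \<in> rtrees (Suc m) \<rightarrow> rtrees m \<times> {..<m}"
  proof
    fix qs assume qs: "qs \<in> rtrees (Suc m)"
    then have ne: "qs \<noteq> []" "length qs = m" using assms by (auto simp: rtrees_def)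
    have "last qs \<le> m - 1" using qs ne assms unfolding rtrees_def last_conv_nth[OF ne(1)] by auto
    then show "(butlast qs, last qs) \<in> rtrees m \<times> {..<m}"
      using qs ne assms by (auto simp: rtrees_def nth_butlast)
  qed
  show "(butlast (case x of (ps, p) \<Rightarrow> ps @ [p]), last (case x of (ps, p) \<Rightarrow> ps @ [p])) = x"
    if "x \<in> rtrees m \<times> {..<m}" for x using that by auto
  show "(case (butlast y, last y) of (ps, p) \<Rightarrow> ps @ [p]) = y" if "y \<in> rtrees (Suc m)" for y
    using that assms by (cases y rule: rev_cases) (auto simp: rtrees_def)
qed

text \<open>Each of the k - 1 edges is counted once at its parent and once at its child. Size 1 is
  excluded, because there the convention sets the degree to 1.\<close>

lemma sum_deg:
  assumes ps: "ps \<in> rtrees m" and k: "2 \<le> k" "k \<le> m"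
  shows "(\<Sum>u<k. real (deg ps u k) + \<alpha>) = (2 + \<alpha>) * real k - 2"
proof -
  have len: "Suc (length ps) = m" using rtrees_length[OF ps] k by simp
  have "(\<Sum>u<k. card {j \<in> {1..<k}. ps ! (j - 1) = u}) = (\<Sum>u<k. \<Sum>j \<in> {j \<in> {1..<k}. ps ! (j - 1) = u}. 1)"
    by simp
  also have "\<dots> = (\<Sum>j\<in>{1..<k}. 1)"
  proof (rule sum.group)
    show "(\<lambda>j. ps ! (j - 1)) ` {1..<k} \<subseteq> {..<k}"
    proof clarsimp
      fix j assume "Suc 0 \<le> j" "j < k"
      then show "ps ! (j - Suc 0) < k" using rtrees_parent[OF ps, of j] len k by simp
    qed
  qed auto
  finally have c: "(\<Sum>u<k. card {j \<in> {1..<k}. ps ! (j - 1) = u}) = k - 1" by simp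
  have nz: "(\<Sum>u<k. (if u = 0 then 0 else 1 :: nat)) = k - 1"
  proof -
    have "{u. u < k \<and> 0 < u} = {1..<k}" by auto
    then have "card {u. u < k \<and> 0 < u} = k - 1" by simp
    then show ?thesis by (simp add: sum.If_cases Int_def)
  qed
  have "(\<Sum>u<k. deg ps u k) = (\<Sum>u<k. card {j \<in> {1..<k}. ps ! (j - 1) = u}) + (\<Sum>u<k. if u = 0 then 0 else 1)"
    using k by (simp add: deg_def sum.distrib)
  also have "\<dots> = 2 * (k - 1)" using c nz by linarith
  finally have "(\<Sum>u<k. deg ps u k) = 2 * (k - 1)" .
  then have "(\<Sum>u<k. real (deg ps u k)) = 2 * (real k - 1)"
    using k by (simp flip: of_nat_sum add: of_nat_diff)
  then show ?thesis by (simp add: sum.distrib algebra_simps)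
qed

text \<open>The entry v of the list stands for the edge from v to its parent, which is why v must
  not be the root.\<close>

lemma deg_eq_count:
  assumes ps: "ps \<in> rtrees m" and k: "v < k" "k \<le> m" and v: "1 \<le> v"
  shows "real (deg ps v k) = (\<Sum>w\<leftarrow>v # children ps v. if w < k then 1 else 0)"
proof -
  have len: "Suc (length ps) = m" using rtrees_length[OF ps] k by simp
  have "{j \<in> {1..<k}. ps ! (j - 1) = v} = {w \<in> set (children ps v). w < k}"
    using len k by (auto simp: set_children)
  also have "card \<dots> = length (filter (\<lambda>w. w < k) (children ps v))"
    using distinct_card[OF distinct_filter[OF distinct_children], of "\<lambda>w. w < k" ps v] by (simp add: set_filter)
  finally have "card {j \<in> {1..<k}. ps ! (j - 1) = v} = length (filter (\<lambda>w. w < k) (children ps v))" .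
  moreover have "(\<Sum>w\<leftarrow>xs. if w < k then 1 else 0 :: real) = real (length (filter (\<lambda>w. w < k) xs))" for xs
    by (induction xs) auto
  ultimately show ?thesis using k v by (simp add: deg_def)
qed

section \<open>Attachment probabilities\<close>

context macro_delay
begin

lemma sum_delay:
  "(\<Sum>k\<in>{0..m}. measure \<mu> {\<xi>. nat \<lfloor>real m - real m * \<xi>\<rfloor> = k} * g k) = (\<integral>\<xi>. g (delayed_size m \<xi>) \<partial>\<mu>)"
proof -
  have meas: "{\<xi>. delayed_size m \<xi> = k} \<in> sets \<mu>" for k
    using measurable_sets[OF delayed_size_measurable, of "{k}" m] by (simp add: vimage_def)
  have "(\<integral>\<xi>. g (delayed_size m \<xi>) \<partial>\<mu>) = (\<integral>\<xi>. (\<Sum>k\<in>{0..m}. g k * indicator {\<xi>. delayed_size m \<xi> = k} \<xi>) \<partial>\<mu>)"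
  proof (rule integral_cong_AE)
    show "(\<lambda>\<xi>. g (delayed_size m \<xi>)) \<in> borel_measurable \<mu>" by measurable
    show "(\<lambda>\<xi>. \<Sum>k\<in>{0..m}. g k * indicator {\<xi>. delayed_size m \<xi> = k} \<xi>) \<in> borel_measurable \<mu>"
      using meas by (intro borel_measurable_sum borel_measurable_times borel_measurable_indicator) auto
    show "AE \<xi> in \<mu>. g (delayed_size m \<xi>) = (\<Sum>k\<in>{0..m}. g k * indicator {\<xi>. delayed_size m \<xi> = k} \<xi>)"
      using AE_mu by eventually_elim
        (auto dest!: delayed_size_le[of _ m] simp: indicator_def if_distrib[of "\<lambda>x. _ * x"] sum.delta cong: if_cong)
  qed
  also have "\<dots> = (\<Sum>k\<in>{0..m}. \<integral>\<xi>. g k * indicator {\<xi>. delayed_size m \<xi> = k} \<xi> \<partial>\<mu>)"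
    by (intro Bochner_Integration.integral_sum integrable_mult_right integrable_real_indicator)
      (use meas in \<open>auto simp: less_top[symmetric]\<close>)
  also have "\<dots> = (\<Sum>k\<in>{0..m}. measure \<mu> {\<xi>. delayed_size m \<xi> = k} * g k)"
    by (simp add: mult.commute)
  finally show ?thesis by (simp add: delayed_size_def)
qed

lemma integral_sum_list:
  assumes "\<forall>w\<in>set xs. integrable \<mu> (f w)"
  shows "integrable \<mu> (\<lambda>\<xi>. \<Sum>w\<leftarrow>xs. f w \<xi> :: real)"
    and "(\<integral>\<xi>. (\<Sum>w\<leftarrow>xs. f w \<xi>) \<partial>\<mu>) = (\<Sum>w\<leftarrow>xs. \<integral>\<xi>. f w \<xi> \<partial>\<mu>)"
  using assms by (induction xs) auto

text \<open>The weight of v in the delayed tree is a sum of visibility indicators of v and its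
  children, so the mean over the delay splits into kernels. Thus the attachment probability depends
  on the tree only through the arrival times of v and its children.\<close>

lemma attach_prob_eq:
  assumes ps: "ps \<in> rtrees m" and m: "2 \<le> m" and v: "1 \<le> v"
  shows "attach_prob \<mu> \<alpha> ps v = (\<Sum>w\<leftarrow>v # children ps v. attach_kernel m w) + \<alpha> * attach_kernel m v"
proof -
  define f where "f w k = (if w < k then 1 / ((2 + \<alpha>) * real k - 2) else 0)" for w k :: nat
  define g where "g k = (if v < max 1 k
         then (real (deg ps v k) + \<alpha>) / (\<Sum>u<max 1 k. (real (deg ps u k) + \<alpha>)) else 0)" for k
  have len: "length ps + 1 = m" using rtrees_length[OF ps] m by simp
  have f_int: "integrable \<mu> (\<lambda>\<xi>. f w (delayed_size m \<xi>))" if "1 \<le> w" for w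
    using attach_kernel_integrable[OF that] by (simp add: f_def)
  have kids: "1 \<le> w" if "w \<in> set (v # children ps v)" for w
    using that children_bounds[OF ps, of w v] v m by auto
  have eq: "g k = (\<Sum>w\<leftarrow>v # children ps v. f w k) + \<alpha> * f v k" if "k \<le> m" for k
  proof (cases "v < k")
    case True
    have "g k = ((\<Sum>w\<leftarrow>v # children ps v. if w < k then 1 else 0) + \<alpha>) / ((2 + \<alpha>) * real k - 2)"
      using True v that unfolding g_def deg_eq_count[OF ps True that v, symmetric]
      by (simp add: max_def sum_deg[OF ps])
    also have "\<dots> = (\<Sum>w\<leftarrow>v # children ps v. (if w < k then 1 else 0) / ((2 + \<alpha>) * real k - 2)) + \<alpha> / ((2 + \<alpha>) * real k - 2)"
      by (simp only: add_divide_distrib divide_inverse sum_list_mult_const distrib_right)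
    also have "\<dots> = (\<Sum>w\<leftarrow>v # children ps v. f w k) + \<alpha> * f v k"
      using True by (intro arg_cong2[where f="(+)"] arg_cong[where f=sum_list] map_cong) (auto simp: f_def)
    finally show ?thesis .
  next
    case False
    then have "\<not> v < max 1 k" using v by auto
    moreover have "f w k = 0" if "w \<in> set (v # children ps v)" for w
      using that children_bounds(1)[OF ps, of w v] False m by (auto simp: f_def)
    ultimately show ?thesis
      by (auto simp: g_def cong: map_cong)
  qed
  have "attach_prob \<mu> \<alpha> ps v = (\<integral>\<xi>. g (delayed_size m \<xi>) \<partial>\<mu>)"
    unfolding attach_prob_def Let_def len sum_delay[symmetric] by (simp add: g_def)
  also have "\<dots> = (\<integral>\<xi>. (\<Sum>w\<leftarrow>v # children ps v. f w (delayed_size m \<xi>)) + \<alpha> * f v (delayed_size m \<xi>) \<partial>\<mu>)"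
  proof (rule integral_cong_AE)
    have "(\<lambda>\<xi>. g (delayed_size m \<xi>)) \<in> borel_measurable \<mu>" by measurable
    then show "(\<lambda>\<xi>. g (delayed_size m \<xi>)) \<in> borel_measurable \<mu>" .
    show "(\<lambda>\<xi>. (\<Sum>w\<leftarrow>v # children ps v. f w (delayed_size m \<xi>)) + \<alpha> * f v (delayed_size m \<xi>)) \<in> borel_measurable \<mu>"
      using f_int kids v by (intro borel_measurable_add borel_measurable_times borel_measurable_integrable integral_sum_list(1)) auto
    show "AE \<xi> in \<mu>. g (delayed_size m \<xi>) = (\<Sum>w\<leftarrow>v # children ps v. f w (delayed_size m \<xi>)) + \<alpha> * f v (delayed_size m \<xi>)"
      using AE_mu by eventually_elim (use eq delayed_size_le in blast)
  qed
  also have "\<dots> = (\<integral>\<xi>. (\<Sum>w\<leftarrow>v # children ps v. f w (delayed_size m \<xi>)) \<partial>\<mu>) + (\<integral>\<xi>. \<alpha> * f v (delayed_size m \<xi>) \<partial>\<mu>)"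
    using f_int kids v by (intro Bochner_Integration.integral_add integral_sum_list(1)) auto
  also have "\<dots> = (\<Sum>w\<leftarrow>v # children ps v. \<integral>\<xi>. f w (delayed_size m \<xi>) \<partial>\<mu>) + (\<integral>\<xi>. \<alpha> * f v (delayed_size m \<xi>) \<partial>\<mu>)"
    using f_int kids by (subst integral_sum_list(2)) auto
  also have "\<dots> = (\<Sum>w\<leftarrow>v # children ps v. attach_kernel m w) + \<alpha> * attach_kernel m v"
    by (simp add: f_def attach_kernel_def)
  finally show ?thesis .
qed

lemma attach_prob_nonneg: "0 \<le> attach_prob \<mu> \<alpha> ps v"
  unfolding attach_prob_def Let_def using alpha
  by (intro sum_nonneg mult_nonneg_nonneg) (auto intro!: divide_nonneg_nonneg sum_nonneg add_nonneg_nonneg)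

lemma sum_attach_prob:
  assumes ps: "ps \<in> rtrees m" and m: "2 \<le> m"
  shows "(\<Sum>v<m. attach_prob \<mu> \<alpha> ps v) = 1"
proof -
  have len: "length ps + 1 = m" using rtrees_length[OF ps] m by simp
  define d where "d k v = real (deg ps v k) + \<alpha>" for k v
  have one: "(\<Sum>v<m. if v < max 1 k then d k v / (\<Sum>u<max 1 k. d k u) else 0) = 1" if "k \<le> m" for k
  proof -
    have pos: "0 < (\<Sum>u<max 1 k. d k u)"
    proof (cases "2 \<le> k")
      case True
      then have "(\<Sum>u<max 1 k. d k u) = (2 + \<alpha>) * real k - 2"
        using sum_deg[OF ps True that] by (simp add: d_def max_def)
      moreover have "0 \<le> \<alpha> * real k" using alpha by simp
      ultimately show ?thesis using True by (simp add: algebra_simps)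
    next
      \<comment> \<open>Sizes 0 and 1 both mean the root alone, with degree 1 by convention and
        hence weight 1 + \<alpha>.\<close>
      case False
      then have "max 1 k = 1" "k \<le> 1" by auto
      then show ?thesis using alpha by (simp add: d_def deg_def)
    qed
    have "(\<Sum>v<m. if v < max 1 k then d k v / (\<Sum>u<max 1 k. d k u) else 0)
      = (\<Sum>v\<in>{..<m} \<inter> {v. v < max 1 k}. d k v / (\<Sum>u<max 1 k. d k u))"
      by (subst sum.inter_restrict) auto
    also have "{..<m} \<inter> {v. v < max 1 k} = {..<max 1 k}" using that m by auto
    also have "(\<Sum>v<max 1 k. d k v / (\<Sum>u<max 1 k. d k u)) = 1"
      using pos by (simp flip: sum_divide_distrib)
    finally show ?thesis .
  qed
  have "(\<Sum>v<m. attach_prob \<mu> \<alpha> ps v) =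
     (\<Sum>k\<in>{0..m}. measure \<mu> {\<xi>. nat \<lfloor>real m - real m * \<xi>\<rfloor> = k} *
        (\<Sum>v<m. if v < max 1 k then d k v / (\<Sum>u<max 1 k. d k u) else 0))"
    unfolding attach_prob_def Let_def len d_def sum_distrib_left by (rule sum.swap)
  also have "\<dots> = (\<Sum>k\<in>{0..m}. measure \<mu> {\<xi>. nat \<lfloor>real m - real m * \<xi>\<rfloor> = k} * 1)"
    using one by (intro sum.cong) auto
  also have "\<dots> = 1" unfolding sum_delay by simp
  finally show ?thesis .
qed

lemma attach_prob_le_1:
  assumes "ps \<in> rtrees m" "2 \<le> m" "v < m"
  shows "attach_prob \<mu> \<alpha> ps v \<le> 1"
proof -
  have "attach_prob \<mu> \<alpha> ps v \<le> (\<Sum>v<m. attach_prob \<mu> \<alpha> ps v)"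
    using assms(3) attach_prob_nonneg by (intro member_le_sum) auto
  then show ?thesis using sum_attach_prob[OF assms(1,2)] by simp
qed

lemma attach_rate_eq:
  assumes "ps \<in> rtrees m" "2 \<le> m" "1 \<le> v" "v < m"
  shows "attach_rate m (v # children ps v) = attach_prob \<mu> \<alpha> ps v"
  using attach_prob_eq[OF assms(1-3)] attach_prob_le_1[OF assms(1,2,4)] by (simp add: attach_rate_def)

section \<open>Expectations over the tree process\<close>

definition expect :: "nat \<Rightarrow> (nat list \<Rightarrow> real) \<Rightarrow> real" where
  "expect m f = (\<Sum>ps\<in>rtrees m. tprob \<mu> \<alpha> m ps * f ps)"

text \<open>The Markov property: a tree on m + 1 vertices is a tree on m vertices with the parent of
  the new vertex appended. The attachment rule governs \<open>tprob\<close> from m = 2 on.\<close>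

lemma expect_Suc:
  assumes "2 \<le> m"
  shows "expect (Suc m) f = expect m (\<lambda>ps. \<Sum>p<m. attach_prob \<mu> \<alpha> ps p * f (ps @ [p]))"
proof -
  obtain k where k: "m = Suc (Suc k)" using assms by (metis add_2_eq_Suc le_Suc_ex)
  have "expect (Suc m) f = (\<Sum>(ps, p)\<in>rtrees m \<times> {..<m}. tprob \<mu> \<alpha> (Suc m) (ps @ [p]) * f (ps @ [p]))"
    unfolding expect_def
    by (subst sum.reindex_bij_betw[OF bij_betw_rtrees_Suc, symmetric]) (use assms in \<open>auto simp: case_prod_unfold\<close>)
  also have "\<dots> = (\<Sum>ps\<in>rtrees m. \<Sum>p<m. tprob \<mu> \<alpha> (Suc m) (ps @ [p]) * f (ps @ [p]))"
    by (simp add: sum.cartesian_product)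
  also have "\<dots> = expect m (\<lambda>ps. \<Sum>p<m. attach_prob \<mu> \<alpha> ps p * f (ps @ [p]))"
    unfolding expect_def sum_distrib_left
  proof (intro sum.cong refl)
    fix ps p assume "ps \<in> rtrees m"
    then have "length ps = Suc k" using rtrees_length[of ps m] k by simp
    then show "tprob \<mu> \<alpha> (Suc m) (ps @ [p]) * f (ps @ [p]) = tprob \<mu> \<alpha> m ps * (attach_prob \<mu> \<alpha> ps p * f (ps @ [p]))"
      by (simp add: k)
  qed
  finally show ?thesis .
qed

lemma tprob_nonneg: "0 \<le> tprob \<mu> \<alpha> m ps"
proof (induction m arbitrary: ps)
  case (Suc m)
  show ?case
  proof (cases "m \<le> 1")
    case True
    then have "m = 0 \<or> m = Suc 0" by auto
    then show ?thesis by auto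
  next
    case False
    then obtain k where "m = Suc (Suc k)" by (metis One_nat_def not_less_eq_eq not0_implies_Suc le0)
    then show ?thesis using Suc attach_prob_nonneg by simp
  qed
qed simp

lemma expect_const:
  assumes "2 \<le> m" shows "expect m (\<lambda>_. c) = c"
  using assms
proof (induction m rule: dec_induct)
  case base
  have "rtrees 2 = {[0]}" by (auto simp: rtrees_def length_Suc_conv)
  then show ?case by (simp add: expect_def numeral_2_eq_2)
next
  case (step m)
  have "expect (Suc m) (\<lambda>_. c) = expect m (\<lambda>ps. \<Sum>p<m. attach_prob \<mu> \<alpha> ps p * c)"
    by (rule expect_Suc[OF step(1)])
  also have "\<dots> = expect m (\<lambda>_. c)"
    unfolding expect_def
    by (intro sum.cong refl) (use step(1) in \<open>simp add: sum_attach_prob flip: sum_distrib_right\<close>)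
  finally show ?case using step by simp
qed

lemma expect_mono: "(\<And>ps. ps \<in> rtrees m \<Longrightarrow> f ps \<le> g ps) \<Longrightarrow> expect m f \<le> expect m g"
  unfolding expect_def by (intro sum_mono mult_left_mono tprob_nonneg)

lemma expect_cong: "(\<And>ps. ps \<in> rtrees m \<Longrightarrow> f ps = g ps) \<Longrightarrow> expect m f = expect m g"
  unfolding expect_def by (intro sum.cong) auto

lemma expect_diff: "expect m (\<lambda>ps. f ps - g ps) = expect m f - expect m g"
  unfolding expect_def by (simp add: right_diff_distrib sum_subtractf)

lemma expect_sum: "expect m (\<lambda>ps. \<Sum>i\<in>I. f i ps) = (\<Sum>i\<in>I. expect m (f i))"
  unfolding expect_def by (simp add: sum_distrib_left) (rule sum.swap)

lemma expect_divide: "expect m (\<lambda>ps. f ps / c) = expect m f / c"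
  unfolding expect_def by (simp add: sum_divide_distrib)

lemma expect_abs_le:
  assumes "2 \<le> m" "\<And>ps. ps \<in> rtrees m \<Longrightarrow> \<bar>f ps\<bar> \<le> c"
  shows "\<bar>expect m f\<bar> \<le> c"
proof -
  have "expect m f \<le> expect m (\<lambda>_. c)" "expect m (\<lambda>_. - c) \<le> expect m f"
    using assms(2) by (intro expect_mono; fastforce simp: abs_le_iff)+
  then show ?thesis using expect_const[OF assms(1)] by (auto simp: abs_le_iff)
qed

text \<open>The match probability at time n predicted from the tree at time m, as if from m on the
  vertices acquired children independently: an approximate martingale in m.\<close>

primrec potential :: "nat \<Rightarrow> nat \<Rightarrow> nat list \<Rightarrow> pattern \<Rightarrow> nat \<Rightarrow> real" where
  "potential n m ps Any = (\<lambda>v. 1)"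
| "potential n m ps (Tree ts) = (\<lambda>v. let cs = children ps v in
     if length cs \<le> length ts
     then (\<Prod>i<length cs. (map (potential n m ps) ts ! i) (cs ! i)) * forest_prob n (drop (length cs) (map (match_prob n) ts)) m (v # cs)
     else 0)"

text \<open>The constant \<Gamma> of \<open>one_step\<close> for the potential. The factor of a node
  is the \<Gamma> with (\<Gamma> - 1) / 2 = (1 + \<open>length ts\<close> + \<alpha>) / 2, the bound
  of \<open>attach_rate_bounds\<close> for a vertex with at most \<open>length ts\<close> children;
  factors of different nodes multiply by \<open>one_step_mult\<close>.\<close>

primrec potential_weight :: "pattern \<Rightarrow> real" where
  "potential_weight Any = 1"
| "potential_weight (Tree ts) = (2 + real (length ts) + \<alpha>) * prod_list (map potential_weight ts)"

lemma potential_weight_ge_1: "1 \<le> potential_weight S"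
proof (induction S)
  case (Tree ts)
  then have "1 \<le> prod_list (map potential_weight ts)"
    by (induction ts) (auto intro: mult_ge1_I)
  then show ?case using alpha by (auto intro!: mult_ge1_I)
qed simp

lemma potential_fresh: "children ps v = [] \<Longrightarrow> potential n m ps S v = (case S of Any \<Rightarrow> 1 | Tree ts \<Rightarrow> forest_prob n (map (match_prob n) ts) m [v])"
  by (cases S) auto

text \<open>The potential of v is the product of the potentials of its present children and of a
  factor for its own future children. These react to attachments in disjoint sets: the descendants
  of the single children, and v itself. The bound uses a fixed v0 instead of v, so that all
  children, whose labels exceed v, share the same \<epsilon> in the induction.\<close>

lemma potential_step:
  assumes ps: "ps \<in> rtrees m" and m: "2 \<le> m" "m < n" and v0: "1 \<le> v0"
  shows "v0 \<le> v \<Longrightarrow> v < m \<Longrightarrow>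
    one_step (attach_prob \<mu> \<alpha> ps) m (descendants ps v) (potential_weight S) (1 / real v0)
      (\<lambda>p. potential n (Suc m) (ps @ [p]) S v) (potential n (Suc m) ps S v) (potential n m ps S v)"
proof (induction S arbitrary: v)
  case Any
  show ?case by (simp add: one_step_const)
next
  case (Tree ts)
  let ?w = "attach_prob \<mu> \<alpha> ps" and ?e = "1 / real v0"
  have m1: "1 \<le> m" using m by simp
  have len: "Suc (length ps) = m" using rtrees_length[OF ps m1] .
  define cs where "cs = children ps v"
  have cs: "v < c \<and> c < m" if "c \<in> set cs" for c using children_bounds[OF ps m1] that by (auto simp: cs_def)
  have e: "0 \<le> ?e" "?e \<le> 1" using v0 by auto
  have W1: "1 \<le> (\<Prod>i<c. potential_weight (ts ! i))" for c using potential_weight_ge_1 by (intro prod_ge_1) auto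
  show ?case
  proof (cases "length cs \<le> length ts")
    case False
    \<comment> \<open>Children are never lost: once v has too many, the match is ruled out for
      good.\<close>
    then have "potential n (Suc m) (ps @ [p]) (Tree ts) v = 0" for p
      by (simp add: children_snoc flip: cs_def)
    moreover have "potential n k ps (Tree ts) v = 0" for k
      using False by (simp flip: cs_def)
    ultimately show ?thesis
      using one_step_mono[OF one_step_const[of 0] subset_refl potential_weight_ge_1 e(1)]
      by (simp del: potential.simps potential_weight.simps)
  next
    case True
    define F where "F i p = potential n (Suc m) (ps @ [p]) (ts ! i) (cs ! i)" for i p
    define x where "x i = potential n (Suc m) ps (ts ! i) (cs ! i)" for i
    define z where "z i = potential n m ps (ts ! i) (cs ! i)" for i
    define L where "L = drop (length cs) (map (match_prob n) ts)"
    define xr where "xr = forest_prob n L (Suc m) (v # cs)"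
    define zr where "zr = forest_prob n L m (v # cs)"
    \<comment> \<open>After the step the own factor of v is \<open>yr\<close> if the new vertex m
      attaches to v, and \<open>xr\<close> otherwise. When no subpattern is left, a further child
      destroys the match, hence the value 0.\<close>
    define yr where "yr = (case L of [] \<Rightarrow> 0 | G # Gs \<Rightarrow> G m * forest_prob n Gs (Suc m) (v # cs @ [m]))"
    have kids: "one_step ?w m (\<Union>i<c. descendants ps (cs ! i)) (\<Prod>i<c. potential_weight (ts ! i)) ?e
        (\<lambda>p. \<Prod>i<c. F i p) (\<Prod>i<c. x i) (\<Prod>i<c. z i)" if "c \<le> length cs" for c
      using that
    proof (induction c)
      case 0
      show ?case by (simp add: one_step_const)
    next
      case (Suc c)
      have c: "cs ! c \<in> set cs" using Suc.prems by simp
      have "one_step ?w m ((\<Union>i<c. descendants ps (cs ! i)) \<union> descendants ps (cs ! c))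
        ((\<Prod>i<c. potential_weight (ts ! i)) * potential_weight (ts ! c)) ?e
        (\<lambda>p. (\<Prod>i<c. F i p) * F c p) ((\<Prod>i<c. x i) * x c) ((\<Prod>i<c. z i) * z c)"
      proof (rule one_step_mult[OF _ _ _ attach_prob_nonneg W1 potential_weight_ge_1 e])
        show "one_step ?w m (\<Union>i<c. descendants ps (cs ! i)) (\<Prod>i<c. potential_weight (ts ! i)) ?e
          (\<lambda>p. \<Prod>i<c. F i p) (\<Prod>i<c. x i) (\<Prod>i<c. z i)" using Suc by simp
        show "one_step ?w m (descendants ps (cs ! c)) (potential_weight (ts ! c)) ?e (F c) (x c) (z c)"
          unfolding F_def x_def z_def
          by (rule Tree.IH) (use Suc.prems True cs[OF c] Tree.prems in auto)
        have "descendants ps (cs ! i) \<inter> descendants ps (cs ! c) = {}" if "i < c" for i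
          using that Suc.prems distinct_children[of ps v]
          by (intro descendants_siblings_disjoint[OF ps, of _ v]) (auto simp: nth_eq_iff_index_eq simp flip: cs_def)
        then show "(\<Union>i<c. descendants ps (cs ! i)) \<inter> descendants ps (cs ! c) = {}" by auto
      qed
      then show ?case by (simp add: lessThan_Suc Un_commute mult.commute)
    qed
    have vcs: "v # cs \<noteq> []" "\<forall>w\<in>set (v # cs). v \<le> w" "1 \<le> v"
      using cs Tree.prems v0 by (auto intro: less_imp_le)
    have Lb: "\<forall>G\<in>set L. \<forall>k\<ge>v. 0 \<le> G k \<and> G k \<le> 1"
      using match_prob_bounds vcs(3) unfolding L_def by (auto dest!: in_set_dropD)
    have xr: "0 \<le> xr \<and> xr \<le> 1" unfolding xr_def by (rule forest_prob_bounds[OF vcs _ Lb]) (use Tree.prems in simp)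
    have zr: "0 \<le> zr \<and> zr \<le> 1" unfolding zr_def by (rule forest_prob_bounds[OF vcs _ Lb]) (use Tree.prems in simp)
    have yr: "0 \<le> yr \<and> yr \<le> 1"
    proof (cases L)
      case (Cons G Gs)
      have "0 \<le> forest_prob n Gs (Suc m) (v # cs @ [m]) \<and> forest_prob n Gs (Suc m) (v # cs @ [m]) \<le> 1"
        by (rule forest_prob_bounds[where v=v]) (use vcs Lb Cons Tree.prems in auto)
      then show ?thesis using Lb Cons Tree.prems by (auto simp: yr_def intro!: mult_le_one)
    qed (simp add: yr_def)
    have at: "attach_rate m (v # cs) = ?w v"
      unfolding cs_def by (rule attach_rate_eq) (use ps m vcs Tree.prems in auto)
    have zr_eq: "zr = (1 - ?w v) * xr + ?w v * yr"
      unfolding zr_def xr_def yr_def at[symmetric] 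
    proof (cases L)
      case Nil
      then show "forest_prob n L m (v # cs) = (1 - attach_rate m (v # cs)) * forest_prob n L (Suc m) (v # cs) +
          attach_rate m (v # cs) * (case L of [] \<Rightarrow> 0 | G # Gs \<Rightarrow> G m * forest_prob n Gs (Suc m) (v # cs @ [m]))"
        using forest_prob_step(1)[OF m(2), of "v # cs"] by (simp del: forest_prob.simps)
    next
      case (Cons G Gs)
      then show "forest_prob n L m (v # cs) = (1 - attach_rate m (v # cs)) * forest_prob n L (Suc m) (v # cs) +
          attach_rate m (v # cs) * (case L of [] \<Rightarrow> 0 | G # Gs \<Rightarrow> G m * forest_prob n Gs (Suc m) (v # cs @ [m]))"
        using forest_prob_step(2)[OF m(2), of G Gs "v # cs"] by (simp del: forest_prob.simps)
    qed
    have wv: "?w v \<le> (1 + real (length ts) + \<alpha>) / 2 * ?e"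
    proof -
      have "?w v \<le> (real (length (v # cs)) + \<alpha>) / (2 * real v)"
        unfolding at[symmetric] by (rule attach_rate_bounds(3)[OF vcs])
      also have "\<dots> \<le> (1 + real (length ts) + \<alpha>) / (2 * real v0)"
        using True Tree.prems v0 alpha by (intro frac_le) auto
      finally show ?thesis by simp
    qed
    have single: "(\<Sum>p<m. g p * (if p = v then b else c)) = g v * b + (\<Sum>p\<in>{..<m} - {v}. g p * c)" for g :: "nat \<Rightarrow> real" and b c
      using Tree.prems by (subst sum.remove[of _ v]) auto
    \<comment> \<open>By \<open>zr_eq\<close> the current value is the exact mean of
      \<open>xr\<close> and \<open>yr\<close>, so the own factor has no second-order error. All such
      errors come from multiplying factors.\<close>
    have own: "one_step ?w m {v} (2 + real (length ts) + \<alpha>) ?e (\<lambda>p. if p = v then yr else xr) xr zr"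
    proof -
      have "(\<Sum>p<m. ?w p * \<bar>(if p = v then yr else xr) - xr\<bar>) = (\<Sum>p<m. ?w p * (if p = v then \<bar>yr - xr\<bar> else 0))"
        by (intro sum.cong) auto
      also have "\<dots> = ?w v * \<bar>yr - xr\<bar>" by (simp add: single)
      also have "\<dots> \<le> ?w v" using xr yr attach_prob_nonneg by (intro mult_left_le) auto
      also have "\<dots> \<le> (2 + real (length ts) + \<alpha> - 1) / 2 * ?e" using wv by (simp add: add.assoc)
      finally have a: "(\<Sum>p<m. ?w p * \<bar>(if p = v then yr else xr) - xr\<bar>) \<le> (2 + real (length ts) + \<alpha> - 1) / 2 * ?e" .
      have "(\<Sum>p<m. ?w p * ((if p = v then yr else xr) - xr)) = (\<Sum>p<m. ?w p * (if p = v then yr - xr else 0))"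
        by (intro sum.cong) auto
      also have "\<dots> = ?w v * (yr - xr)" by (simp add: single)
      finally have "xr + (\<Sum>p<m. ?w p * ((if p = v then yr else xr) - xr)) - zr = 0"
        unfolding zr_eq by (simp add: algebra_simps)
      then show ?thesis
        using a xr yr zr alpha by (auto simp: one_step_def)
    qed
    have all: "one_step ?w m ((\<Union>i<length cs. descendants ps (cs ! i)) \<union> {v})
        ((\<Prod>i<length cs. potential_weight (ts ! i)) * (2 + real (length ts) + \<alpha>)) ?e
        (\<lambda>p. (\<Prod>i<length cs. F i p) * (if p = v then yr else xr)) ((\<Prod>i<length cs. x i) * xr) ((\<Prod>i<length cs. z i) * zr)"
      using vertex_notin_descendants_child[OF ps m1] alpha
      by (intro one_step_mult[OF kids[OF order_refl] own _ attach_prob_nonneg W1 _ e]) (auto simp: cs_def)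
    have phi_new: "potential n (Suc m) (ps @ [p]) (Tree ts) v = (\<Prod>i<length cs. F i p) * (if p = v then yr else xr)"
      if "p < m" for p
    proof (cases "p = v")
      case False
      then show ?thesis using True
        by (simp add: children_snoc F_def xr_def L_def flip: cs_def)
    next
      case pv: True
      show ?thesis
      proof (cases "length cs = length ts")
        case T: True
        then show ?thesis using pv by (simp add: children_snoc yr_def L_def flip: cs_def)
      next
        case F: False
        then have lt: "length cs < length ts" using True by simp
        then have L: "L = match_prob n (ts ! length cs) # drop (Suc (length cs)) (map (match_prob n) ts)"
          unfolding L_def by (metis Cons_nth_drop_Suc length_map nth_map)
        \<comment> \<open>The newcomer has no children yet, so its potential is the unconditional
          match probability, which is the head of the remaining list in \<open>yr\<close>.\<close>
        have "children (ps @ [v]) m = []"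
          using children_fresh[OF ps m1] Tree.prems by (simp add: children_snoc)
        then have new: "potential n (Suc m) (ps @ [v]) (ts ! length cs) m = match_prob n (ts ! length cs) m"
          by (cases "ts ! length cs") (auto simp: potential_fresh)
        have prod: "(\<Prod>i<length cs. (map (potential n (Suc m) (ps @ [v])) ts ! i) ((cs @ [m]) ! i)) = (\<Prod>i<length cs. F i v)"
          using lt by (intro prod.cong) (auto simp: F_def nth_append)
        show ?thesis using pv lt new prod
          by (simp add: children_snoc yr_def L len Let_def Suc_le_eq drop_map flip: cs_def)
      qed
    qed
    have phi_old: "potential n k ps (Tree ts) v = (\<Prod>i<length cs. potential n k ps (ts ! i) (cs ! i)) * forest_prob n L k (v # cs)" for k
      using True by (simp add: L_def flip: cs_def)
    have D: "(\<Union>i<length cs. descendants ps (cs ! i)) \<union> {v} \<subseteq> descendants ps v"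
    proof -
      have "descendants ps (cs ! i) \<subseteq> descendants ps v" if "i < length cs" for i
        using that by (intro descendants_child) (simp add: cs_def)
      then show ?thesis by (auto simp: descendants_self)
    qed
    have G: "(\<Prod>i<length cs. potential_weight (ts ! i)) * (2 + real (length ts) + \<alpha>) \<le> potential_weight (Tree ts)"
    proof -
      have "prod_list (map potential_weight ts) = (\<Prod>i<length ts. potential_weight (ts ! i))"
        by (simp add: prod.list_conv_set_nth atLeast0LessThan)
      moreover have "(\<Prod>i<length cs. potential_weight (ts ! i)) \<le> (\<Prod>i<length ts. potential_weight (ts ! i))"
        using True potential_weight_ge_1 order_trans[OF zero_le_one potential_weight_ge_1] by (intro prod_mono2) auto
      ultimately show ?thesis using alpha by (simp add: mult.commute mult_left_mono)
    qed
    show ?thesis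
      using one_step_mono[OF all D G e(1)] unfolding phi_old one_step_def
      by (simp add: phi_new x_def z_def xr_def zr_def del: potential.simps)
  qed
qed

section \<open>From the potential to fringe probabilities\<close>

primrec fringe_matches :: "nat list \<Rightarrow> pattern \<Rightarrow> nat \<Rightarrow> bool" where
  "fringe_matches ps Any = (\<lambda>v. True)"
| "fringe_matches ps (Tree ts) = (\<lambda>v. list_all2 (\<lambda>f c. f c) (map (fringe_matches ps) ts) (children ps v))"

lemma fringe_matches_Tree:
  "fringe_matches ps (Tree ts) v \<longleftrightarrow> length (children ps v) = length ts \<and> (\<forall>i<length ts. fringe_matches ps (ts ! i) (children ps v ! i))"
  by (auto simp: list_all2_conv_all_nth)

text \<open>At m = n there is no future: with no subpattern left the own factor is an empty product,
  otherwise it is an empty sum.\<close>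

lemma potential_final: "potential n n ps S v = of_bool (fringe_matches ps S v)"
proof (induction S arbitrary: v)
  case (Tree ts)
  define cs where "cs = children ps v"
  consider "length cs < length ts" | "length cs > length ts" | "length cs = length ts" by linarith
  then show ?case
  proof cases
    case 1
    then obtain G Gs where "drop (length cs) (map (match_prob n) ts) = G # Gs"
      by (metis Cons_nth_drop_Suc length_map)
    then have "potential n n ps (Tree ts) v = 0" by (simp flip: cs_def)
    then show ?thesis using 1 by (auto simp: fringe_matches_Tree cs_def simp del: potential.simps fringe_matches.simps)
  next
    case 2
    then show ?thesis unfolding fringe_matches_Tree by (auto simp flip: cs_def)
  next
    case 3
    have "potential n n ps (Tree ts) v = (\<Prod>i<length cs. of_bool (fringe_matches ps (ts ! i) (cs ! i)))"
      using 3 Tree by (simp flip: cs_def)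
    also have "\<dots> = of_bool (\<forall>i<length cs. fringe_matches ps (ts ! i) (cs ! i))"
      by (induction "length cs") (auto simp: lessThan_Suc less_Suc_eq)
    finally show ?thesis using 3 by (simp add: fringe_matches_Tree cs_def del: potential.simps fringe_matches.simps)
  qed
qed simp

text \<open>Telescoping over m. At time v + 1 the vertex v is the newest and has no children, so its
  potential is the number \<open>match_prob n S v\<close>; at time n it is the indicator of a match.
  Each of the fewer than n steps costs the second-order error of \<open>potential_step\<close> with
  v0 = v.\<close>

lemma fringe_matches_prob_approx:
  assumes v: "1 \<le> v" "v < n"
  shows "\<bar>expect n (\<lambda>ps. of_bool (fringe_matches ps S v)) - match_prob n S v\<bar> \<le> (potential_weight S - 1) / 2 * (real n / (real v)\<^sup>2)"
proof -
  define C where "C = (potential_weight S - 1) / 2 * (1 / real v)\<^sup>2"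
  have C: "0 \<le> C" using potential_weight_ge_1 by (simp add: C_def)
  have "\<bar>expect m (\<lambda>ps. potential n m ps S v) - match_prob n S v\<bar> \<le> real (m - Suc v) * C" if "Suc v \<le> m" "m \<le> n" for m
    using that
  proof (induction m rule: dec_induct)
    case base
    have "expect (Suc v) (\<lambda>ps. potential n (Suc v) ps S v) = expect (Suc v) (\<lambda>ps. match_prob n S v)"
    proof (rule expect_cong)
      fix ps assume "ps \<in> rtrees (Suc v)"
      then have "children ps v = []"
        using children_bounds[of ps "Suc v" _ v] by (metis Suc_leI less_Suc_eq list.set_intros(1) neq_Nil_conv not_less_eq zero_less_Suc One_nat_def)
      then show "potential n (Suc v) ps S v = match_prob n S v" by (cases S) (auto simp: potential_fresh)
    qed
    then show ?case using v expect_const[of "Suc v"] by simp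
  next
    case (step m)
    have m: "2 \<le> m" "m < n" "v < m" using step v by auto
    have "\<bar>expect m (\<lambda>ps. (\<Sum>p<m. attach_prob \<mu> \<alpha> ps p * potential n (Suc m) (ps @ [p]) S v) - potential n m ps S v)\<bar> \<le> C"
      unfolding C_def
      by (rule expect_abs_le[OF m(1)])
        (rule one_step_expectation[OF potential_step[OF _ m(1,2) v(1) order_refl m(3)] sum_attach_prob[OF _ m(1)]])
    then have "\<bar>expect (Suc m) (\<lambda>ps. potential n (Suc m) ps S v) - expect m (\<lambda>ps. potential n m ps S v)\<bar> \<le> C"
      unfolding expect_Suc[OF m(1)] expect_diff .
    moreover have "\<bar>expect m (\<lambda>ps. potential n m ps S v) - match_prob n S v\<bar> \<le> real (m - Suc v) * C"
      using step m by simp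
    moreover have "real (Suc m - Suc v) * C = real (m - Suc v) * C + C"
      using m(3) by (simp add: of_nat_diff algebra_simps)
    ultimately show ?case by linarith
  qed
  from this[of n] have "\<bar>expect n (\<lambda>ps. of_bool (fringe_matches ps S v)) - match_prob n S v\<bar> \<le> real (n - Suc v) * C"
    using v by (simp add: potential_final)
  also have "\<dots> \<le> real n * C" using C by (intro mult_right_mono) auto
  finally show ?thesis by (simp add: C_def power_divide mult.commute)
qed

end

subsection \<open>Hazard rates of the limit process\<close>

text \<open>A cumulative hazard. With the interval expressed by \<open>if\<close> in the integrand,
  splitting and merging intervals are pointwise identities; for b < a the value is 0.\<close>

definition cum :: "(real \<Rightarrow> real) \<Rightarrow> real \<Rightarrow> real \<Rightarrow> real" where
  "cum g a b = (\<integral>t. (if a \<le> t \<and> t \<le> b then g t else 0) \<partial>lborel)"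

lemma integrable_on_bounded_interval:
  fixes g :: "real \<Rightarrow> real"
  assumes [measurable]: "g \<in> borel_measurable borel" "Measurable.pred borel P"
    and "\<And>t. P t \<Longrightarrow> a \<le> t \<and> t \<le> b" "\<And>t. P t \<Longrightarrow> \<bar>g t\<bar> \<le> K"
  shows "integrable lborel (\<lambda>t. if P t then g t else 0)"
proof (rule Bochner_Integration.integrable_bound)
  show "integrable lborel (\<lambda>t. indicator {a..b} t *\<^sub>R K)"
    by (intro integrable_scaleR_left integrable_real_indicator) (auto simp: emeasure_lborel_Icc_eq)
  show "AE t in lborel. norm (if P t then g t else 0) \<le> norm (indicator {a..b} t *\<^sub>R K)"
    using assms(3,4) by (intro AE_I2) (auto simp: indicator_def intro: order_trans[OF _ abs_ge_self])
qed simp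

lemma integral_bounded_interval:
  fixes g :: "real \<Rightarrow> real"
  assumes [measurable]: "g \<in> borel_measurable borel" "Measurable.pred borel P"
    and P: "\<And>t. P t \<Longrightarrow> a \<le> t \<and> t \<le> b" and g: "\<And>t. P t \<Longrightarrow> \<bar>g t\<bar> \<le> K" and K: "0 \<le> K" and ab: "a \<le> b"
  shows "\<bar>\<integral>t. (if P t then g t else 0) \<partial>lborel\<bar> \<le> K * (b - a)"
proof -
  have "\<bar>\<integral>t. (if P t then g t else 0) \<partial>lborel\<bar> \<le> (\<integral>t. indicator {a..b} t *\<^sub>R K \<partial>lborel)"
  proof (rule order_trans[OF integral_abs_bound integral_mono])
    show "integrable lborel (\<lambda>t. \<bar>if P t then g t else 0\<bar>)"
      by (intro integrable_abs integrable_on_bounded_interval[OF assms(1-4)]) auto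
    show "integrable lborel (\<lambda>t. indicator {a..b} t *\<^sub>R K)"
      by (intro integrable_scaleR_left integrable_real_indicator) (auto simp: emeasure_lborel_Icc_eq)
  qed (use P g K in \<open>auto simp: indicator_def\<close>)
  also have "\<dots> = K * (b - a)" using ab by simp
  finally show ?thesis .
qed

text \<open>Monotonicity supplies measurability and local boundedness. Continuity cannot be
  demanded, since hazards built from h jump with it.\<close>

locale rate =
  fixes g :: "real \<Rightarrow> real"
  assumes g_mono: "mono g" and g_nonneg: "\<And>t. 0 \<le> g t"
begin

lemma g_measurable [measurable]: "g \<in> borel_measurable borel"
  by (rule borel_measurable_mono[OF g_mono])

lemma cum_integrable: "integrable lborel (\<lambda>t. if a \<le> t \<and> t \<le> b then g t else 0)"
  by (rule integrable_on_bounded_interval[where a=a and b=b and K="g b"])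
    (use g_nonneg monoD[OF g_mono] in auto)

lemma cum_nonneg: "0 \<le> cum g a b"
  unfolding cum_def by (rule Bochner_Integration.integral_nonneg) (simp add: g_nonneg)

lemma cum_diff:
  assumes "a \<le> x" "x \<le> y"
  shows "cum g a y - cum g a x = (\<integral>t. (if x < t \<and> t \<le> y then g t else 0) \<partial>lborel)"
    and "0 \<le> cum g a y - cum g a x" and "cum g a y - cum g a x \<le> g y * (y - x)"
proof -
  have *: "integrable lborel (\<lambda>t. if x < t \<and> t \<le> y then g t else 0)"
    by (rule integrable_on_bounded_interval[where a=x and b=y and K="g y"])
      (use g_nonneg monoD[OF g_mono] in auto)
  have "cum g a y = (\<integral>t. (if a \<le> t \<and> t \<le> x then g t else 0) + (if x < t \<and> t \<le> y then g t else 0) \<partial>lborel)"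
    unfolding cum_def using assms by (intro Bochner_Integration.integral_cong) auto
  also have "\<dots> = cum g a x + (\<integral>t. (if x < t \<and> t \<le> y then g t else 0) \<partial>lborel)"
    unfolding cum_def by (rule Bochner_Integration.integral_add[OF cum_integrable *])
  finally show eq: "cum g a y - cum g a x = (\<integral>t. (if x < t \<and> t \<le> y then g t else 0) \<partial>lborel)" by simp
  show "0 \<le> cum g a y - cum g a x"
    unfolding eq by (rule Bochner_Integration.integral_nonneg) (simp add: g_nonneg)
  have "\<bar>\<integral>t. (if x < t \<and> t \<le> y then g t else 0) \<partial>lborel\<bar> \<le> g y * (y - x)"
    by (rule integral_bounded_interval) (use g_nonneg monoD[OF g_mono] assms in auto)
  then show "cum g a y - cum g a x \<le> g y * (y - x)" unfolding eq by simp
qed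

lemma cum_start [simp]: "b \<le> a \<Longrightarrow> cum g a b = 0"
proof -
  assume "b \<le> a"
  have "AE t in lborel. t \<noteq> a" by (rule AE_lborel_singleton)
  then have "AE t in lborel. (if a \<le> t \<and> t \<le> b then g t else 0) = 0"
    by eventually_elim (use \<open>b \<le> a\<close> in auto)
  then show ?thesis unfolding cum_def by (rule integral_eq_zero_AE)
qed

lemma cum_measurable [measurable]: "cum g a \<in> borel_measurable borel"
proof -
  have "mono (cum g a)"
  proof (rule monoI)
    fix x y :: real assume "x \<le> y"
    then show "cum g a x \<le> cum g a y"
      using cum_diff(2)[of a x y] cum_nonneg[of a y] by (cases "a \<le> x") auto
  qed
  then show ?thesis by (rule borel_measurable_mono)
qed

lemma first_event_integrable:
  "integrable lborel (\<lambda>b. if a < b \<and> b < y then g b * exp (- cum g a b) else 0)"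
proof (rule integrable_on_bounded_interval[where a=a and b=y and K="g y"])
  fix t assume t: "a < t \<and> t < y"
  have "g t * exp (- cum g a t) \<le> g y * 1"
    using t g_nonneg monoD[OF g_mono, of t y] cum_nonneg by (intro mult_mono) auto
  then show "\<bar>g t * exp (- cum g a t)\<bar> \<le> g y" using g_nonneg by simp
qed auto

text \<open>\<open>g b * exp (- cum g a b)\<close> is the density of the first event after a of a
  process with rate g, so the claim says that either an event occurs before y or none does.\<close>

lemma first_event_integral:
  assumes ay: "a \<le> y"
  shows "(\<integral>b. (if a < b \<and> b < y then g b * exp (- cum g a b) else 0) \<partial>lborel) = 1 - exp (- cum g a y)"
proof -
  define K where "K = g y"
  have K: "0 \<le> K" "\<And>t. t \<le> y \<Longrightarrow> g t \<le> K" using g_nonneg monoD[OF g_mono] by (auto simp: K_def)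
  define J where "J x = (\<integral>b. (if a < b \<and> b < x then g b * exp (- cum g a b) else 0) \<partial>lborel)" for x
  define F where "F x = J x + exp (- cum g a x)" for x
  (* g need not be continuous, so F is not differentiable everywhere; this quadratic bound
     still forces F to be constant. *)
  have quad: "\<bar>F z - F x\<bar> \<le> 2 * K\<^sup>2 * (z - x)\<^sup>2" if x: "a \<le> x" "x \<le> z" "z \<le> y" for x z
  proof -
    define e where "e = exp (- cum g a x)"
    define d where "d = cum g a z - cum g a x"
    have d: "0 \<le> d" "d \<le> K * (z - x)"
      using cum_diff[OF x(1,2)] mult_right_mono[OF K(2)[OF x(3)], of "z - x"] x by (auto simp: d_def)
    have e: "0 < e" "e \<le> 1" using cum_nonneg by (auto simp: e_def)
    let ?I = "\<lambda>b. if x < b \<and> b < z then g b * exp (- cum g a b) else 0"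
    let ?I' = "\<lambda>b. if x < b \<and> b \<le> z then g b else 0"
    have I: "integrable lborel ?I"
    proof (rule integrable_on_bounded_interval[where a=x and b=z and K=K])
      fix t assume t: "x < t \<and> t < z"
      have "g t * exp (- cum g a t) \<le> K * 1"
        using t g_nonneg K(1) K(2)[of t] x cum_nonneg by (intro mult_mono) auto
      then show "\<bar>g t * exp (- cum g a t)\<bar> \<le> K" using g_nonneg by simp
    qed auto
    have I': "integrable lborel ?I'"
      by (rule integrable_on_bounded_interval[where a=x and b=z and K="g z"])
        (use g_nonneg monoD[OF g_mono] in auto)
    have "J z = (\<integral>b. (if a < b \<and> b < x then g b * exp (- cum g a b) else 0) + ?I b \<partial>lborel)"
      unfolding J_def
    proof (rule integral_cong_AE)
      show "AE b in lborel. (if a < b \<and> b < z then g b * exp (- cum g a b) else 0) =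
          (if a < b \<and> b < x then g b * exp (- cum g a b) else 0) + ?I b"
        using AE_lborel_singleton[of x] by eventually_elim (use x in auto)
    qed auto
    also have "\<dots> = J x + integral\<^sup>L lborel ?I"
      unfolding J_def by (rule Bochner_Integration.integral_add[OF first_event_integrable I])
    finally have Jz: "J z - J x = integral\<^sup>L lborel ?I" by simp
    \<comment> \<open>With e * d as the first-order term, J increases by e * d and the exponential
      decreases by e * d, each up to an error quadratic in z - x. The first-order terms cancel in
      F.\<close>
    have "integral\<^sup>L lborel ?I - e * d = (\<integral>b. ?I b - e * ?I' b \<partial>lborel)"
      unfolding d_def cum_diff(1)[OF x(1,2)] using I I' by (subst Bochner_Integration.integral_diff) auto
    also have "\<dots> = (\<integral>b. (if x < b \<and> b < z then g b * (exp (- cum g a b) - e) else 0) \<partial>lborel)"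
    proof (rule integral_cong_AE)
      show "AE b in lborel. ?I b - e * ?I' b = (if x < b \<and> b < z then g b * (exp (- cum g a b) - e) else 0)"
        using AE_lborel_singleton[of z] by eventually_elim (auto simp: algebra_simps)
    qed auto
    also have "\<bar>\<dots>\<bar> \<le> (K * (K * (z - x))) * (z - x)"
    proof (rule integral_bounded_interval)
      fix t assume t: "x < t \<and> t < z"
      define u where "u = cum g a t - cum g a x"
      have u: "0 \<le> u" "u \<le> g t * (t - x)"
        using cum_diff[of a x t] t x by (auto simp: u_def)
      have "g t * (t - x) \<le> K * (z - x)" using K(2)[of t] K(1) t x by (intro mult_mono) auto
      then have u2: "u \<le> K * (z - x)" using u by linarith
      have "exp (- cum g a t) = e * exp (- u)" by (simp add: e_def u_def flip: exp_add)
      then have "\<bar>exp (- cum g a t) - e\<bar> = e * (1 - exp (- u))"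
        using e u(1) by (simp add: algebra_simps)
      also have "\<dots> \<le> 1 * u" using e exp_ge_add_one_self[of "- u"] u by (intro mult_mono) auto
      finally have "\<bar>exp (- cum g a t) - e\<bar> \<le> K * (z - x)" using u2 by simp
      then show "\<bar>g t * (exp (- cum g a t) - e)\<bar> \<le> K * (K * (z - x))"
        unfolding abs_mult using g_nonneg K(1) K(2)[of t] t x by (intro mult_mono) auto
    qed (use x K in auto)
    finally have 1: "\<bar>integral\<^sup>L lborel ?I - e * d\<bar> \<le> K\<^sup>2 * (z - x)\<^sup>2" by (simp add: power2_eq_square mult_ac)
    have "exp (- cum g a z) = e * exp (- d)" by (simp add: e_def d_def flip: exp_add)
    then have "exp (- cum g a z) - exp (- cum g a x) + e * d = e * (exp (- d) - 1 + d)"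
      by (simp add: e_def algebra_simps)
    moreover have "0 \<le> exp (- d) - 1 + d" using exp_ge_add_one_self[of "- d"] by simp
    moreover have "exp (- d) - 1 + d \<le> d\<^sup>2"
    proof -
      have "exp (- d) = inverse (exp d)" by (rule exp_minus)
      also have "\<dots> \<le> inverse (1 + d)" using d exp_ge_add_one_self[of d] by (intro le_imp_inverse_le) auto
      finally have "exp (- d) - 1 + d \<le> inverse (1 + d) - 1 + d" by simp
      also have "\<dots> = d\<^sup>2 / (1 + d)" using d by (simp add: field_simps power2_eq_square)
      also have "\<dots> \<le> d\<^sup>2" using d by (simp add: divide_le_eq mult_left_mono algebra_simps power2_eq_square)
      finally show ?thesis .
    qed
    ultimately have "\<bar>exp (- cum g a z) - exp (- cum g a x) + e * d\<bar> \<le> d\<^sup>2"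
      using e mult_mono[of e 1 "exp (- d) - 1 + d" "d\<^sup>2"] by (simp add: abs_mult)
    also have "d\<^sup>2 \<le> K\<^sup>2 * (z - x)\<^sup>2" using d by (simp flip: power_mult_distrib add: power_mono)
    finally show ?thesis using 1 unfolding F_def Jz[symmetric]
      by (simp add: abs_le_iff) 
  qed
  have "\<exists>c. \<forall>x\<in>{a..y}. F x = c"
  proof (rule has_field_derivative_zero_constant[of "{a..y}" F])
    show "convex {a..y}" by simp
    fix x assume x: "x \<in> {a..y}"
    show "(F has_field_derivative 0) (at x within {a..y})"
      unfolding has_field_derivative_iff
    proof (rule Lim_null_comparison)
      show "\<forall>\<^sub>F z in at x within {a..y}. norm ((F z - F x) / (z - x)) \<le> 2 * K\<^sup>2 * \<bar>z - x\<bar>"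
        unfolding eventually_at_filter
      proof (intro always_eventually allI impI)
        fix z assume z: "z \<noteq> x" "z \<in> {a..y}"
        have "\<bar>F z - F x\<bar> \<le> 2 * K\<^sup>2 * (z - x)\<^sup>2"
          using quad[of x z] quad[of z x] x z by (cases "x \<le> z") (auto simp: abs_minus_commute power2_commute)
        then have "\<bar>F z - F x\<bar> \<le> 2 * K\<^sup>2 * \<bar>z - x\<bar> * \<bar>z - x\<bar>"
          by (simp add: power2_eq_square mult.assoc)
        then show "norm ((F z - F x) / (z - x)) \<le> 2 * K\<^sup>2 * \<bar>z - x\<bar>"
          using z by (simp add: abs_divide divide_le_eq)
      qed
      have "((\<lambda>z. 2 * K\<^sup>2 * \<bar>z - x\<bar>) \<longlongrightarrow> 2 * K\<^sup>2 * \<bar>x - x\<bar>) (at x within {a..y})"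
        by (intro tendsto_intros)
      then show "((\<lambda>z. 2 * K\<^sup>2 * \<bar>z - x\<bar>) \<longlongrightarrow> 0) (at x within {a..y})" by simp
    qed
  qed
  then have "F y = F a" using ay by force
  moreover have "J a = 0" unfolding J_def by (simp add: not_less_iff_gr_or_eq cong: conj_cong) 
  ultimately show ?thesis by (simp add: F_def J_def)
qed

end

section \<open>Limit hazards and nested integrals\<close>

context macro_delay
begin

abbreviation h :: "real \<Rightarrow> real" where "h \<equiv> hfun \<mu> \<alpha>"

lemma hfun_integrable:
  "integrable \<mu> (\<lambda>\<xi>. if \<xi> < 1 \<and> - ln (1 - \<xi>) \<le> x then exp (- ln (1 - \<xi>)) else 0)"
  by (rule mu.integrable_const_bound[where B="exp x"]) auto

lemma h_nonneg: "0 \<le> h x"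
  unfolding hfun_def using alpha by (intro mult_nonneg_nonneg Bochner_Integration.integral_nonneg) auto

lemma h_mono: "mono h"
proof (rule monoI)
  fix x y :: real assume "x \<le> y"
  then show "h x \<le> h y"
    unfolding hfun_def using alpha
    by (intro mult_left_mono integral_mono hfun_integrable) auto
qed

lemma h_measurable [measurable]: "h \<in> borel_measurable borel"
  by (rule borel_measurable_mono[OF h_mono])

text \<open>The function \<open>hazard\<close> in absolute time: for t = s i + x and s j = s 0 +
  \<sigma>_j, the difference t - s j is x + \<sigma>_i - \<sigma>_j. Absolute times suit both the
  rescaled tree and the recursion, in which the birth time of each child is the starting point of a
  new family.\<close>

definition haz :: "(nat \<Rightarrow> real) \<Rightarrow> nat \<Rightarrow> real \<Rightarrow> real" where
  "haz s i t = (\<Sum>j\<le>i. h (t - s j)) + \<alpha> * h (t - s 0)"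

sublocale haz: rate "haz s i" for s i
proof
  show "mono (haz s i)" unfolding haz_def
    by (intro monoI add_mono sum_mono mult_left_mono monoD[OF h_mono] alpha) auto
  show "0 \<le> haz s i t" for t unfolding haz_def using alpha by (intro add_nonneg_nonneg sum_nonneg mult_nonneg_nonneg h_nonneg)
qed

text \<open>The logarithmic time runs up to 0; s 0 is the birth time of an individual and s 1, ..., s i
  are those of its first i children.\<close>

primrec limit_forest_prob :: "(real \<Rightarrow> real) list \<Rightarrow> (nat \<Rightarrow> real) \<Rightarrow> nat \<Rightarrow> real" where
  "limit_forest_prob [] = (\<lambda>s i. exp (- cum (haz s i) (s i) 0))"
| "limit_forest_prob (G # Gs) = (\<lambda>s i. \<integral>b. (if s i < b \<and> b < 0
     then haz s i b * exp (- cum (haz s i) (s i) b) * (G b * limit_forest_prob Gs (s(Suc i := b)) (Suc i)) else 0) \<partial>lborel)"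

primrec limit_prob :: "pattern \<Rightarrow> real \<Rightarrow> real" where
  "limit_prob Any = (\<lambda>b. 1)"
| "limit_prob (Tree ts) = (\<lambda>b. limit_forest_prob (map limit_prob ts) (\<lambda>_. b) 0)"

lemma haz_cong: "(\<And>j. j \<le> i \<Longrightarrow> s j = s' j) \<Longrightarrow> haz s i = haz s' i"
  unfolding haz_def by (intro ext arg_cong2[where f="(+)"] sum.cong) auto

lemma limit_forest_prob_cong: "(\<And>j. j \<le> i \<Longrightarrow> s j = s' j) \<Longrightarrow> limit_forest_prob Gs s i = limit_forest_prob Gs s' i"
proof (induction Gs arbitrary: s s' i)
  case Nil
  then show ?case using haz_cong[of i s s'] by simp
next
  case (Cons G Gs)
  have "limit_forest_prob Gs (s(Suc i := b)) (Suc i) = limit_forest_prob Gs (s'(Suc i := b)) (Suc i)" for b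
    by (rule Cons.IH) (use Cons.prems in auto)
  then show ?case using haz_cong[of i s s'] Cons.prems by (simp cong: if_cong)
qed

abbreviation seqs :: "(nat \<Rightarrow> real) measure" where "seqs \<equiv> PiM UNIV (\<lambda>_. borel)"

lemma haz_joint_measurable [measurable]:
  assumes [measurable]: "f \<in> measurable N seqs" "t \<in> borel_measurable N"
  shows "(\<lambda>x. haz (f x) i (t x)) \<in> borel_measurable N"
  unfolding haz_def by measurable

lemma cum_joint_measurable [measurable]:
  assumes [measurable]: "f \<in> measurable N seqs" "a \<in> borel_measurable N" "t \<in> borel_measurable N"
  shows "(\<lambda>x. cum (haz (f x) i) (a x) (t x)) \<in> borel_measurable N"
  unfolding cum_def by measurable

lemma const_seqs [measurable]: "(\<lambda>_. s) \<in> measurable N seqs"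
  by (rule measurable_const) (simp add: space_PiM)

text \<open>The history grows by one entry with each child. Keeping histories as whole sequences
  that are updated at one place lets a single induction handle all lengths.\<close>

lemma limit_forest_prob_measurable_seqs:
  "\<forall>G\<in>set Gs. G \<in> borel_measurable borel \<Longrightarrow> (\<lambda>s. limit_forest_prob Gs s i) \<in> borel_measurable seqs"
proof (induction Gs arbitrary: i)
  case (Cons G Gs)
  have [measurable]: "G \<in> borel_measurable borel" using Cons.prems by simp
  have upd: "(\<lambda>y. (fst y)(Suc i := snd y)) \<in> measurable (seqs \<Otimes>\<^sub>M lborel) seqs"
    by (rule measurable_fun_upd[where J=UNIV]) auto
  have "(\<lambda>y. limit_forest_prob Gs ((fst y)(Suc i := snd y)) (Suc i)) \<in> borel_measurable (seqs \<Otimes>\<^sub>M lborel)"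
    by (rule measurable_compose[OF upd Cons.IH]) (use Cons.prems in simp)
  then have [measurable]: "(\<lambda>(s, b). limit_forest_prob Gs (s(Suc i := b)) (Suc i)) \<in> borel_measurable (seqs \<Otimes>\<^sub>M lborel)"
    by (simp add: case_prod_unfold)
  show ?case unfolding limit_forest_prob.simps by measurable
qed simp

lemma limit_forest_prob_measurable:
  assumes "\<forall>G\<in>set Gs. G \<in> borel_measurable borel" and "f \<in> measurable N seqs"
  shows "(\<lambda>x. limit_forest_prob Gs (f x) i) \<in> borel_measurable N"
  using measurable_compose[OF assms(2) limit_forest_prob_measurable_seqs[OF assms(1)]] .

lemma limit_prob_measurable [measurable]: "limit_prob S \<in> borel_measurable borel"
proof (induction S)
  case (Tree ts)
  have "(\<lambda>b. limit_forest_prob (map limit_prob ts) (\<lambda>_. b) 0) \<in> borel_measurable borel"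
    by (rule limit_forest_prob_measurable) (use Tree in \<open>auto intro!: measurable_PiM_single'\<close>)
  then show ?case by simp
qed simp

text \<open>The integrand lies between 0 and the density of the next birth, because the remaining
  factors are in [0,1]. That density is integrable with mass at most 1 by
  \<open>rate.first_event_integral\<close>.\<close>

lemma limit_forest_prob_bounds:
  assumes "\<forall>G\<in>set Gs. G \<in> borel_measurable borel \<and> (\<forall>b. 0 \<le> G b \<and> G b \<le> 1)"
  shows "0 \<le> limit_forest_prob Gs s i \<and> limit_forest_prob Gs s i \<le> 1"
    and "Gs = G # Gs' \<Longrightarrow> integrable lborel (\<lambda>b. if s i < b \<and> b < 0
     then haz s i b * exp (- cum (haz s i) (s i) b) * (G b * limit_forest_prob Gs' (s(Suc i := b)) (Suc i)) else 0)"
proof -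
  have "(0 \<le> limit_forest_prob Gs s i \<and> limit_forest_prob Gs s i \<le> 1) \<and> (Gs = G # Gs' \<longrightarrow> integrable lborel (\<lambda>b. if s i < b \<and> b < 0
     then haz s i b * exp (- cum (haz s i) (s i) b) * (G b * limit_forest_prob Gs' (s(Suc i := b)) (Suc i)) else 0))"
    using assms
  proof (induction Gs arbitrary: G Gs' s i)
    case Nil
    show ?case using haz.cum_nonneg by simp
  next
    case (Cons F Fs)
    have [measurable]: "F \<in> borel_measurable borel" using Cons.prems by simp
    have IH: "0 \<le> limit_forest_prob Fs s i \<and> limit_forest_prob Fs s i \<le> 1" for s i using Cons.IH Cons.prems by simp
    have upd: "(\<lambda>b. s(Suc i := b)) \<in> measurable borel seqs"
      by (rule measurable_fun_upd[where J=UNIV]) auto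
    have [measurable]: "(\<lambda>b. limit_forest_prob Fs (s(Suc i := b)) (Suc i)) \<in> borel_measurable borel"
      by (rule limit_forest_prob_measurable[OF _ upd]) (use Cons.prems in simp)
    have FR: "0 \<le> F b * limit_forest_prob Fs (s(Suc i := b)) (Suc i)" "F b * limit_forest_prob Fs (s(Suc i := b)) (Suc i) \<le> 1" for b
      using IH Cons.prems by (auto intro!: mult_nonneg_nonneg mult_le_one)
    let ?f = "\<lambda>b. if s i < b \<and> b < 0 then haz s i b * exp (- cum (haz s i) (s i) b) else 0"
    let ?g = "\<lambda>b. if s i < b \<and> b < 0
     then haz s i b * exp (- cum (haz s i) (s i) b) * (F b * limit_forest_prob Fs (s(Suc i := b)) (Suc i)) else 0"
    have le: "0 \<le> ?g b" "?g b \<le> ?f b" for b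
      using FR haz.g_nonneg[of s i b] by (auto intro!: mult_nonneg_nonneg mult_left_le simp del: mult_eq_0_iff)
    have "norm u \<le> norm v" if "0 \<le> u" "u \<le> v" for u v :: real using that by simp
    then have norm_le: "norm (?g b) \<le> norm (?f b)" for b
      using le[of b] by blast
    have int: "integrable lborel ?g"
      by (rule Bochner_Integration.integrable_bound[OF haz.first_event_integrable[of "s i" 0 s i]])
        (use norm_le in auto)
    have "integral\<^sup>L lborel ?g \<le> 1"
    proof (cases "s i \<le> 0")
      case True
      have "integral\<^sup>L lborel ?g \<le> integral\<^sup>L lborel ?f"
        by (rule integral_mono[OF int haz.first_event_integrable le(2)])
      also have "\<dots> \<le> 1" unfolding haz.first_event_integral[OF True] by simp
      finally show ?thesis .
    next
      case False
      then have "?g = (\<lambda>b. 0)" by auto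
      then show ?thesis by simp
    qed
    moreover have "0 \<le> integral\<^sup>L lborel ?g" by (rule Bochner_Integration.integral_nonneg) (rule le)
    moreover have "integrable lborel (\<lambda>b. if s i < b \<and> b < 0
     then haz s i b * exp (- cum (haz s i) (s i) b) * (G b * limit_forest_prob Gs' (s(Suc i := b)) (Suc i)) else 0)"
      if "F # Fs = G # Gs'"
    proof -
      have "G = F" "Gs' = Fs" using that by auto
      then show ?thesis using int by (simp only:)
    qed
    ultimately show ?case by simp
  qed
  then show "0 \<le> limit_forest_prob Gs s i \<and> limit_forest_prob Gs s i \<le> 1"
    and "Gs = G # Gs' \<Longrightarrow> integrable lborel (\<lambda>b. if s i < b \<and> b < 0
     then haz s i b * exp (- cum (haz s i) (s i) b) * (G b * limit_forest_prob Gs' (s(Suc i := b)) (Suc i)) else 0)" by auto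
qed

lemma limit_prob_bounds: "0 \<le> limit_prob S b \<and> limit_prob S b \<le> 1"
proof (induction S arbitrary: b)
  case (Tree ts)
  then show ?case using limit_forest_prob_bounds(1)[of "map limit_prob ts" "\<lambda>_. b" 0] by auto
qed simp

end

subsection \<open>Convergence in logarithmic time\<close>

text \<open>The substitution t = log (m/n).\<close>

definition time_index :: "nat \<Rightarrow> real \<Rightarrow> nat" where
  "time_index n t = nat \<lfloor>real n * exp t\<rfloor>"

lemma time_index_measurable [measurable]: "time_index n \<in> measurable borel (count_space UNIV)"
  unfolding time_index_def by measurable

lemma time_index_le: "real (time_index n t) \<le> real n * exp t"
  unfolding time_index_def by simp

lemma time_index_gt: "real n * exp t < real (time_index n t) + 1"
  unfolding time_index_def by simp

lemma time_index_mono: "s \<le> t \<Longrightarrow> time_index n s \<le> time_index n t"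
  unfolding time_index_def by (intro nat_mono floor_mono mult_left_mono) auto

lemma time_index_0 [simp]: "time_index n 0 = n"
  unfolding time_index_def by simp

lemma time_index_over_n: "(\<lambda>n. real (time_index n t) / real n) \<longlonglongrightarrow> exp t"
proof (rule real_tendsto_sandwich)
  show "\<forall>\<^sub>F n in sequentially. exp t - 1 / real n \<le> real (time_index n t) / real n"
    using eventually_gt_at_top[of 0]
  proof eventually_elim
    case (elim n)
    then have "(real n * exp t - 1) / real n \<le> real (time_index n t) / real n"
      using time_index_gt[of n t] by (intro divide_right_mono) auto
    then show ?case using elim by (simp add: diff_divide_distrib)
  qed
  show "\<forall>\<^sub>F n in sequentially. real (time_index n t) / real n \<le> exp t"
    using eventually_gt_at_top[of 0]
    by eventually_elim (use time_index_le[of _ t] in \<open>auto simp: field_simps\<close>)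
  show "(\<lambda>n. exp t - 1 / real n) \<longlonglongrightarrow> exp t" by real_asymp
qed simp

lemma time_index_at_top: "filterlim (\<lambda>n. time_index n t) at_top sequentially"
proof -
  have "filterlim (\<lambda>n. real n * exp t - 1) at_top sequentially" by real_asymp
  then have "filterlim (\<lambda>n. real (time_index n t)) at_top sequentially"
    by (rule filterlim_at_top_mono) (use time_index_gt[of _ t] in \<open>auto simp: algebra_simps less_imp_le intro!: always_eventually\<close>)
  then show ?thesis by (simp add: filterlim_sequentially_iff_filterlim_real)
qed

lemma time_index_less_eventually:
  assumes "s < t" shows "\<forall>\<^sub>F n in sequentially. time_index n s < time_index n t"
proof -
  have "(\<lambda>n. real (time_index n t) / real n - real (time_index n s) / real n) \<longlonglongrightarrow> exp t - exp s"
    by (intro tendsto_diff time_index_over_n)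
  then have "\<forall>\<^sub>F n in sequentially. 0 < real (time_index n t) / real n - real (time_index n s) / real n"
    by (rule order_tendstoD(1)) (use assms in simp)
  then show ?thesis
    by eventually_elim (auto simp: divide_less_cancel)
qed

text \<open>Sums that start after an earlier arrival carry such a condition in the integrand; for
  fixed s < t it eventually holds.\<close>

lemma time_index_gate_limit:
  fixes g :: "nat \<Rightarrow> real"
  assumes "g \<longlonglongrightarrow> L" "s < t"
  shows "(\<lambda>n. if Suc (time_index n s) \<le> time_index n t then g n else 0) \<longlonglongrightarrow> L"
  using assms(1) by (rule Lim_transform_eventually) (rule eventually_mono[OF time_index_less_eventually[OF assms(2)]], simp)

lemma time_index_eq_iff:
  assumes "1 \<le> m" "1 \<le> n"
  shows "time_index n t = m \<longleftrightarrow> ln (real m / real n) \<le> t \<and> t < ln (real (Suc m) / real n)"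
proof -
  have "time_index n t = m \<longleftrightarrow> real m \<le> real n * exp t \<and> real n * exp t < real m + 1"
    unfolding time_index_def using assms(1) by (auto simp: nat_eq_iff floor_eq_iff)
  also have "real m \<le> real n * exp t \<longleftrightarrow> ln (real m / real n) \<le> t"
    using assms exp_le_cancel_iff[of "ln (real m / real n)" t] by (auto simp: field_simps)
  also have "real n * exp t < real m + 1 \<longleftrightarrow> t < ln (real (Suc m) / real n)"
    using assms exp_less_cancel_iff[of t "ln (real (Suc m) / real n)"] by (auto simp: field_simps)
  finally show ?thesis .
qed

text \<open>The times t with \<open>time_index n t = m\<close> form an interval of length ln (1 +
  1/m). The sum is therefore exactly the integral of a step function, without a discretization
  error.\<close>

lemma sum_eq_log_integral:
  fixes G :: "nat \<Rightarrow> real"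
  assumes "1 \<le> m0" "1 \<le> n"
  shows "(\<Sum>m=m0..<m1. G m) =
    (\<integral>t. (if m0 \<le> time_index n t \<and> time_index n t < m1 then G (time_index n t) / ln (1 + 1 / real (time_index n t)) else 0) \<partial>lborel)"
proof -
  define I where "I m = {ln (real m / real n)..<ln (real (Suc m) / real n)}" for m
  have I: "t \<in> I m \<longleftrightarrow> time_index n t = m" if "1 \<le> m" for m t
    using time_index_eq_iff[OF that assms(2)] by (simp add: I_def)
  have fin: "emeasure lborel (I m) < \<infinity>" for m
    by (rule emeasure_bounded_finite, rule bounded_subset[OF bounded_closed_interval])
      (auto simp: I_def intro: less_imp_le)
  have meas: "measure lborel (I m) = ln (1 + 1 / real m)" if "1 \<le> m" for m
  proof -
    have "ln (real m / real n) \<le> ln (real (Suc m) / real n)"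
      using that assms(2) by (simp add: divide_right_mono)
    then have "measure lborel (I m) = ln (real (Suc m) / real n) - ln (real m / real n)"
      by (simp add: I_def)
    also have "\<dots> = ln ((real (Suc m) / real n) / (real m / real n))"
      using that assms(2) by (subst ln_div) auto
    also have "(real (Suc m) / real n) / (real m / real n) = 1 + 1 / real m"
      using that assms(2) by (simp add: field_simps)
    finally show ?thesis .
  qed
  have "(\<integral>t. (if m0 \<le> time_index n t \<and> time_index n t < m1 then G (time_index n t) / ln (1 + 1 / real (time_index n t)) else 0) \<partial>lborel)
     = (\<integral>t. (\<Sum>m=m0..<m1. indicator (I m) t * (G m / ln (1 + 1 / real m))) \<partial>lborel)"
  proof (rule Bochner_Integration.integral_cong[OF refl])
    fix t
    have "(\<Sum>m=m0..<m1. indicator (I m) t * (G m / ln (1 + 1 / real m)))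
       = (\<Sum>m=m0..<m1. if m = time_index n t then G m / ln (1 + 1 / real m) else 0)"
      using I assms(1) by (intro sum.cong) (auto simp: indicator_def)
    also have "\<dots> = (if m0 \<le> time_index n t \<and> time_index n t < m1 then G (time_index n t) / ln (1 + 1 / real (time_index n t)) else 0)"
      by (simp add: sum.delta)
    finally show "(if m0 \<le> time_index n t \<and> time_index n t < m1 then G (time_index n t) / ln (1 + 1 / real (time_index n t)) else 0)
       = (\<Sum>m=m0..<m1. indicator (I m) t * (G m / ln (1 + 1 / real m)))" by simp
  qed
  also have "\<dots> = (\<Sum>m=m0..<m1. \<integral>t. indicator (I m) t * (G m / ln (1 + 1 / real m)) \<partial>lborel)"
    by (intro Bochner_Integration.integral_sum integrable_mult_left integrable_real_indicator)
      (use fin in \<open>auto simp: I_def\<close>)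
  also have "\<dots> = (\<Sum>m=m0..<m1. G m)"
  proof (intro sum.cong refl)
    fix m assume "m \<in> {m0..<m1}"
    then have m: "1 \<le> m" using assms by simp
    then have "0 < ln (1 + 1 / real m)" by (intro ln_gt_zero) simp
    then show "(\<integral>t. indicator (I m) t * (G m / ln (1 + 1 / real m)) \<partial>lborel) = G m"
      using meas[OF m] by simp
  qed
  finally show ?thesis by simp
qed

text \<open>The reciprocal interval length behaves like m; the factor 2 gives a bound valid for all
  m \<ge> 1, as domination requires. It comes from ln x \<le> x - 1 at x = m / (m + 1).\<close>

lemma inverse_ln_bound:
  assumes "1 \<le> m" shows "0 < ln (1 + 1 / real m)" and "1 / ln (1 + 1 / real m) \<le> 2 * real m"
proof -
  show pos: "0 < ln (1 + 1 / real m)" using assms by (intro ln_gt_zero) simp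
  have "ln (real m / (real m + 1)) \<le> real m / (real m + 1) - 1"
    using assms by (intro ln_le_minus_one) simp
  moreover have "ln (real m / (real m + 1)) = - ln (1 + 1 / real m)"
  proof -
    have "1 + 1 / real m = (real m + 1) / real m" using assms by (simp add: field_simps)
    then show ?thesis using assms by (simp add: ln_div)
  qed
  moreover have "real m / (real m + 1) - 1 = - (1 / (real m + 1))" by (simp add: field_simps)
  ultimately have "1 / (real m + 1) \<le> ln (1 + 1 / real m)" by simp
  moreover have "1 / (2 * real m) \<le> 1 / (real m + 1)"
    using assms by (intro divide_left_mono) auto
  ultimately have "1 / (2 * real m) \<le> ln (1 + 1 / real m)" by linarith
  then show "1 / ln (1 + 1 / real m) \<le> 2 * real m"
    using pos assms by (simp add: field_simps)
qed

lemma integrable_exp_neg_halfline: "integrable lborel (\<lambda>t :: real. if t \<le> 0 then exp t else 0)"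
proof -
  have "(\<integral>\<^sup>+x. ennreal (exponential_density 1 x) \<partial>lborel) = 1"
    using prob_space.emeasure_space_1[OF prob_space_exponential_density[of 1]] by (simp add: emeasure_density)
  then have "integrable lborel (exponential_density 1)"
    by (intro integrableI_nonneg) (auto simp: exponential_density_def)
  then have "integrable lborel (\<lambda>x :: real. exponential_density 1 (0 + (-1) * x))"
    by (rule lborel_integrable_real_affine) simp
  moreover have "exponential_density 1 (0 + (-1) * x) = (if x \<le> 0 then exp x else 0)" for x :: real
    by (simp add: exponential_density_def)
  ultimately show ?thesis by simp
qed

text \<open>Dominated convergence for the step functions of \<open>sum_eq_log_integral\<close>. A
  summand of size C/n divided by an interval length is at most (C/n) * 2m, and m \<le> n * exp t
  yields the integrable majorant 2 * C * exp t on t \<le> 0. Pointwise convergence is asked for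
  almost all t only, which tolerates the jumps of h; the lower limit m0 may move with n.\<close>

lemma riemann_sum_limit:
  fixes F :: "nat \<Rightarrow> nat \<Rightarrow> real"
  assumes b: "b \<le> 0" and C: "0 \<le> C"
    and bound: "\<forall>\<^sub>F n in sequentially. 1 \<le> m0 n \<and> (\<forall>m. m0 n \<le> m \<and> m < time_index n b \<longrightarrow> \<bar>F n m\<bar> \<le> C / real n)"
    and [measurable]: "f \<in> borel_measurable borel"
    and lim: "AE t in lborel. t < b \<longrightarrow> (\<lambda>n. if m0 n \<le> time_index n t then real (time_index n t) * F n (time_index n t) else 0) \<longlonglongrightarrow> f t"
  shows "(\<lambda>n. \<Sum>m=m0 n..<time_index n b. F n m) \<longlonglongrightarrow> (\<integral>t. (if t < b then f t else 0) \<partial>lborel)"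
proof -
  define u where "u n t = (if m0 n \<le> time_index n t \<and> time_index n t < time_index n b then F n (time_index n t) / ln (1 + 1 / real (time_index n t)) else 0)" for n t
  obtain N where N: "\<And>n. N \<le> n \<Longrightarrow> 1 \<le> m0 n \<and> (\<forall>m. m0 n \<le> m \<and> m < time_index n b \<longrightarrow> \<bar>F n m\<bar> \<le> C / real n)"
    using bound by (auto simp: eventually_sequentially)
  \<comment> \<open>The bounds hold only from N on, whereas the majorant must serve every member of
    the sequence; the successor also excludes n = 0.\<close>
  have "(\<lambda>n. \<integral>t. u (n + Suc N) t \<partial>lborel) \<longlonglongrightarrow> (\<integral>t. (if t < b then f t else 0) \<partial>lborel)"
  proof (rule integral_dominated_convergence[where w="\<lambda>t. (2 * C) * (if t \<le> 0 then exp t else 0)"])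
    show "integrable lborel (\<lambda>t :: real. (2 * C) * (if t \<le> 0 then exp t else 0))"
      by (intro integrable_mult_right integrable_exp_neg_halfline)
    show "u (n + Suc N) \<in> borel_measurable lborel" for n unfolding u_def by measurable
    show "AE t in lborel. norm (u (n + Suc N) t) \<le> (2 * C) * (if t \<le> 0 then exp t else 0)" for n
    proof (intro AE_I2)
      fix t
      let ?n = "n + Suc N" and ?m = "time_index (n + Suc N) t"
      show "norm (u ?n t) \<le> (2 * C) * (if t \<le> 0 then exp t else 0)"
      proof (cases "m0 ?n \<le> ?m \<and> ?m < time_index ?n b")
        case True
        have n: "N \<le> ?n" by simp
        have m: "1 \<le> ?m" using N[OF n] True by linarith
        have "t < b" using True time_index_mono[of b t ?n] by (meson leD leI)
        have "\<bar>F ?n ?m\<bar> * (1 / ln (1 + 1 / real ?m)) \<le> (C / real ?n) * (2 * real ?m)"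
          using N[OF n] True inverse_ln_bound[OF m] C by (intro mult_mono) auto
        also have "\<dots> \<le> (C / real ?n) * (2 * (real ?n * exp t))"
          using C time_index_le[of ?n t] by (intro mult_left_mono) auto
        also have "\<dots> = 2 * C * exp t" by simp
        finally show ?thesis
          using True \<open>t < b\<close> b inverse_ln_bound(1)[OF m] by (simp add: u_def abs_divide)
      qed (auto simp: u_def C)
    qed
    show "AE t in lborel. (\<lambda>n. u (n + Suc N) t) \<longlonglongrightarrow> (if t < b then f t else 0)"
      using lim AE_lborel_singleton[of b]
    proof eventually_elim
      case (elim t)
      show ?case
      proof (cases "t < b")
        case True
        have A: "(\<lambda>n. 1 / (real (time_index n t) * ln (1 + 1 / real (time_index n t)))) \<longlonglongrightarrow> 1"
        proof -
          have "(\<lambda>m :: nat. 1 / (real m * ln (1 + 1 / real m))) \<longlonglongrightarrow> 1" by real_asymp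
          from filterlim_compose[OF this time_index_at_top[of t]] show ?thesis .
        qed
        have "(\<lambda>n. (if m0 n \<le> time_index n t then real (time_index n t) * F n (time_index n t) else 0) *
            (1 / (real (time_index n t) * ln (1 + 1 / real (time_index n t))))) \<longlonglongrightarrow> f t * 1"
          using elim(1) True A by (intro tendsto_mult) auto
        then have "(\<lambda>n. u n t) \<longlonglongrightarrow> f t * 1"
        proof (rule Lim_transform_eventually)
          show "\<forall>\<^sub>F n in sequentially. (if m0 n \<le> time_index n t then real (time_index n t) * F n (time_index n t) else 0) *
            (1 / (real (time_index n t) * ln (1 + 1 / real (time_index n t)))) = u n t"
            using time_index_less_eventually[OF True] eventually_compose_filterlim[OF eventually_gt_at_top[of 0] time_index_at_top[of t]]
            by eventually_elim (auto simp: u_def)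
        qed
        from LIMSEQ_ignore_initial_segment[OF this, of "Suc N"] show ?thesis using True by simp
      next
        case False
        then have "u n t = 0" for n using time_index_mono[of b t n] by (auto simp: u_def)
        then show ?thesis using False by simp
      qed
    qed
  qed simp
  moreover have "(\<integral>t. u (n + Suc N) t \<partial>lborel) = (\<Sum>m=m0 (n + Suc N)..<time_index (n + Suc N) b. F (n + Suc N) m)" for n
    unfolding u_def using N[of "n + Suc N"] by (subst sum_eq_log_integral[symmetric]) auto
  ultimately have "(\<lambda>n. \<Sum>m=m0 (n + Suc N)..<time_index (n + Suc N) b. F (n + Suc N) m) \<longlonglongrightarrow> (\<integral>t. (if t < b then f t else 0) \<partial>lborel)"
    by simp
  then show ?thesis by (rule LIMSEQ_offset)
qed


section \<open>Limits of rates, survival probabilities and match probabilities\<close>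

context macro_delay
begin

text \<open>At time m = n * exp t the delayed size is about n * exp t * (1 - \<xi>), and the vertex
  n * exp s is visible in it iff 1 - \<xi> > exp (s - t), that is \<eta> < t - s. Then m divided by
  the total weight tends to exp \<eta> / (2 + \<alpha>). On the boundary \<eta> = t - s the rounding
  decides, so this value must not be an atom.\<close>

lemma attach_kernel_limit:
  assumes st: "s < t" "t \<le> 0" and atom: "measure \<mu> {1 - exp (s - t)} = 0"
  shows "(\<lambda>n. real (time_index n t) * attach_kernel (time_index n t) (time_index n s)) \<longlonglongrightarrow> h (t - s)"
proof -
  define u where "u n \<xi> = (if time_index n s < delayed_size (time_index n t) \<xi>
      then real (time_index n t) / ((2 + \<alpha>) * real (delayed_size (time_index n t) \<xi>) - 2) else 0)" for n \<xi>
  define g where "g \<xi> = (if \<xi> < 1 \<and> - ln (1 - \<xi>) \<le> t - s then exp (- ln (1 - \<xi>)) else 0) / (2 + \<alpha>)" for \<xi> :: real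
  \<comment> \<open>The kernel bound 1/(2w) gives m/(2w), which tends to exp (t - s) / 2. The spare
    factor 2 makes exp (t - s) a bound for all large n.\<close>
  have ev: "\<forall>\<^sub>F n in sequentially. 1 \<le> time_index n s \<and> real (time_index n t) / (2 * real (time_index n s)) \<le> exp (t - s)"
  proof -
    have "(\<lambda>n. (real (time_index n t) / real n) / (2 * (real (time_index n s) / real n))) \<longlonglongrightarrow> exp t / (2 * exp s)"
      by (intro tendsto_intros time_index_over_n) simp
    moreover have "exp t / (2 * exp s) < exp (t - s)"
    proof -
      have "exp t = exp s * exp (t - s)" by (simp flip: exp_add)
      then have "exp t / (2 * exp s) = exp (t - s) / 2" by simp
      also have "\<dots> < exp (t - s)" by simp
      finally show ?thesis .
    qed
    ultimately have "\<forall>\<^sub>F n in sequentially. (real (time_index n t) / real n) / (2 * (real (time_index n s) / real n)) < exp (t - s)"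
      by (rule order_tendstoD(2))
    with eventually_compose_filterlim[OF eventually_ge_at_top[of 1] time_index_at_top[of s]] eventually_gt_at_top[of 0]
    show ?thesis by eventually_elim auto
  qed
  then obtain N where N: "\<And>n. N \<le> n \<Longrightarrow> 1 \<le> time_index n s \<and> real (time_index n t) / (2 * real (time_index n s)) \<le> exp (t - s)"
    by (auto simp: eventually_sequentially)
  have "(\<lambda>n. \<integral>\<xi>. u (n + N) \<xi> \<partial>\<mu>) \<longlonglongrightarrow> (\<integral>\<xi>. g \<xi> \<partial>\<mu>)"
  proof (rule integral_dominated_convergence[where w="\<lambda>_. exp (t - s)"])
    show "g \<in> borel_measurable \<mu>" unfolding g_def by measurable
    show "u (n + N) \<in> borel_measurable \<mu>" for n unfolding u_def by measurable
    show "AE \<xi> in \<mu>. norm (u (n + N) \<xi>) \<le> exp (t - s)" for n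
    proof (intro AE_I2)
      fix \<xi>
      let ?n = "n + N"
      have w: "1 \<le> time_index ?n s" and le: "real (time_index ?n t) / (2 * real (time_index ?n s)) \<le> exp (t - s)" using N[of ?n] by auto
      have "u ?n \<xi> = real (time_index ?n t) * (if time_index ?n s < delayed_size (time_index ?n t) \<xi> then 1 / ((2 + \<alpha>) * real (delayed_size (time_index ?n t) \<xi>) - 2) else 0)"
        by (simp add: u_def)
      moreover have "\<dots> \<le> real (time_index ?n t) * (1 / (2 * real (time_index ?n s)))"
        by (rule mult_left_mono[OF attach_kernel_bounds(2)[OF w]]) simp
      moreover have "0 \<le> \<dots>" by simp
      moreover have "0 \<le> u ?n \<xi>" unfolding calculation(1) by (rule mult_nonneg_nonneg[OF _ attach_kernel_bounds(1)[OF w]]) simp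
      ultimately show "norm (u ?n \<xi>) \<le> exp (t - s)" using le by simp
    qed
    have ne: "AE \<xi> in \<mu>. \<xi> \<noteq> 1 - exp (s - t)"
    proof -
      have "{1 - exp (s - t)} \<in> null_sets \<mu>" using atom by (intro null_setsI) (auto simp: mu.emeasure_eq_measure)
      from AE_not_in[OF this] show ?thesis by simp
    qed
    show "AE \<xi> in \<mu>. (\<lambda>n. u (n + N) \<xi>) \<longlonglongrightarrow> g \<xi>"
      using AE_mu ne
    proof eventually_elim
      case (elim \<xi>)
      define q where "q = 1 - \<xi>"
      have q: "0 \<le> q" "q \<le> 1" "q \<noteq> exp (s - t)" using elim by (auto simp: q_def)
      have delayed_size_le: "real (delayed_size m \<xi>) \<le> real m * q" and delayed_size_gt: "real m * q < real (delayed_size m \<xi>) + 1" for m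
      proof -
        have "delayed_size m \<xi> = nat \<lfloor>real m * q\<rfloor>" by (simp add: delayed_size_def q_def algebra_simps)
        moreover have "0 \<le> real m * q" using q by simp
        ultimately show "real (delayed_size m \<xi>) \<le> real m * q" "real m * q < real (delayed_size m \<xi>) + 1" by simp_all
      qed
      have dlim: "(\<lambda>n. real (delayed_size (time_index n t) \<xi>) / real n) \<longlonglongrightarrow> exp t * q"
      proof (rule real_tendsto_sandwich)
        show "\<forall>\<^sub>F n in sequentially. real (time_index n t) / real n * q - 1 / real n \<le> real (delayed_size (time_index n t) \<xi>) / real n"
          using eventually_gt_at_top[of 0]
        proof eventually_elim
          case (elim n)
          then have "(real (time_index n t) * q - 1) / real n \<le> real (delayed_size (time_index n t) \<xi>) / real n"
            using delayed_size_gt[of "time_index n t"] by (intro divide_right_mono) auto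
          then show ?case by (simp add: diff_divide_distrib)
        qed
        show "\<forall>\<^sub>F n in sequentially. real (delayed_size (time_index n t) \<xi>) / real n \<le> real (time_index n t) / real n * q"
          using delayed_size_le by (intro always_eventually) (auto intro: divide_right_mono)
        have "(\<lambda>n. real (time_index n t) / real n * q - 1 / real n) \<longlonglongrightarrow> exp t * q - 0"
          by (intro tendsto_intros time_index_over_n lim_1_over_n)
        then show "(\<lambda>n. real (time_index n t) / real n * q - 1 / real n) \<longlonglongrightarrow> exp t * q" by simp
        show "(\<lambda>n. real (time_index n t) / real n * q) \<longlonglongrightarrow> exp t * q"
          by (intro tendsto_intros time_index_over_n)
      qed
      have diff: "(\<lambda>n. real (delayed_size (time_index n t) \<xi>) / real n - real (time_index n s) / real n) \<longlonglongrightarrow> exp t * q - exp s"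
        by (intro tendsto_diff dlim time_index_over_n)
      have "(\<lambda>n. u n \<xi>) \<longlonglongrightarrow> g \<xi>"
      proof (cases "exp (s - t) < q")
        case True
        then have pos: "0 < exp t * q - exp s" by (simp add: exp_diff field_simps)
        have q0: "0 < q" using True by (meson exp_gt_zero order.strict_trans)
        have a2: "2 + \<alpha> \<noteq> 0" using alpha by simp
        have "- ln q \<le> t - s"
        proof -
          have "s - t \<le> ln q" using True q0 by (subst ln_ge_iff) auto
          then show ?thesis by simp
        qed
        then have g: "g \<xi> = exp t / ((2 + \<alpha>) * (exp t * q) - 0)"
        proof -
          have "\<xi> < 1" using q0 by (simp add: q_def)
          then have "g \<xi> = (1 / q) / (2 + \<alpha>)"
            using \<open>- ln q \<le> t - s\<close> q0 unfolding g_def q_def[symmetric] by (simp add: exp_minus inverse_eq_divide)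
          moreover have "exp t / ((2 + \<alpha>) * (exp t * q) - 0) = (1 / q) / (2 + \<alpha>)"
            using a2 q0 by simp
          ultimately show ?thesis by simp
        qed
        have "(\<lambda>n. (real (time_index n t) / real n) / ((2 + \<alpha>) * (real (delayed_size (time_index n t) \<xi>) / real n) - 2 / real n)) \<longlonglongrightarrow> g \<xi>"
          unfolding g
        proof (rule tendsto_divide[OF time_index_over_n tendsto_diff[OF tendsto_mult[OF tendsto_const dlim]]])
          show "(\<lambda>n. 2 / real n) \<longlonglongrightarrow> 0" by real_asymp
          show "(2 + \<alpha>) * (exp t * q) - 0 \<noteq> 0" using q0 a2 by simp
        qed
        then show ?thesis
        proof (rule Lim_transform_eventually)
          show "\<forall>\<^sub>F n in sequentially. (real (time_index n t) / real n) / ((2 + \<alpha>) * (real (delayed_size (time_index n t) \<xi>) / real n) - 2 / real n) = u n \<xi>"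
            using order_tendstoD(1)[OF diff pos] eventually_gt_at_top[of 0]
          proof eventually_elim
            case (elim n)
            then have "time_index n s < delayed_size (time_index n t) \<xi>" by (simp add: divide_less_cancel)
            moreover have "(2 + \<alpha>) * (real (delayed_size (time_index n t) \<xi>) / real n) - 2 / real n = ((2 + \<alpha>) * real (delayed_size (time_index n t) \<xi>) - 2) / real n"
              by (simp add: diff_divide_distrib)
            ultimately show ?case using elim by (simp add: u_def)
          qed
        qed
      next
        case False
        then have "q < exp (s - t)" using q by simp
        then have neg: "exp t * q - exp s < 0" by (simp add: exp_diff field_simps)
        have "\<not> (\<xi> < 1 \<and> - ln (1 - \<xi>) \<le> t - s)"
        proof
          assume *: "\<xi> < 1 \<and> - ln (1 - \<xi>) \<le> t - s"
          then have "s - t \<le> ln q" "0 < q" by (auto simp: q_def)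
          then have "exp (s - t) \<le> q" by (metis ln_ge_iff)
          then show False using \<open>q < exp (s - t)\<close> by simp
        qed
        then have g: "g \<xi> = 0" unfolding g_def by (simp only: if_False div_0)
        show ?thesis unfolding g
        proof (rule tendsto_eventually)
          show "\<forall>\<^sub>F n in sequentially. u n \<xi> = 0"
            using order_tendstoD(2)[OF diff neg] eventually_gt_at_top[of 0]
            by eventually_elim (auto simp: u_def divide_less_cancel)
        qed
      qed
      from LIMSEQ_ignore_initial_segment[OF this, of N] show ?case .
    qed
  qed auto
  moreover have "(\<integral>\<xi>. u (n + N) \<xi> \<partial>\<mu>) = real (time_index (n + N) t) * attach_kernel (time_index (n + N) t) (time_index (n + N) s)" for n
  proof -
    have "u (n + N) \<xi> = real (time_index (n + N) t) * (if time_index (n + N) s < delayed_size (time_index (n + N) t) \<xi> then 1 / ((2 + \<alpha>) * real (delayed_size (time_index (n + N) t) \<xi>) - 2) else 0)" for \<xi>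
      by (simp add: u_def)
    then show ?thesis unfolding attach_kernel_def by (simp only: Bochner_Integration.integral_mult_right_zero)
  qed
  moreover have "(\<integral>\<xi>. g \<xi> \<partial>\<mu>) = h (t - s)"
    unfolding g_def hfun_def by simp
  ultimately have "(\<lambda>n. real (time_index (n + N) t) * attach_kernel (time_index (n + N) t) (time_index (n + N) s)) \<longlonglongrightarrow> h (t - s)"
    by simp
  then show ?thesis by (rule LIMSEQ_offset)
qed

abbreviation pasts :: "nat \<Rightarrow> (nat \<Rightarrow> real) \<Rightarrow> nat \<Rightarrow> nat list" where
  "pasts n s i \<equiv> map (\<lambda>j. time_index n (s j)) [0..<Suc i]"

text \<open>For each earlier arrival s j the limit can fail only if 1 - exp (s j - t) is an atom of
  \<mu>. A probability measure has countably many atoms, and finitely many arrivals matter.\<close>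

lemma attach_rate_limit:
  assumes s: "\<And>j. j \<le> i \<Longrightarrow> s j \<le> s i"
  shows "AE t in lborel. s i < t \<and> t \<le> 0 \<longrightarrow>
    (\<lambda>n. real (time_index n t) * attach_rate (time_index n t) (pasts n s i)) \<longlonglongrightarrow> haz s i t"
proof -
  \<comment> \<open>The map x \<mapsto> s j - ln (1 - x) inverts t \<mapsto> 1 - exp (s j - t), so B
    contains every exceptional time.\<close>
  define B where "B = (\<Union>j\<le>i. (\<lambda>x. s j - ln (1 - x)) ` {x. measure \<mu> {x} \<noteq> 0})"
  have "countable B" unfolding B_def by (intro countable_UN countable_image mu.countable_support) auto
  then have "AE t in lborel. t \<notin> B" by (intro AE_not_in countable_imp_null_set_lborel)
  then show ?thesis
  proof (eventually_elim, intro impI)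
    fix t assume "t \<notin> B" "s i < t \<and> t \<le> 0"
    then have t: "t \<notin> B" "s i < t" "t \<le> 0" by auto
    have attach_kernel: "(\<lambda>n. real (time_index n t) * attach_kernel (time_index n t) (time_index n (s j))) \<longlonglongrightarrow> h (t - s j)" if "j \<le> i" for j
    proof (rule attach_kernel_limit)
      show "s j < t" "t \<le> 0" using s[OF that] t by auto
      show "measure \<mu> {1 - exp (s j - t)} = 0"
      proof (rule ccontr)
        assume "measure \<mu> {1 - exp (s j - t)} \<noteq> 0"
        then have "s j - ln (1 - (1 - exp (s j - t))) \<in> B" using that unfolding B_def by blast
        then show False using t by simp
      qed
    qed
    define r where "r n = (\<Sum>w\<leftarrow>pasts n s i. attach_kernel (time_index n t) w) + \<alpha> * attach_kernel (time_index n t) (hd (pasts n s i))" for n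
    have r: "r n = (\<Sum>j\<le>i. attach_kernel (time_index n t) (time_index n (s j))) + \<alpha> * attach_kernel (time_index n t) (time_index n (s 0))" for n
    proof -
      have "(\<Sum>w\<leftarrow>pasts n s i. attach_kernel (time_index n t) w) = (\<Sum>j\<leftarrow>[0..<Suc i]. attach_kernel (time_index n t) (time_index n (s j)))"
        by (simp only: map_map comp_def)
      also have "\<dots> = (\<Sum>j\<le>i. attach_kernel (time_index n t) (time_index n (s j)))"
        by (simp only: sum_list_distinct_conv_sum_set[OF distinct_upt] set_upt atLeast0LessThan lessThan_Suc_atMost)
      moreover have "hd (pasts n s i) = time_index n (s 0)" by (simp add: hd_map upt_conv_Cons del: upt_Suc)
      ultimately show ?thesis by (simp only: r_def)
    qed
    have "(\<lambda>n. (\<Sum>j\<le>i. real (time_index n t) * attach_kernel (time_index n t) (time_index n (s j))) + \<alpha> * (real (time_index n t) * attach_kernel (time_index n t) (time_index n (s 0))))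
        \<longlonglongrightarrow> (\<Sum>j\<le>i. h (t - s j)) + \<alpha> * h (t - s 0)"
      using attach_kernel by (intro tendsto_intros) auto
    then have lim: "(\<lambda>n. real (time_index n t) * r n) \<longlonglongrightarrow> haz s i t"
      by (simp add: r haz_def algebra_simps sum_distrib_left)
    \<comment> \<open>The uncapped rate r n is of order 1/m and tends to 0. Hence the minimum with 1
      in \<open>attach_rate\<close> is eventually inactive, also for lists that come from no
      tree.\<close>
    have "(\<lambda>n. real (time_index n t) * r n * (1 / real (time_index n t))) \<longlonglongrightarrow> haz s i t * 0"
      by (intro tendsto_mult lim filterlim_compose[OF lim_1_over_n time_index_at_top])
    then have "\<forall>\<^sub>F n in sequentially. real (time_index n t) * r n * (1 / real (time_index n t)) < 1"
      by (rule order_tendstoD(2)) simp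
    with eventually_compose_filterlim[OF eventually_gt_at_top[of 0] time_index_at_top[of t]]
    have ev: "\<forall>\<^sub>F n in sequentially. real (time_index n t) * r n = real (time_index n t) * attach_rate (time_index n t) (pasts n s i)"
      by eventually_elim (simp add: attach_rate_def r_def del: upt_Suc)
    show "(\<lambda>n. real (time_index n t) * attach_rate (time_index n t) (pasts n s i)) \<longlonglongrightarrow> haz s i t"
      using lim ev by (rule Lim_transform_eventually)
  qed
qed

lemma attach_rate_eventually_bounds:
  assumes s: "\<And>j. j \<le> i \<Longrightarrow> s 0 \<le> s j"
  obtains C where "0 \<le> C" "\<forall>\<^sub>F n in sequentially. \<forall>m. 0 \<le> attach_rate m (pasts n s i) \<and> attach_rate m (pasts n s i) \<le> 1
    \<and> attach_rate m (pasts n s i) \<le> C / real n"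
proof
  \<comment> \<open>The oldest vertex of the list eventually exceeds n * exp (s 0) / 2, and the 2 in
    the denominator of \<open>attach_rate_bounds\<close> absorbs this half.\<close>
  define C where "C = (real (Suc i) + \<alpha>) * exp (- s 0)"
  show "0 \<le> C" using alpha by (simp add: C_def)
  have "\<forall>\<^sub>F n in sequentially. exp (s 0) / 2 < real (time_index n (s 0)) / real n"
    by (rule order_tendstoD(1)[OF time_index_over_n]) simp
  then show "\<forall>\<^sub>F n in sequentially. \<forall>m. 0 \<le> attach_rate m (pasts n s i) \<and> attach_rate m (pasts n s i) \<le> 1
    \<and> attach_rate m (pasts n s i) \<le> C / real n"
    using eventually_gt_at_top[of 0]
      eventually_compose_filterlim[OF eventually_ge_at_top[of 1] time_index_at_top[of "s 0"]]
  proof (eventually_elim, intro allI)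
    fix n m :: nat
    assume elim: "exp (s 0) / 2 < real (time_index n (s 0)) / real n" "0 < n" "1 \<le> time_index n (s 0)"
    have xs: "pasts n s i \<noteq> []" "\<forall>w\<in>set (pasts n s i). time_index n (s 0) \<le> w"
      using s by (auto simp del: upt_Suc intro!: time_index_mono)
    have "(real (length (pasts n s i)) + \<alpha>) / (2 * real (time_index n (s 0))) \<le> (real (Suc i) + \<alpha>) / (exp (s 0) * real n)"
      using elim alpha by (intro frac_le) (auto simp: field_simps)
    also have "\<dots> = C / real n" by (simp add: C_def exp_minus field_simps)
    finally show "0 \<le> attach_rate m (pasts n s i) \<and> attach_rate m (pasts n s i) \<le> 1
        \<and> attach_rate m (pasts n s i) \<le> C / real n" using attach_rate_bounds[OF xs elim(3), of m] by linarith
  qed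
qed

text \<open>Replacing one factor 1 - a by exp (- a) costs at most a^2, and the other factors are at
  most 1. With about n rates of size O(1/n) the total error is O(1/n).\<close>

lemma prod_diff_exp_sum:
  fixes a :: "nat \<Rightarrow> real"
  assumes "finite A" "\<And>l. l \<in> A \<Longrightarrow> 0 \<le> a l \<and> a l \<le> 1"
  shows "\<bar>(\<Prod>l\<in>A. 1 - a l) - exp (- (\<Sum>l\<in>A. a l))\<bar> \<le> (\<Sum>l\<in>A. (a l)\<^sup>2)"
  using assms
proof (induction A rule: finite_induct)
  case (insert x A)
  let ?P = "\<Prod>l\<in>A. 1 - a l" and ?E = "exp (- (\<Sum>l\<in>A. a l))"
  have P: "0 \<le> ?P" "?P \<le> 1" using insert.prems by (auto intro!: prod_nonneg prod_le_1)
  have x: "0 \<le> a x" "a x \<le> 1" using insert.prems by auto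
  have E: "0 \<le> ?E" "?E \<le> 1" using insert.prems by (auto intro!: sum_nonneg)
  have ex: "0 \<le> exp (- a x) - (1 - a x)" "exp (- a x) - (1 - a x) \<le> (a x)\<^sup>2"
  proof -
    show "0 \<le> exp (- a x) - (1 - a x)" using exp_ge_add_one_self[of "- a x"] by simp
    have "exp (- a x) \<le> inverse (1 + a x)"
      unfolding exp_minus using x exp_ge_add_one_self[of "a x"] by (intro le_imp_inverse_le) auto
    moreover have "inverse (1 + a x) - (1 - a x) = (a x)\<^sup>2 / (1 + a x)"
      using x by (simp add: field_simps power2_eq_square)
    moreover have "(a x)\<^sup>2 / (1 + a x) \<le> (a x)\<^sup>2 / 1" using x by (intro divide_left_mono) auto
    ultimately show "exp (- a x) - (1 - a x) \<le> (a x)\<^sup>2" by simp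
  qed
  have "(\<Prod>l\<in>insert x A. 1 - a l) - exp (- (\<Sum>l\<in>insert x A. a l)) = (1 - a x) * ?P - exp (- a x) * ?E"
    using insert.hyps by (simp add: exp_diff exp_minus field_simps)
  also have "\<dots> = (1 - a x) * (?P - ?E) - (exp (- a x) - (1 - a x)) * ?E" by (simp add: algebra_simps)
  also have "\<bar>\<dots>\<bar> \<le> \<bar>(1 - a x) * (?P - ?E)\<bar> + \<bar>(exp (- a x) - (1 - a x)) * ?E\<bar>" by linarith
  also have "\<bar>(1 - a x) * (?P - ?E)\<bar> \<le> \<bar>?P - ?E\<bar>"
    using x by (auto simp: abs_mult intro!: mult_left_le_one_le)
  also have "\<bar>(exp (- a x) - (1 - a x)) * ?E\<bar> \<le> (a x)\<^sup>2"
    using ex E mult_mono[of "exp (- a x) - (1 - a x)" "(a x)\<^sup>2" ?E 1] by (simp add: abs_mult)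
  also have "\<bar>?P - ?E\<bar> \<le> (\<Sum>l\<in>A. (a l)\<^sup>2)" using insert by simp
  finally show ?case using insert.hyps by simp
qed simp

text \<open>The sum of the rates is a Riemann sum for the cumulative hazard, and
  \<open>prod_diff_exp_sum\<close> passes from the sum to the product.\<close>

lemma survival_limit:
  assumes s: "\<And>j. j \<le> i \<Longrightarrow> s 0 \<le> s j \<and> s j \<le> s i" and b: "b \<le> 0"
  shows "(\<lambda>n. \<Prod>l=Suc (time_index n (s i))..<time_index n b. 1 - attach_rate l (pasts n s i)) \<longlonglongrightarrow> exp (- cum (haz s i) (s i) b)"
proof -
  let ?a = "\<lambda>n l. attach_rate l (pasts n s i)" and ?A = "\<lambda>n. {Suc (time_index n (s i))..<time_index n b}"
  obtain C where C: "0 \<le> C" "\<forall>\<^sub>F n in sequentially. \<forall>m. 0 \<le> ?a n m \<and> ?a n m \<le> 1 \<and> ?a n m \<le> C / real n"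
    using attach_rate_eventually_bounds[of i s] s by blast
  have lim: "AE t in lborel. s i < t \<and> t \<le> 0 \<longrightarrow> (\<lambda>n. real (time_index n t) * ?a n (time_index n t)) \<longlonglongrightarrow> haz s i t"
    by (rule attach_rate_limit) (use s in blast)
  have "(\<lambda>n. \<Sum>l=Suc (time_index n (s i))..<time_index n b. ?a n l) \<longlonglongrightarrow> (\<integral>t. (if t < b then if s i < t then haz s i t else 0 else 0) \<partial>lborel)"
  proof (rule riemann_sum_limit[OF b C(1)])
    show "\<forall>\<^sub>F n in sequentially. 1 \<le> Suc (time_index n (s i)) \<and>
        (\<forall>m. Suc (time_index n (s i)) \<le> m \<and> m < time_index n b \<longrightarrow> \<bar>?a n m\<bar> \<le> C / real n)"
      using C(2) by eventually_elim auto
    show "AE t in lborel. t < b \<longrightarrow> (\<lambda>n. if Suc (time_index n (s i)) \<le> time_index n t then real (time_index n t) * ?a n (time_index n t) else 0)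
        \<longlonglongrightarrow> (if s i < t then haz s i t else 0)"
      using lim AE_lborel_singleton[of "s i"]
    proof (eventually_elim, intro impI)
      fix t assume elim: "s i < t \<and> t \<le> 0 \<longrightarrow> (\<lambda>n. real (time_index n t) * ?a n (time_index n t)) \<longlonglongrightarrow> haz s i t" "t \<noteq> s i" "t < b"
      then consider "s i < t" | "t < s i" by linarith
      then show "(\<lambda>n. if Suc (time_index n (s i)) \<le> time_index n t then real (time_index n t) * ?a n (time_index n t) else 0)
        \<longlonglongrightarrow> (if s i < t then haz s i t else 0)"
      proof cases
        case 1
        then have "(\<lambda>n. real (time_index n t) * ?a n (time_index n t)) \<longlonglongrightarrow> haz s i t" using elim b s by auto
        from time_index_gate_limit[OF this 1] show ?thesis using 1 by (simp del: upt_Suc)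
      next
        case 2
        then have "\<not> Suc (time_index n (s i)) \<le> time_index n t" for n using time_index_mono[of t "s i" n] by simp
        then show ?thesis using 2 by simp
      qed
    qed
  qed measurable
  also have "(\<integral>t. (if t < b then if s i < t then haz s i t else 0 else 0) \<partial>lborel) = cum (haz s i) (s i) b"
    unfolding cum_def
  proof (rule integral_cong_AE)
    show "AE t in lborel. (if t < b then if s i < t then haz s i t else 0 else 0) = (if s i \<le> t \<and> t \<le> b then haz s i t else 0)"
      using AE_lborel_singleton[of "s i"] AE_lborel_singleton[of b] by eventually_elim auto
  qed measurable
  finally have "(\<lambda>n. exp (- (\<Sum>l\<in>?A n. ?a n l))) \<longlonglongrightarrow> exp (- cum (haz s i) (s i) b)"
    by (intro tendsto_intros)
  moreover have "(\<lambda>n. (\<Prod>l\<in>?A n. 1 - ?a n l) - exp (- (\<Sum>l\<in>?A n. ?a n l))) \<longlonglongrightarrow> 0"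
  proof (rule Lim_null_comparison)
    show "\<forall>\<^sub>F n in sequentially. norm ((\<Prod>l\<in>?A n. 1 - ?a n l) - exp (- (\<Sum>l\<in>?A n. ?a n l))) \<le> C\<^sup>2 / real n"
      using C(2) eventually_gt_at_top[of 0]
    proof eventually_elim
      case (elim n)
      have "norm ((\<Prod>l\<in>?A n. 1 - ?a n l) - exp (- (\<Sum>l\<in>?A n. ?a n l))) \<le> (\<Sum>l\<in>?A n. (?a n l)\<^sup>2)"
        unfolding real_norm_def using elim by (intro prod_diff_exp_sum) auto
      also have "\<dots> \<le> (\<Sum>l\<in>?A n. (C / real n)\<^sup>2)"
        using elim by (intro sum_mono power_mono) auto
      also have "\<dots> = real (card (?A n)) * (C / real n)\<^sup>2" by simp
      also have "\<dots> \<le> real n * (C / real n)\<^sup>2"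
        using time_index_mono[OF b, of n] by (intro mult_right_mono) auto
      also have "\<dots> = C\<^sup>2 / real n" using elim by (simp add: power2_eq_square field_simps)
      finally show ?case .
    qed
    show "(\<lambda>n. C\<^sup>2 / real n) \<longlonglongrightarrow> 0" by real_asymp
  qed
  ultimately have "(\<lambda>n. exp (- (\<Sum>l\<in>?A n. ?a n l)) + ((\<Prod>l\<in>?A n. 1 - ?a n l) - exp (- (\<Sum>l\<in>?A n. ?a n l))))
      \<longlonglongrightarrow> exp (- cum (haz s i) (s i) b) + 0"
    by (rule tendsto_add)
  then show ?thesis by simp
qed

text \<open>Induction on the list of children still to come, with the history s growing. The sum
  over the next arrival is a Riemann sum whose summand contains the remaining nested sum; its limit
  at fixed b is the induction hypothesis for the extended history. All factors except the rate are
  at most 1, so the rate bound C/n also dominates the summand.\<close>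

lemma forest_prob_limit:
  assumes "\<And>t b. t \<in> set ts \<Longrightarrow> b < 0 \<Longrightarrow> (\<lambda>n. match_prob n t (time_index n b)) \<longlonglongrightarrow> limit_prob t b"
    and "\<And>j. j \<le> i \<Longrightarrow> s 0 \<le> s j \<and> s j \<le> s i" and "s i < 0"
  shows "(\<lambda>n. forest_prob n (map (match_prob n) ts) (Suc (time_index n (s i))) (pasts n s i)) \<longlonglongrightarrow> limit_forest_prob (map limit_prob ts) s i"
  using assms
proof (induction ts arbitrary: s i)
  case Nil
  then show ?case using survival_limit[of i s 0] by simp
next
  case (Cons t ts)
  note s = Cons.prems(2)
  let ?a = "\<lambda>n l. attach_rate l (pasts n s i)"
  let ?T = "\<lambda>n k. forest_prob n (map (match_prob n) ts) (Suc k) (pasts n s i @ [k])"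
  define F where "F n k = (\<Prod>l=Suc (time_index n (s i))..<k. 1 - ?a n l) * ?a n k * (match_prob n t k * ?T n k)" for n k
  define f where "f b = (if s i < b then haz s i b * exp (- cum (haz s i) (s i) b) *
      (limit_prob t b * limit_forest_prob (map limit_prob ts) (s(Suc i := b)) (Suc i)) else 0)" for b
  obtain C where C: "0 \<le> C" "\<forall>\<^sub>F n in sequentially. \<forall>m. 0 \<le> ?a n m \<and> ?a n m \<le> 1 \<and> ?a n m \<le> C / real n"
    using attach_rate_eventually_bounds[of i s] s by blast
  have lim: "AE t in lborel. s i < t \<and> t \<le> 0 \<longrightarrow> (\<lambda>n. real (time_index n t) * ?a n (time_index n t)) \<longlonglongrightarrow> haz s i t"
    by (rule attach_rate_limit) (use s in blast)
  have upd: "(\<lambda>b. s(Suc i := b)) \<in> measurable borel seqs"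
    by (rule measurable_fun_upd[where J=UNIV]) auto
  have [measurable]: "(\<lambda>b. limit_forest_prob (map limit_prob ts) (s(Suc i := b)) (Suc i)) \<in> borel_measurable borel"
    by (rule limit_forest_prob_measurable[OF _ upd]) auto
  have "(\<lambda>n. \<Sum>k=Suc (time_index n (s i))..<time_index n 0. F n k) \<longlonglongrightarrow> (\<integral>b. (if b < 0 then f b else 0) \<partial>lborel)"
  proof (rule riemann_sum_limit[OF order_refl C(1)])
    show "f \<in> borel_measurable borel" unfolding f_def by measurable
    show "\<forall>\<^sub>F n in sequentially. 1 \<le> Suc (time_index n (s i)) \<and>
        (\<forall>m. Suc (time_index n (s i)) \<le> m \<and> m < time_index n 0 \<longrightarrow> \<bar>F n m\<bar> \<le> C / real n)"
      using C(2) eventually_compose_filterlim[OF eventually_ge_at_top[of 1] time_index_at_top[of "s 0"]]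
    proof (eventually_elim, intro conjI allI impI)
      fix n m
      assume elim: "\<forall>m. 0 \<le> ?a n m \<and> ?a n m \<le> 1 \<and> ?a n m \<le> C / real n" "1 \<le> time_index n (s 0)"
        "Suc (time_index n (s i)) \<le> m \<and> m < time_index n 0"
      have pr: "0 \<le> (\<Prod>l=Suc (time_index n (s i))..<m. 1 - ?a n l)" "(\<Prod>l=Suc (time_index n (s i))..<m. 1 - ?a n l) \<le> 1"
        using elim(1) by (auto intro!: prod_nonneg prod_le_1 simp del: upt_Suc)
      have m: "time_index n (s 0) \<le> m" using elim(3) s[of i] time_index_mono[of "s 0" "s i" n] by linarith
      have "0 \<le> match_prob n t m \<and> match_prob n t m \<le> 1" using match_prob_bounds[of m] m elim(2) by simp
      moreover have "0 \<le> ?T n m \<and> ?T n m \<le> 1"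
        by (rule forest_prob_bounds[where v="time_index n (s 0)"])
          (use m elim(2) s match_prob_bounds in \<open>auto simp del: upt_Suc intro!: time_index_mono\<close>)
      ultimately have QT: "0 \<le> match_prob n t m * ?T n m" "match_prob n t m * ?T n m \<le> 1"
        by (auto intro!: mult_nonneg_nonneg mult_le_one)
      have a: "0 \<le> ?a n m" "?a n m \<le> C / real n" using elim(1) by auto
      have "\<bar>F n m\<bar> = (\<Prod>l=Suc (time_index n (s i))..<m. 1 - ?a n l) * ?a n m * (match_prob n t m * ?T n m)"
        unfolding F_def by (rule abs_of_nonneg[OF mult_nonneg_nonneg[OF mult_nonneg_nonneg[OF pr(1) a(1)] QT(1)]])
      also have "\<dots> \<le> (\<Prod>l=Suc (time_index n (s i))..<m. 1 - ?a n l) * ?a n m"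
        by (rule mult_left_le[OF QT(2) mult_nonneg_nonneg[OF pr(1) a(1)]])
      also have "\<dots> \<le> ?a n m"
        by (rule mult_left_le_one_le[OF a(1) pr])
      finally show "\<bar>F n m\<bar> \<le> C / real n" using a(2) by (rule order_trans)
    qed simp
    show "AE b in lborel. b < 0 \<longrightarrow>
        (\<lambda>n. if Suc (time_index n (s i)) \<le> time_index n b then real (time_index n b) * F n (time_index n b) else 0) \<longlonglongrightarrow> f b"
      using lim AE_lborel_singleton[of "s i"]
    proof (eventually_elim, intro impI)
      fix b assume elim: "s i < b \<and> b \<le> 0 \<longrightarrow> (\<lambda>n. real (time_index n b) * ?a n (time_index n b)) \<longlonglongrightarrow> haz s i b" "b \<noteq> s i" "b < 0"
      then consider "s i < b" | "b < s i" by linarith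
      then show "(\<lambda>n. if Suc (time_index n (s i)) \<le> time_index n b then real (time_index n b) * F n (time_index n b) else 0) \<longlonglongrightarrow> f b"
      proof cases
        case 1
        define s' where "s' = s(Suc i := b)"
        have past: "pasts n s i @ [time_index n b] = pasts n s' (Suc i)" for n
          by (simp add: s'_def)
        have "(\<lambda>n. forest_prob n (map (match_prob n) ts) (Suc (time_index n (s' (Suc i)))) (pasts n s' (Suc i))) \<longlonglongrightarrow> limit_forest_prob (map limit_prob ts) s' (Suc i)"
        proof (rule Cons.IH)
          show "s' 0 \<le> s' j \<and> s' j \<le> s' (Suc i)" if "j \<le> Suc i" for j
          proof (cases "j = Suc i")
            case True
            then show ?thesis using s[of 0] 1 by (simp add: s'_def)
          next
            case False
            then show ?thesis using s[of j] that 1 by (simp add: s'_def)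
          qed
          show "s' (Suc i) < 0" using elim by (simp add: s'_def)
        qed (use Cons.prems in auto)
        then have T: "(\<lambda>n. ?T n (time_index n b)) \<longlonglongrightarrow> limit_forest_prob (map limit_prob ts) s' (Suc i)"
          unfolding past by (simp add: s'_def del: upt_Suc)
        have a: "(\<lambda>n. real (time_index n b) * ?a n (time_index n b)) \<longlonglongrightarrow> haz s i b" using elim 1 s by auto
        have "(\<lambda>n. (\<Prod>l=Suc (time_index n (s i))..<time_index n b. 1 - ?a n l) * (real (time_index n b) * ?a n (time_index n b)) * (match_prob n t (time_index n b) * ?T n (time_index n b)))
          \<longlonglongrightarrow> exp (- cum (haz s i) (s i) b) * haz s i b * (limit_prob t b * limit_forest_prob (map limit_prob ts) s' (Suc i))"
          using elim by (intro tendsto_mult T a survival_limit s Cons.prems(1)) auto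
        then have "(\<lambda>n. real (time_index n b) * F n (time_index n b)) \<longlonglongrightarrow> f b"
          using 1 by (simp add: F_def f_def s'_def mult_ac del: upt_Suc)
        from time_index_gate_limit[OF this 1] show ?thesis using 1 by (simp del: upt_Suc)
      next
        case 2
        then have "\<not> Suc (time_index n (s i)) \<le> time_index n b" for n using time_index_mono[of b "s i" n] by simp
        then show ?thesis using 2 by (simp add: f_def)
      qed
    qed
  qed
  moreover have "(\<Sum>k=Suc (time_index n (s i))..<time_index n 0. F n k) = forest_prob n (map (match_prob n) (t # ts)) (Suc (time_index n (s i))) (pasts n s i)" for n
    by (simp add: F_def del: upt_Suc)
  moreover have "(\<integral>b. (if b < 0 then f b else 0) \<partial>lborel) = limit_forest_prob (map limit_prob (t # ts)) s i"
    by (auto simp: f_def intro!: Bochner_Integration.integral_cong)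
  ultimately show ?case by (simp del: upt_Suc)
qed

lemma match_prob_limit: "b < 0 \<Longrightarrow> (\<lambda>n. match_prob n S (time_index n b)) \<longlonglongrightarrow> limit_prob S b"
proof (induction S arbitrary: b)
  case (Tree ts)
  have "(\<lambda>n. forest_prob n (map (match_prob n) ts) (Suc (time_index n b)) (pasts n (\<lambda>_. b) 0)) \<longlonglongrightarrow> limit_forest_prob (map limit_prob ts) (\<lambda>_. b) 0"
    using forest_prob_limit[of ts 0 "\<lambda>_. b"] Tree by simp
  then show ?case by simp
qed simp

text \<open>The average over v is a Riemann sum in t = log (v/n); its weight v/n tends to exp t, the
  density of the negative of an Exp(1) variable. The root, to which the approximation does not
  apply, contributes at most 1/n.\<close>

theorem fringe_matches_average_limit:
  "(\<lambda>n. \<Sum>v<n. expect n (\<lambda>ps. of_bool (fringe_matches ps S v)) / real n) \<longlonglongrightarrow> (\<integral>t. (if t < 0 then exp t * limit_prob S t else 0) \<partial>lborel)"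
proof -
  let ?E = "\<lambda>n v. expect n (\<lambda>ps. of_bool (fringe_matches ps S v))"
  have E: "\<bar>?E n v\<bar> \<le> 1" if "2 \<le> n" for n v by (rule expect_abs_le[OF that]) simp
  have "(\<lambda>n. \<Sum>v=1..<time_index n 0. ?E n v / real n) \<longlonglongrightarrow> (\<integral>t. (if t < 0 then exp t * limit_prob S t else 0) \<partial>lborel)"
  proof (rule riemann_sum_limit[OF order_refl zero_le_one])
    show "\<forall>\<^sub>F n in sequentially. 1 \<le> (1::nat) \<and> (\<forall>m. 1 \<le> m \<and> m < time_index n 0 \<longrightarrow> \<bar>?E n m / real n\<bar> \<le> 1 / real n)"
      using eventually_ge_at_top[of 2] by eventually_elim (auto simp: E divide_right_mono)
    show "AE t in lborel. t < 0 \<longrightarrow> (\<lambda>n. if 1 \<le> time_index n t then real (time_index n t) * (?E n (time_index n t) / real n) else 0) \<longlonglongrightarrow> exp t * limit_prob S t"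
    proof (intro AE_I2 impI)
      fix t :: real assume t: "t < 0"
      \<comment> \<open>The error n/v^2 is useless for small v, but it is needed only at fixed t,
        where v is about n * exp t and the error is O(1/n). Domination rests on the trivial bound 1
        for probabilities.\<close>
      have "(\<lambda>n. ?E n (time_index n t) - match_prob n S (time_index n t)) \<longlonglongrightarrow> 0"
      proof (rule Lim_null_comparison)
        show "\<forall>\<^sub>F n in sequentially. norm (?E n (time_index n t) - match_prob n S (time_index n t)) \<le> (potential_weight S - 1) / 2 * (real n / (real (time_index n t))\<^sup>2)"
          using time_index_less_eventually[OF t] eventually_compose_filterlim[OF eventually_ge_at_top[of 1] time_index_at_top[of t]]
        proof eventually_elim
          case (elim n)
          then show ?case unfolding real_norm_def by (intro fringe_matches_prob_approx) auto
        qed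
        have "(\<lambda>n. (potential_weight S - 1) / 2 * (1 / (real (time_index n t) / real n)\<^sup>2 * (1 / real n))) \<longlonglongrightarrow> (potential_weight S - 1) / 2 * (1 / (exp t)\<^sup>2 * 0)"
          by (intro tendsto_intros time_index_over_n lim_1_over_n) simp
        moreover have "1 / (real (time_index n t) / real n)\<^sup>2 * (1 / real n) = real n / (real (time_index n t))\<^sup>2" for n
          by (cases "n = 0") (simp_all add: power2_eq_square)
        ultimately show "(\<lambda>n. (potential_weight S - 1) / 2 * (real n / (real (time_index n t))\<^sup>2)) \<longlonglongrightarrow> 0"
          by (simp only: mult_zero_right)
      qed
      from tendsto_add[OF this match_prob_limit[OF t, of S]]
      have "(\<lambda>n. ?E n (time_index n t)) \<longlonglongrightarrow> limit_prob S t" by simp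
      from tendsto_mult[OF time_index_over_n[of t] this]
      have "(\<lambda>n. real (time_index n t) * (?E n (time_index n t) / real n)) \<longlonglongrightarrow> exp t * limit_prob S t" by simp
      then show "(\<lambda>n. if 1 \<le> time_index n t then real (time_index n t) * (?E n (time_index n t) / real n) else 0) \<longlonglongrightarrow> exp t * limit_prob S t"
        by (rule Lim_transform_eventually)
          (rule eventually_mono[OF eventually_compose_filterlim[OF eventually_ge_at_top[of 1] time_index_at_top[of t]]], simp)
    qed
  qed measurable
  moreover have "(\<lambda>n. ?E n 0 / real n) \<longlonglongrightarrow> 0"
  proof (rule Lim_null_comparison)
    show "\<forall>\<^sub>F n in sequentially. norm (?E n 0 / real n) \<le> 1 / real n"
      using eventually_ge_at_top[of 2] by eventually_elim (auto simp: E divide_right_mono)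
  qed (rule lim_1_over_n)
  ultimately have "(\<lambda>n. ?E n 0 / real n + (\<Sum>v=1..<time_index n 0. ?E n v / real n)) \<longlonglongrightarrow> 0 + (\<integral>t. (if t < 0 then exp t * limit_prob S t else 0) \<partial>lborel)"
    by (intro tendsto_add)
  moreover have "\<forall>\<^sub>F n in sequentially. ?E n 0 / real n + (\<Sum>v=1..<time_index n 0. ?E n v / real n) = (\<Sum>v<n. ?E n v / real n)"
    using eventually_gt_at_top[of 0]
    by eventually_elim (simp add: sum.atLeast_Suc_lessThan flip: atLeast0LessThan)
  ultimately show ?thesis by (auto intro: Lim_transform_eventually)
qed

end

subsection \<open>Joint law of the past and a gap with given conditional hazard\<close>

lemma cum_param_measurable [measurable (raw)]:
  assumes [measurable]: "(\<lambda>(x, t). g x t) \<in> borel_measurable (N \<Otimes>\<^sub>M borel)"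
    "a \<in> borel_measurable N" "b \<in> borel_measurable N"
  shows "(\<lambda>x. cum (g x) (a x) (b x)) \<in> borel_measurable N"
proof -
  have [measurable]: "(\<lambda>(x, t). g x t) \<in> borel_measurable (N \<Otimes>\<^sub>M lborel)"
    using assms(1) by (simp cong: measurable_cong_sets)
  show ?thesis unfolding cum_def by measurable
qed

lemma (in rate) first_event_nn_integral:
  "(\<integral>\<^sup>+x. indicator {..t} x * ennreal (if 0 < x then g x * exp (- cum g 0 x) else 0) \<partial>lborel) =
    (if 0 \<le> t then ennreal (1 - exp (- cum g 0 t)) else 0)"
proof -
  have "(\<integral>\<^sup>+x. indicator {..t} x * ennreal (if 0 < x then g x * exp (- cum g 0 x) else 0) \<partial>lborel)
    = (\<integral>\<^sup>+x. ennreal (if 0 < x \<and> x < t then g x * exp (- cum g 0 x) else 0) \<partial>lborel)"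
    by (rule nn_integral_cong_AE) (use AE_lborel_singleton[of t] in eventually_elim, auto simp: indicator_def)
  also have "\<dots> = ennreal (\<integral>x. (if 0 < x \<and> x < t then g x * exp (- cum g 0 x) else 0) \<partial>lborel)"
    by (rule nn_integral_eq_integral[OF first_event_integrable]) (simp add: g_nonneg)
  finally have eq: "(\<integral>\<^sup>+x. indicator {..t} x * ennreal (if 0 < x then g x * exp (- cum g 0 x) else 0) \<partial>lborel)
    = ennreal (\<integral>x. (if 0 < x \<and> x < t then g x * exp (- cum g 0 x) else 0) \<partial>lborel)" .
  show ?thesis
  proof (cases "0 \<le> t")
    case True
    then show ?thesis unfolding eq first_event_integral[OF True] by simp
  next
    case False
    then have "(\<lambda>x. if 0 < x \<and> x < t then g x * exp (- cum g 0 x) else 0) = (\<lambda>_. 0)" by auto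
    then show ?thesis unfolding eq using False by simp
  qed
qed

text \<open>Products of sets of F with half-lines are closed under intersection and generate the
  product algebra. Half-lines are the right sets here because the gap is known through its tail
  probabilities.\<close>

lemma measure_pair_eqI_atMost:
  fixes N1 N2 :: "('a \<times> real) measure"
  assumes sets: "sets N1 = sets (F \<Otimes>\<^sub>M borel)" "sets N2 = sets (F \<Otimes>\<^sub>M borel)"
    and fin: "emeasure N1 (space N1) \<noteq> \<infinity>"
    and eq: "\<And>A t. A \<in> sets F \<Longrightarrow> emeasure N1 (A \<times> {..t}) = emeasure N2 (A \<times> {..t})"
  shows "N1 = N2"
proof (rule measure_eqI_generator_eq)
  let ?E = "{a \<times> b | a b. a \<in> sets F \<and> b \<in> range (\<lambda>t :: real. {..t})}"
  let ?\<Omega> = "space F \<times> (UNIV :: real set)"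
  have cover: "(\<Union>n. {..real n}) = (UNIV :: real set)" using real_arch_simple by auto
  have gen: "sets (F \<Otimes>\<^sub>M (borel :: real measure)) = sigma_sets ?\<Omega> ?E"
  proof -
    have "sets (F \<Otimes>\<^sub>M (borel :: real measure)) = sets (sigma (space F \<times> space (borel :: real measure)) ?E)"
    proof (rule sets_pair_eq)
      show "sets (borel :: real measure) = sigma_sets (space borel) (range (\<lambda>t :: real. {..t}))"
        by (subst borel_eq_atMost) simp
      show "countable {space F}" "{space F} \<subseteq> sets F" "\<Union>{space F} = space F" by auto
      show "countable (range (\<lambda>n :: nat. {..real n}))" "range (\<lambda>n :: nat. {..real n}) \<subseteq> range (\<lambda>t :: real. {..t})" by auto
      show "\<Union>(range (\<lambda>n :: nat. {..real n})) = space borel" using cover by simp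
      show "sets F \<subseteq> Pow (space F)" by (rule sets.space_closed)
      show "sets F = sigma_sets (space F) (sets F)" by (simp add: sets.sigma_sets_eq)
    qed auto
    also have "\<dots> = sigma_sets ?\<Omega> ?E"
      using sets.sets_into_space[of _ F] by (subst sets_measure_of) auto
    finally show ?thesis .
  qed
  show "sets N1 = sigma_sets ?\<Omega> ?E" "sets N2 = sigma_sets ?\<Omega> ?E" using sets gen by auto
  show "?E \<subseteq> Pow ?\<Omega>" using sets.sets_into_space[of _ F] by auto
  show "Int_stable ?E"
  proof (rule Int_stableI)
    fix x y assume "x \<in> ?E" "y \<in> ?E"
    then obtain a b s t where "x = a \<times> {..s}" "y = b \<times> {..t}" "a \<in> sets F" "b \<in> sets F" by auto
    moreover have "{..s} \<inter> {..t} = {..min s t}" by auto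
    ultimately show "x \<inter> y \<in> ?E" by (auto simp: Times_Int_Times)
  qed
  show "range (\<lambda>n. space F \<times> {..real n}) \<subseteq> ?E" by auto
  show "(\<Union>n. space F \<times> {..real n}) = ?\<Omega>" using cover by blast
  show "emeasure N1 (space F \<times> {..real n}) \<noteq> \<infinity>" for n
  proof -
    have "emeasure N1 (space F \<times> {..real n}) \<le> emeasure N1 (space N1)" by (rule emeasure_space)
    then show ?thesis using fin by (auto simp: top_unique)
  qed
  show "emeasure N1 X = emeasure N2 X" if "X \<in> ?E" for X using that eq by auto
qed

text \<open>A gap X with hazard rate g given the past F; the event B says that the gap exists at all,
  i.e. that the previous birth time is finite.\<close>

locale conditional_hazard = M: prob_space M for M :: "'a measure" +
  fixes F :: "'a measure" and X :: "'a \<Rightarrow> ereal" and B :: "'a set" and g :: "'a \<Rightarrow> real \<Rightarrow> real"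
  assumes subalg: "subalgebra M F" and X_meas [measurable]: "X \<in> borel_measurable M"
    and B_sets: "B \<in> sets F"
    and g_meas: "(\<lambda>(\<omega>, x). g \<omega> x) \<in> borel_measurable (F \<Otimes>\<^sub>M borel)"
    and g_rate: "\<And>\<omega>. rate (g \<omega>)"
    and law: "\<And>s. 0 \<le> s \<Longrightarrow> AE \<omega> in M. \<omega> \<in> B \<longrightarrow>
      real_cond_exp M F (indicator {\<omega>' \<in> space M. X \<omega>' > ereal s}) \<omega> = exp (- cum (g \<omega>) 0 s)"
begin

sublocale finite_measure_subalgebra M F
  by unfold_locales (rule subalg)

lemma F_to_M: "f \<in> measurable F N \<Longrightarrow> f \<in> measurable M N"
  by (rule measurable_from_subalg[OF subalg])

lemma F_sets: "A \<in> sets F \<Longrightarrow> A \<in> sets M"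
  using subalg by (auto simp: subalgebra_def)

lemma cum_F: "(\<lambda>\<omega>. cum (g \<omega>) 0 s) \<in> borel_measurable F"
  using g_meas by (rule cum_param_measurable) auto

text \<open>As B belongs to F, the conditional expectation can be replaced under the integral
  exactly where \<open>law\<close> describes it.\<close>

lemma tail_prob:
  assumes A: "A \<in> sets F" and s: "0 \<le> s"
  shows "measure M {\<omega> \<in> A \<inter> B. X \<omega> > ereal s} = (\<integral>\<omega>. indicator (A \<inter> B) \<omega> * exp (- cum (g \<omega>) 0 s) \<partial>M)"
    and "integrable M (\<lambda>\<omega>. indicator (A \<inter> B) \<omega> * exp (- cum (g \<omega>) 0 s) :: real)"
proof -
  have AB: "A \<inter> B \<in> sets F" "A \<inter> B \<in> sets M" using A B_sets F_sets by auto
  note [measurable] = AB F_to_M[OF cum_F]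
  let ?I = "indicator {\<omega>' \<in> space M. X \<omega>' > ereal s} :: 'a \<Rightarrow> real"
  have sub: "\<omega> \<in> A \<inter> B \<Longrightarrow> \<omega> \<in> space M" for \<omega> using sets.sets_into_space[OF AB(2)] by auto
  show "integrable M (\<lambda>\<omega>. indicator (A \<inter> B) \<omega> * exp (- cum (g \<omega>) 0 s) :: real)"
  proof (rule M.integrable_const_bound[where B=1])
    show "AE \<omega> in M. norm (indicator (A \<inter> B) \<omega> * exp (- cum (g \<omega>) 0 s) :: real) \<le> 1"
      by (auto simp: indicator_def rate.cum_nonneg[OF g_rate])
  qed measurable
  have "measure M {\<omega> \<in> A \<inter> B. X \<omega> > ereal s} = measure M ((A \<inter> B) \<inter> {\<omega> \<in> space M. X \<omega> > ereal s})"
    by (rule arg_cong[where f="measure M"]) (use sub in auto)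
  also have "\<dots> = (\<integral>\<omega>. indicator ((A \<inter> B) \<inter> {\<omega> \<in> space M. X \<omega> > ereal s}) \<omega> \<partial>M)"
    by (simp add: Int_absorb2 sets.sets_into_space)
  also have "\<dots> = (\<integral>\<omega>. indicator (A \<inter> B) \<omega> * ?I \<omega> \<partial>M)"
    by (simp only: indicator_inter_arith)
  also have "\<dots> = (\<integral>\<omega>. indicator (A \<inter> B) \<omega> * real_cond_exp M F ?I \<omega> \<partial>M)"
  proof (rule real_cond_exp_intg(2)[symmetric])
    show "integrable M (\<lambda>\<omega>. indicator (A \<inter> B) \<omega> * ?I \<omega>)"
    proof (rule M.integrable_const_bound[where B=1])
      show "AE \<omega> in M. norm (indicator (A \<inter> B) \<omega> * ?I \<omega>) \<le> 1" by (auto simp: indicator_def)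
    qed measurable
    show "indicator (A \<inter> B) \<in> borel_measurable F" using AB by simp
  qed measurable
  also have "\<dots> = (\<integral>\<omega>. indicator (A \<inter> B) \<omega> * exp (- cum (g \<omega>) 0 s) \<partial>M)"
  proof (rule integral_cong_AE)
    show "AE \<omega> in M. indicator (A \<inter> B) \<omega> * real_cond_exp M F ?I \<omega> = indicator (A \<inter> B) \<omega> * exp (- cum (g \<omega>) 0 s)"
      using law[OF s] by eventually_elim (auto simp: indicator_def)
  qed measurable
  finally show "measure M {\<omega> \<in> A \<inter> B. X \<omega> > ereal s} = (\<integral>\<omega>. indicator (A \<inter> B) \<omega> * exp (- cum (g \<omega>) 0 s) \<partial>M)" .
qed

lemma atMost_prob:
  assumes A: "A \<in> sets F" and s: "0 \<le> s"
  shows "emeasure M {\<omega> \<in> A \<inter> B. X \<omega> \<le> ereal s} = (\<integral>\<^sup>+\<omega>. indicator (A \<inter> B) \<omega> * ennreal (1 - exp (- cum (g \<omega>) 0 s)) \<partial>M)"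
proof -
  have AB: "A \<inter> B \<in> sets F" "A \<inter> B \<in> sets M" using A B_sets F_sets by auto
  note [measurable] = AB F_to_M[OF cum_F]
  have sub: "\<omega> \<in> A \<inter> B \<Longrightarrow> \<omega> \<in> space M" for \<omega> using sets.sets_into_space[OF AB(2)] by auto
  let ?e = "\<lambda>\<omega>. indicator (A \<inter> B) \<omega> * exp (- cum (g \<omega>) 0 s) :: real"
  have "{\<omega> \<in> A \<inter> B. X \<omega> > ereal s} = (A \<inter> B) \<inter> {\<omega> \<in> space M. X \<omega> > ereal s}" using sub by auto
  then have m: "{\<omega> \<in> A \<inter> B. X \<omega> > ereal s} \<in> sets M" by simp
  have "{\<omega> \<in> A \<inter> B. X \<omega> \<le> ereal s} = (A \<inter> B) - {\<omega> \<in> A \<inter> B. X \<omega> > ereal s}" by auto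
  then have "measure M {\<omega> \<in> A \<inter> B. X \<omega> \<le> ereal s} = measure M (A \<inter> B) - measure M {\<omega> \<in> A \<inter> B. X \<omega> > ereal s}"
    using m by (simp add: M.finite_measure_Diff Int_absorb1 subset_iff)
  also have "\<dots> = (\<integral>\<omega>. indicator (A \<inter> B) \<omega> \<partial>M) - (\<integral>\<omega>. ?e \<omega> \<partial>M)"
    unfolding tail_prob(1)[OF A s] by (simp add: Int_absorb2 sets.sets_into_space[OF AB(2)])
  also have "\<dots> = (\<integral>\<omega>. indicator (A \<inter> B) \<omega> - ?e \<omega> \<partial>M)"
    by (intro Bochner_Integration.integral_diff[symmetric] tail_prob(2)[OF A s]) (simp add: M.emeasure_eq_measure)
  finally have "emeasure M {\<omega> \<in> A \<inter> B. X \<omega> \<le> ereal s} = ennreal (\<integral>\<omega>. indicator (A \<inter> B) \<omega> - ?e \<omega> \<partial>M)"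
    by (simp add: M.emeasure_eq_measure)
  also have "\<dots> = (\<integral>\<^sup>+\<omega>. ennreal (indicator (A \<inter> B) \<omega> - ?e \<omega>) \<partial>M)"
  proof (rule nn_integral_eq_integral[symmetric])
    show "integrable M (\<lambda>\<omega>. indicator (A \<inter> B) \<omega> - ?e \<omega>)"
      by (intro Bochner_Integration.integrable_diff tail_prob(2)[OF A s]) (simp add: M.emeasure_eq_measure)
    show "AE \<omega> in M. 0 \<le> indicator (A \<inter> B) \<omega> - ?e \<omega>"
      by (auto simp: indicator_def rate.cum_nonneg[OF g_rate])
  qed
  also have "\<dots> = (\<integral>\<^sup>+\<omega>. indicator (A \<inter> B) \<omega> * ennreal (1 - exp (- cum (g \<omega>) 0 s)) \<partial>M)"
    by (intro nn_integral_cong) (auto simp: indicator_def)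
  finally show ?thesis .
qed

text \<open>At s = 0 the cumulative hazard vanishes, so given F the gap exceeds 0 with probability 1
  on B.\<close>

lemma X_pos: "AE \<omega> in M. \<omega> \<in> B \<longrightarrow> 0 < X \<omega>"
proof -
  have "emeasure M {\<omega> \<in> B. X \<omega> \<le> 0} = 0"
  proof -
    have sp: "space F \<inter> B = B" using sets.sets_into_space[OF B_sets] by auto
    have "emeasure M {\<omega> \<in> space F \<inter> B. X \<omega> \<le> ereal 0} = 0"
      unfolding atMost_prob[OF sets.top order_refl] by (simp add: rate.cum_start[OF g_rate])
    then show ?thesis unfolding sp by (simp add: zero_ereal_def)
  qed
  moreover have "{\<omega> \<in> B. X \<omega> \<le> 0} \<in> sets M"
  proof -
    have [measurable]: "B \<in> sets M" using B_sets F_sets by simp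
    have "{\<omega> \<in> B. X \<omega> \<le> 0} = B \<inter> {\<omega> \<in> space M. X \<omega> \<le> 0}" using sets.sets_into_space[OF F_sets[OF B_sets]] by auto
    then show ?thesis by simp
  qed
  ultimately have "{\<omega> \<in> B. X \<omega> \<le> 0} \<in> null_sets M" by auto
  from AE_not_in[OF this] show ?thesis by eventually_elim auto
qed

text \<open>The null set in \<open>law\<close> depends on s, so no conditional distribution is
  available for a fixed outcome. Comparing two measures on pairs (outcome, gap) avoids this: on each
  rectangle a single value of s enters, and only after integration.\<close>

lemma joint_law:
  assumes \<Psi>: "\<Psi> \<in> borel_measurable (F \<Otimes>\<^sub>M borel)"
  shows "(\<integral>\<^sup>+\<omega>. indicator B \<omega> * (if X \<omega> < \<infinity> then \<Psi> (\<omega>, real_of_ereal (X \<omega>)) else 0) \<partial>M) =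
    (\<integral>\<^sup>+\<omega>. indicator B \<omega> * (\<integral>\<^sup>+x. \<Psi> (\<omega>, x) * ennreal (if 0 < x then g \<omega> x * exp (- cum (g \<omega>) 0 x) else 0) \<partial>lborel) \<partial>M)"
proof -
  let ?d = "\<lambda>\<omega> x. ennreal (if 0 < x then g \<omega> x * exp (- cum (g \<omega>) 0 x) else 0)"
  let ?Fr = "restr_to_subalg M F"
  have BM [measurable]: "B \<in> sets M" using B_sets F_sets by simp
  have B_sub: "\<omega> \<in> B \<Longrightarrow> \<omega> \<in> space M" for \<omega> using sets.sets_into_space[OF BM] by auto
  have id_meas: "(\<lambda>\<omega>. \<omega>) \<in> measurable M F" by (rule F_to_M) simp
  have pair_meas: "(\<lambda>\<omega>. (\<omega>, real_of_ereal (X \<omega>))) \<in> measurable M (F \<Otimes>\<^sub>M borel)"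
    using id_meas by (rule measurable_Pair) measurable
  note [measurable] = pair_meas
  have sets_Fr: "sets (?Fr \<Otimes>\<^sub>M lborel) = sets (F \<Otimes>\<^sub>M borel)"
    by (rule sets_pair_measure_cong[OF sets_restr_to_subalg[OF subalg] sets_lborel])
  have Fr_cong: "borel_measurable (?Fr \<Otimes>\<^sub>M lborel) = borel_measurable (F \<Otimes>\<^sub>M borel)"
    by (rule measurable_cong_sets[OF sets_Fr refl])
  have Fl_cong: "borel_measurable (F \<Otimes>\<^sub>M lborel) = borel_measurable (F \<Otimes>\<^sub>M borel)"
    by (rule measurable_cong_sets[OF sets_pair_measure_cong[OF refl sets_lborel] refl])
  have d_meas: "(\<lambda>(\<omega>, x). indicator B \<omega> * ?d \<omega> x) \<in> borel_measurable (F \<Otimes>\<^sub>M borel)"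
  proof -
    note [measurable] = g_meas B_sets
    have g': "(\<lambda>(y, t). g (fst y) t) \<in> borel_measurable ((F \<Otimes>\<^sub>M borel) \<Otimes>\<^sub>M borel)"
      by measurable
    have [measurable]: "(\<lambda>y. cum (g (fst y)) 0 (snd y)) \<in> borel_measurable (F \<Otimes>\<^sub>M borel)"
      by (rule cum_param_measurable[OF g']) auto
    have [measurable]: "(\<lambda>y. g (fst y) (snd y)) \<in> borel_measurable (F \<Otimes>\<^sub>M borel)"
      using g_meas by (simp add: case_prod_unfold)
    show ?thesis unfolding case_prod_unfold by measurable
  qed
  \<comment> \<open>In the pair the outcome is seen through the past algebra F alone, so N1 records
    no more than the joint law of past and gap. Correspondingly N2 has its density with respect to M
    restricted to F.\<close>
  define N1 where "N1 = distr (density M (\<lambda>\<omega>. indicator {\<omega> \<in> B. X \<omega> < \<infinity>} \<omega>)) (F \<Otimes>\<^sub>M borel) (\<lambda>\<omega>. (\<omega>, real_of_ereal (X \<omega>)))"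
  define N2 where "N2 = density (?Fr \<Otimes>\<^sub>M lborel) (\<lambda>(\<omega>, x). indicator B \<omega> * ?d \<omega> x)"
  have C [measurable]: "{\<omega> \<in> B. X \<omega> < \<infinity>} \<in> sets M"
  proof -
    have "{\<omega> \<in> B. X \<omega> < \<infinity>} = B \<inter> {\<omega> \<in> space M. X \<omega> < \<infinity>}" using B_sub by auto
    then show ?thesis by simp
  qed
  have "N1 = N2"
  proof (rule measure_pair_eqI_atMost)
    show "sets N1 = sets (F \<Otimes>\<^sub>M borel)" by (simp add: N1_def)
    show "sets N2 = sets (F \<Otimes>\<^sub>M borel)" unfolding N2_def sets_density by (rule sets_Fr)
    show "emeasure N1 (space N1) \<noteq> \<infinity>"
    proof -
      have "emeasure N1 (space N1) = emeasure (density M (\<lambda>\<omega>. indicator {\<omega> \<in> B. X \<omega> < \<infinity>} \<omega>))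
          ((\<lambda>\<omega>. (\<omega>, real_of_ereal (X \<omega>))) -` space (F \<Otimes>\<^sub>M borel) \<inter> space M)"
        unfolding N1_def by (subst emeasure_distr) auto
      also have "\<dots> \<le> emeasure (density M (\<lambda>\<omega>. indicator {\<omega> \<in> B. X \<omega> < \<infinity>} \<omega>)) (space M)"
        by (rule emeasure_mono) auto
      also have "\<dots> = (\<integral>\<^sup>+\<omega>. indicator {\<omega> \<in> B. X \<omega> < \<infinity>} \<omega> * indicator (space M) \<omega> \<partial>M)"
        by (rule emeasure_density) auto
      also have "\<dots> \<le> (\<integral>\<^sup>+\<omega>. 1 \<partial>M)"
        by (intro nn_integral_mono) (auto simp: indicator_def)
      also have "\<dots> = 1" by (simp add: M.emeasure_space_1)
      finally show ?thesis by (auto simp: top_unique)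
    qed
    fix A and t :: real assume A: "A \<in> sets F"
    have AM [measurable]: "A \<in> sets M" using F_sets[OF A] .
    have At [measurable]: "A \<times> {..t} \<in> sets (F \<Otimes>\<^sub>M borel)" by (rule pair_measureI[OF A]) simp
    let ?S = "{\<omega> \<in> A \<inter> B. X \<omega> < \<infinity> \<and> real_of_ereal (X \<omega>) \<le> t}"
    have S: "?S \<in> sets M"
    proof -
      have "?S = (A \<inter> B) \<inter> {\<omega> \<in> space M. X \<omega> < \<infinity> \<and> real_of_ereal (X \<omega>) \<le> t}" using B_sub by auto
      then show ?thesis by simp
    qed
    have "emeasure N1 (A \<times> {..t}) = (\<integral>\<^sup>+\<omega>. indicator {\<omega> \<in> B. X \<omega> < \<infinity>} \<omega> *
        indicator ((\<lambda>\<omega>. (\<omega>, real_of_ereal (X \<omega>))) -` (A \<times> {..t}) \<inter> space M) \<omega> \<partial>M)"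
      unfolding N1_def by (subst emeasure_distr) (auto simp: emeasure_density)
    also have "\<dots> = (\<integral>\<^sup>+\<omega>. indicator ?S \<omega> \<partial>M)"
      by (intro nn_integral_cong) (auto simp: indicator_def)
    also have "\<dots> = emeasure M ?S" using S by simp
    also have "\<dots> = (\<integral>\<^sup>+\<omega>. indicator (A \<inter> B) \<omega> * (if 0 \<le> t then ennreal (1 - exp (- cum (g \<omega>) 0 t)) else 0) \<partial>M)"
    proof (cases "0 \<le> t")
      case True
      \<comment> \<open>The function \<open>real_of_ereal\<close> sends the value minus infinity to
        0, which agrees with the right-hand side because t \<ge> 0. For t < 0 the event is null
        since X is almost surely positive.\<close>
      have "X \<omega> < \<infinity> \<and> real_of_ereal (X \<omega>) \<le> t \<longleftrightarrow> X \<omega> \<le> ereal t" for \<omega>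
        using True by (cases "X \<omega>") auto
      then show ?thesis using atMost_prob[OF A True] True by simp
    next
      case False
      have "AE \<omega> in M. \<omega> \<notin> ?S"
        using X_pos
      proof eventually_elim
        case (elim \<omega>)
        then show ?case using False by (cases "X \<omega>") auto
      qed
      then have "emeasure M ?S = 0" using S by (subst AE_iff_measurable[symmetric, OF S]) (use B_sub in auto)
      then show ?thesis using False by simp
    qed
    also have "\<dots> = (\<integral>\<^sup>+\<omega>. indicator (A \<inter> B) \<omega> * (\<integral>\<^sup>+x. indicator {..t} x * ?d \<omega> x \<partial>lborel) \<partial>M)"
      unfolding rate.first_event_nn_integral[OF g_rate] ..
    also have "\<dots> = (\<integral>\<^sup>+\<omega>. (\<integral>\<^sup>+x. indicator B \<omega> * ?d \<omega> x * indicator (A \<times> {..t}) (\<omega>, x) \<partial>lborel) \<partial>M)"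
    proof (intro nn_integral_cong)
      fix \<omega>
      interpret rate "g \<omega>" by (rule g_rate)
      have "(\<integral>\<^sup>+x. indicator B \<omega> * ?d \<omega> x * indicator (A \<times> {..t}) (\<omega>, x) \<partial>lborel)
         = (\<integral>\<^sup>+x. indicator (A \<inter> B) \<omega> * (indicator {..t} x * ?d \<omega> x) \<partial>lborel)"
        by (intro nn_integral_cong) (auto simp: indicator_def)
      then show "indicator (A \<inter> B) \<omega> * (\<integral>\<^sup>+x. indicator {..t} x * ?d \<omega> x \<partial>lborel) =
         (\<integral>\<^sup>+x. indicator B \<omega> * ?d \<omega> x * indicator (A \<times> {..t}) (\<omega>, x) \<partial>lborel)"
        by (simp add: nn_integral_cmult)
    qed
    also have "\<dots> = (\<integral>\<^sup>+\<omega>. (\<integral>\<^sup>+x. indicator B \<omega> * ?d \<omega> x * indicator (A \<times> {..t}) (\<omega>, x) \<partial>lborel) \<partial>?Fr)"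
    proof (rule nn_integral_subalgebra2[OF subalg, symmetric])
      have "(\<lambda>y. (case y of (\<omega>, x) \<Rightarrow> indicator B \<omega> * ?d \<omega> x) * indicator (A \<times> {..t}) y) \<in> borel_measurable (F \<Otimes>\<^sub>M borel)"
        using d_meas At by (intro borel_measurable_times_ennreal borel_measurable_indicator) auto
      then have "(\<lambda>y. (case y of (\<omega>, x) \<Rightarrow> indicator B \<omega> * ?d \<omega> x) * indicator (A \<times> {..t}) y) \<in> borel_measurable (F \<Otimes>\<^sub>M lborel)"
        unfolding Fl_cong .
      from lborel.borel_measurable_nn_integral_fst[OF this]
      show "(\<lambda>\<omega>. \<integral>\<^sup>+x. indicator B \<omega> * ?d \<omega> x * indicator (A \<times> {..t}) (\<omega>, x) \<partial>lborel) \<in> borel_measurable F"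
        by simp
    qed
    also have "\<dots> = emeasure N2 (A \<times> {..t})"
    proof -
      have m: "(\<lambda>(\<omega>, x). indicator B \<omega> * ?d \<omega> x) \<in> borel_measurable (?Fr \<Otimes>\<^sub>M lborel)"
        unfolding Fr_cong by (rule d_meas)
      have At': "A \<times> {..t} \<in> sets (?Fr \<Otimes>\<^sub>M lborel)" unfolding sets_Fr by (rule At)
      have "emeasure N2 (A \<times> {..t}) = (\<integral>\<^sup>+y. (case y of (\<omega>, x) \<Rightarrow> indicator B \<omega> * ?d \<omega> x) * indicator (A \<times> {..t}) y \<partial>(?Fr \<Otimes>\<^sub>M lborel))"
        unfolding N2_def by (rule emeasure_density[OF m At'])
      also have "\<dots> = (\<integral>\<^sup>+\<omega>. (\<integral>\<^sup>+x. indicator B \<omega> * ?d \<omega> x * indicator (A \<times> {..t}) (\<omega>, x) \<partial>lborel) \<partial>?Fr)"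
        using m At' by (subst lborel.nn_integral_fst[symmetric]) (auto intro!: borel_measurable_times_ennreal borel_measurable_indicator)
      finally show ?thesis by simp
    qed
    finally show "emeasure N1 (A \<times> {..t}) = emeasure N2 (A \<times> {..t})" .
  qed
  then have "(\<integral>\<^sup>+y. \<Psi> y \<partial>N1) = (\<integral>\<^sup>+y. \<Psi> y \<partial>N2)" by simp
  also have "(\<integral>\<^sup>+y. \<Psi> y \<partial>N1) = (\<integral>\<^sup>+\<omega>. indicator {\<omega> \<in> B. X \<omega> < \<infinity>} \<omega> * \<Psi> (\<omega>, real_of_ereal (X \<omega>)) \<partial>M)"
    unfolding N1_def using \<Psi> measurable_compose[OF pair_meas \<Psi>]
    by (subst nn_integral_distr) (auto simp: nn_integral_density)
  also have "\<dots> = (\<integral>\<^sup>+\<omega>. indicator B \<omega> * (if X \<omega> < \<infinity> then \<Psi> (\<omega>, real_of_ereal (X \<omega>)) else 0) \<partial>M)"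
    by (intro nn_integral_cong) (auto simp: indicator_def)
  also have "(\<integral>\<^sup>+y. \<Psi> y \<partial>N2) = (\<integral>\<^sup>+\<omega>. (\<integral>\<^sup>+x. indicator B \<omega> * ?d \<omega> x * \<Psi> (\<omega>, x) \<partial>lborel) \<partial>?Fr)"
  proof -
    have m: "(\<lambda>(\<omega>, x). indicator B \<omega> * ?d \<omega> x) \<in> borel_measurable (?Fr \<Otimes>\<^sub>M lborel)"
      "\<Psi> \<in> borel_measurable (?Fr \<Otimes>\<^sub>M lborel)"
      unfolding Fr_cong by (rule d_meas, rule \<Psi>)
    show ?thesis unfolding N2_def
      using m by (subst nn_integral_density, simp, simp, subst lborel.nn_integral_fst[symmetric])
         (auto intro!: borel_measurable_times_ennreal)
  qed
  also have "\<dots> = (\<integral>\<^sup>+\<omega>. (\<integral>\<^sup>+x. indicator B \<omega> * ?d \<omega> x * \<Psi> (\<omega>, x) \<partial>lborel) \<partial>M)"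
  proof (rule nn_integral_subalgebra2[OF subalg])
    have "(\<lambda>y. (case y of (\<omega>, x) \<Rightarrow> indicator B \<omega> * ?d \<omega> x) * \<Psi> y) \<in> borel_measurable (F \<Otimes>\<^sub>M borel)"
      using d_meas \<Psi> by (intro borel_measurable_times_ennreal) auto
    then have "(\<lambda>y. (case y of (\<omega>, x) \<Rightarrow> indicator B \<omega> * ?d \<omega> x) * \<Psi> y) \<in> borel_measurable (F \<Otimes>\<^sub>M lborel)"
      unfolding Fl_cong .
    from lborel.borel_measurable_nn_integral_fst[OF this]
    show "(\<lambda>\<omega>. \<integral>\<^sup>+x. indicator B \<omega> * ?d \<omega> x * \<Psi> (\<omega>, x) \<partial>lborel) \<in> borel_measurable F"
      by simp
  qed
  also have "\<dots> = (\<integral>\<^sup>+\<omega>. indicator B \<omega> * (\<integral>\<^sup>+x. \<Psi> (\<omega>, x) * ?d \<omega> x \<partial>lborel) \<partial>M)"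
    by (intro nn_integral_cong) (auto simp: indicator_def mult.commute intro!: nn_integral_cong)
  finally show ?thesis .
qed

end

subsection \<open>Gaps between the births of one individual\<close>

lemma sig_0 [simp]: "sig e u 0 = 0"
  by (simp add: sig_def)

lemma sig_Suc: "sig e u (Suc k) = sig e u k + e u k"
  by (simp add: sig_def)

text \<open>Nothing is asked of gaps after an infinite one: their law is not prescribed. They do no
  harm, since in \<open>ereal\<close> the sum of \<infinity> and anything is \<infinity>.\<close>

definition positive_gaps :: "(nat list \<Rightarrow> nat \<Rightarrow> ereal) \<Rightarrow> bool" where
  "positive_gaps e \<longleftrightarrow> (\<forall>u k. sig e u k < \<infinity> \<longrightarrow> 0 < e u k)"

lemma sig_nonneg: "positive_gaps e \<Longrightarrow> 0 \<le> sig e u k"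
proof (induction k)
  case (Suc k)
  show ?case
  proof (cases "sig e u k = \<infinity>")
    case False
    then have "0 < e u k" using Suc.prems by (simp add: positive_gaps_def)
    then show ?thesis using Suc by (simp add: sig_Suc)
  qed (simp add: sig_Suc)
qed simp

lemma sig_less_Suc:
  assumes "positive_gaps e" "sig e u k < \<infinity>"
  shows "sig e u k < sig e u (Suc k)"
proof -
  have "0 < e u k" using assms by (simp add: positive_gaps_def)
  then show ?thesis using sig_nonneg[OF assms(1), of u k] assms(2)
    unfolding sig_Suc by (cases "sig e u k"; cases "e u k") auto
qed

lemma sig_mono:
  assumes "positive_gaps e" "i \<le> k"
  shows "sig e u i \<le> sig e u k"
  using assms(2)
proof (induction k rule: dec_induct)
  case (step k)
  then show ?case using sig_less_Suc[OF assms(1), of u k]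
    by (cases "sig e u k = \<infinity>") (auto simp: sig_Suc)
qed simp

lemma cum_translate: "cum (\<lambda>x. g (c + x)) a b = cum g (c + a) (c + b)"
proof -
  have "cum g (c + a) (c + b) = \<bar>1\<bar> *\<^sub>R (\<integral>x. (if c + a \<le> c + 1 * x \<and> c + 1 * x \<le> c + b then g (c + 1 * x) else 0) \<partial>lborel)"
    unfolding cum_def by (rule lborel_integral_real_affine) simp
  then show ?thesis by (simp add: cum_def cong: if_cong)
qed

lemma ennreal_add_right_imp_eq: "a + b = c + b \<Longrightarrow> b \<noteq> \<infinity> \<Longrightarrow> a = c" for a b c :: ennreal
  by (metis add.commute ennreal_add_left_cancel)

locale branching = macro_delay \<mu> \<alpha> + M: prob_space M
  for \<mu> \<alpha> and M :: "'a measure" +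
  fixes E :: "nat list \<Rightarrow> nat \<Rightarrow> 'a \<Rightarrow> ereal"
  assumes E_indep: "M.indep_vars (\<lambda>_. PiM UNIV (\<lambda>_. borel)) (\<lambda>u \<omega> i. E u i \<omega>) UNIV"
    and E_law: "\<And>u i s. s \<ge> 0 \<Longrightarrow>
       AE \<omega> in M. sig (\<lambda>v j. E v j \<omega>) u i < \<infinity> \<longrightarrow>
         real_cond_exp M (past_alg M E u i) (indicator {\<omega>' \<in> space M. E u i \<omega>' > ereal s}) \<omega>
         = exp (- (LINT x:{0..s}|lborel. hazard \<mu> \<alpha> (\<lambda>j. real_of_ereal (sig (\<lambda>v j. E v j \<omega>) u j)) i x))"
begin

abbreviation ev :: "'a \<Rightarrow> nat list \<Rightarrow> nat \<Rightarrow> ereal" where "ev \<omega> \<equiv> (\<lambda>v j. E v j \<omega>)"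

definition sig_rv :: "nat list \<Rightarrow> nat \<Rightarrow> 'a \<Rightarrow> ereal" where "sig_rv u k \<omega> = sig (ev \<omega>) u k"

definition sig_real :: "nat list \<Rightarrow> nat \<Rightarrow> 'a \<Rightarrow> real" where "sig_real u k \<omega> = real_of_ereal (sig_rv u k \<omega>)"

lemma sig_rv_0 [simp]: "sig_rv u 0 \<omega> = 0" and sig_real_0 [simp]: "sig_real u 0 \<omega> = 0"
  by (simp_all add: sig_real_def sig_rv_def)

lemma path_measurable [measurable]: "(\<lambda>\<omega> i. E u i \<omega>) \<in> measurable M (PiM UNIV (\<lambda>_. borel))"
  using E_indep by (simp add: M.indep_vars_def)

lemma E_measurable [measurable]: "E u i \<in> borel_measurable M"
  using measurable_compose[OF path_measurable[of u] measurable_component_singleton[of i UNIV "\<lambda>_. borel"]] by simp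

lemma past_alg_sets:
  "sets (past_alg M E u i) = sigma_sets (space M) {E u j -` A \<inter> space M | j A. j < i \<and> A \<in> sets borel}"
  unfolding past_alg_def by (rule sets_measure_of) auto

lemma past_alg_space [simp]: "space (past_alg M E u i) = space M"
  unfolding past_alg_def by (rule space_measure_of) auto

lemma past_alg_subalgebra: "subalgebra M (past_alg M E u i)"
proof -
  have "{E u j -` A \<inter> space M | j A. j < i \<and> A \<in> sets borel} \<subseteq> sets M"
    using measurable_sets[OF E_measurable] by blast
  then show ?thesis
    unfolding subalgebra_def past_alg_sets by (simp add: sets.sigma_sets_subset)
qed

lemma E_past_measurable [measurable]: "j < i \<Longrightarrow> E u j \<in> borel_measurable (past_alg M E u i)"
  by (rule measurableI) (auto simp: past_alg_sets)

lemma sig_rv_past_measurable: "k \<le> i \<Longrightarrow> sig_rv u k \<in> borel_measurable (past_alg M E u i)"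
proof -
  assume "k \<le> i"
  then have "(\<lambda>\<omega>. \<Sum>j<k. E u j \<omega>) \<in> borel_measurable (past_alg M E u i)"
    by (intro borel_measurable_ereal_sum E_past_measurable) auto
  then show ?thesis by (simp add: sig_rv_def[abs_def] sig_def)
qed

lemma sig_real_past_measurable: "k \<le> i \<Longrightarrow> sig_real u k \<in> borel_measurable (past_alg M E u i)"
  unfolding sig_real_def[abs_def] using sig_rv_past_measurable by (rule measurable_compose) measurable

lemma sig_rv_measurable [measurable]: "sig_rv u k \<in> borel_measurable M"
  by (rule measurable_from_subalg[OF past_alg_subalgebra sig_rv_past_measurable[OF order_refl]])

text \<open>The birth times of u and its first j children on a clock that shows 0 when the remaining
  life \<tau> of u is over; u itself is born at - \<tau>. These are the logarithmic times of
  \<open>haz\<close>. Entries beyond j are set to 0, so that the sequence is measurable in the first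
  j gaps.\<close>

definition age :: "nat list \<Rightarrow> nat \<Rightarrow> real \<Rightarrow> 'a \<Rightarrow> nat \<Rightarrow> real" where
  "age u j \<tau> \<omega> = (\<lambda>k. if k \<le> j then sig_real u k \<omega> - \<tau> else 0)"

lemma age_measurable: "f \<in> borel_measurable (past_alg M E u j) \<Longrightarrow> (\<lambda>\<omega>. age u j (f \<omega>) \<omega>) \<in> measurable (past_alg M E u j) seqs"
  unfolding age_def
proof (intro measurable_PiM_single')
  fix k assume [measurable]: "f \<in> borel_measurable (past_alg M E u j)"
  show "(\<lambda>\<omega>. if k \<le> j then sig_real u k \<omega> - f \<omega> else 0) \<in> borel_measurable (past_alg M E u j)"
    by (cases "k \<le> j") (auto intro!: borel_measurable_diff sig_real_past_measurable)
qed auto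

text \<open>Choosing \<tau> = \<sigma>_j puts 0 at the start of the gap, so the argument is the time
  elapsed in the gap; \<open>gap_rate_hazard\<close> identifies the result with
  \<open>hazard\<close>.\<close>

definition gap_rate :: "nat list \<Rightarrow> nat \<Rightarrow> 'a \<Rightarrow> real \<Rightarrow> real" where
  "gap_rate u j \<omega> = haz (age u j (sig_real u j \<omega>) \<omega>) j"

lemma gap_rate_shift: "gap_rate u j \<omega> x = haz (age u j \<tau> \<omega>) j ((sig_real u j \<omega> - \<tau>) + x)"
  unfolding gap_rate_def haz_def age_def by (auto intro!: sum.cong arg_cong[where f=h] simp: algebra_simps)

lemma gap_rate_hazard: "hazard \<mu> \<alpha> (\<lambda>k. sig_real u k \<omega>) j x = gap_rate u j \<omega> x"
  unfolding hazard_def gap_rate_def haz_def age_def by (auto intro!: sum.cong arg_cong[where f=h] simp: algebra_simps)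

lemma cum_gap_rate: "cum (gap_rate u j \<omega>) 0 y = cum (haz (age u j \<tau> \<omega>) j) (sig_real u j \<omega> - \<tau>) ((sig_real u j \<omega> - \<tau>) + y)"
proof -
  have "gap_rate u j \<omega> = (\<lambda>x. haz (age u j \<tau> \<omega>) j ((sig_real u j \<omega> - \<tau>) + x))" by (rule ext) (rule gap_rate_shift)
  then show ?thesis using cum_translate[of "haz (age u j \<tau> \<omega>) j" "sig_real u j \<omega> - \<tau>" 0 y] by simp
qed

sublocale gap: conditional_hazard M "past_alg M E u j" "E u j" "{\<omega> \<in> space M. sig_rv u j \<omega> < \<infinity>}" "gap_rate u j" for u j
proof
  show "subalgebra M (past_alg M E u j)" by (rule past_alg_subalgebra)
  have "sig_rv u j -` {..<\<infinity>} \<inter> space (past_alg M E u j) \<in> sets (past_alg M E u j)"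
    by (rule measurable_sets[OF sig_rv_past_measurable]) auto
  then show "{\<omega> \<in> space M. sig_rv u j \<omega> < \<infinity>} \<in> sets (past_alg M E u j)"
    by (simp add: vimage_def Int_def conj_commute)
  have [measurable]: "(\<lambda>\<omega>. age u j (sig_real u j \<omega>) \<omega>) \<in> measurable (past_alg M E u j) seqs"
    by (rule age_measurable) (rule sig_real_past_measurable, simp)
  show "(\<lambda>(\<omega>, x). gap_rate u j \<omega> x) \<in> borel_measurable (past_alg M E u j \<Otimes>\<^sub>M borel)"
    unfolding gap_rate_def case_prod_unfold by measurable
  show "mono (gap_rate u j \<omega>)" "0 \<le> gap_rate u j \<omega> t" for \<omega> t
    unfolding gap_rate_def by (rule haz.g_mono haz.g_nonneg)+
  fix s :: real assume s: "0 \<le> s"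
  have cum: "(LINT x:{0..s}|lborel. hazard \<mu> \<alpha> (\<lambda>k. real_of_ereal (sig (ev \<omega>) u k)) j x) = cum (gap_rate u j \<omega>) 0 s" for \<omega>
  proof -
    have "hazard \<mu> \<alpha> (\<lambda>k. real_of_ereal (sig (ev \<omega>) u k)) j = gap_rate u j \<omega>"
      using gap_rate_hazard[of u \<omega> j] by (auto simp: sig_real_def sig_rv_def)
    then show ?thesis
      unfolding cum_def set_lebesgue_integral_def by (auto intro!: Bochner_Integration.integral_cong simp: indicator_def)
  qed
  show "AE \<omega> in M. \<omega> \<in> {\<omega> \<in> space M. sig_rv u j \<omega> < \<infinity>} \<longrightarrow>
      real_cond_exp M (past_alg M E u j) (indicator {\<omega>' \<in> space M. E u j \<omega>' > ereal s}) \<omega> = exp (- cum (gap_rate u j \<omega>) 0 s)"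
    using E_law[OF s, of u j] by eventually_elim (simp add: cum sig_rv_def)
qed measurable

lemma AE_positive_gaps: "AE \<omega> in M. positive_gaps (ev \<omega>)"
proof -
  have "AE \<omega> in M. \<forall>u k. sig_rv u k \<omega> < \<infinity> \<longrightarrow> 0 < E u k \<omega>"
    unfolding AE_all_countable
  proof (intro allI)
    fix u k
    show "AE \<omega> in M. sig_rv u k \<omega> < \<infinity> \<longrightarrow> 0 < E u k \<omega>"
      using gap.X_pos[of u k] AE_space by eventually_elim auto
  qed
  then show ?thesis by (simp add: positive_gaps_def sig_rv_def)
qed

end

text \<open>The random variable on a sequence of birth times whose conditional mean is
  \<open>limit_forest_prob\<close>, see \<open>path_law\<close>: exactly \<open>length Gs\<close>
  children follow the j-th by time \<tau>, each weighted at minus its remaining time. The condition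
  that the j-th child is born by \<tau> is left to the caller.\<close>

primrec forest_weight :: "(real \<Rightarrow> real) list \<Rightarrow> (nat \<Rightarrow> ereal) \<Rightarrow> real \<Rightarrow> nat \<Rightarrow> ennreal" where
  "forest_weight [] \<sigma> \<tau> = (\<lambda>j. if ereal \<tau> < \<sigma> (Suc j) then 1 else 0)"
| "forest_weight (G # Gs) \<sigma> \<tau> = (\<lambda>j. if \<sigma> (Suc j) \<le> ereal \<tau>
     then ennreal (G (real_of_ereal (\<sigma> (Suc j)) - \<tau>)) * forest_weight Gs \<sigma> \<tau> (Suc j) else 0)"

section \<open>Law of the births of one individual\<close>

context branching
begin

text \<open>The substitution b = \<sigma>_j + x - \<tau> turns the gap length x into the birth time
  b of the child on the clock ending at 0, which yields the recursion for
  \<open>limit_forest_prob\<close>. The endpoints b \<le> 0 and b < 0 differ by a null set.\<close>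

lemma nn_integral_jump:
  assumes G: "\<forall>G\<in>set (G # Gs). G \<in> borel_measurable borel \<and> (\<forall>b. 0 \<le> G b \<and> G b \<le> 1)"
  shows "(\<integral>\<^sup>+x. (if sig_real u j \<omega> + x \<le> \<tau>
        then ennreal (G (sig_real u j \<omega> + x - \<tau>) * limit_forest_prob Gs ((age u j \<tau> \<omega>)(Suc j := sig_real u j \<omega> + x - \<tau>)) (Suc j)) else 0)
        * ennreal (if 0 < x then gap_rate u j \<omega> x * exp (- cum (gap_rate u j \<omega>) 0 x) else 0) \<partial>lborel)
    = ennreal (limit_forest_prob (G # Gs) (\<lambda>k. sig_real u k \<omega> - \<tau>) j)"
proof -
  define s where "s = age u j \<tau> \<omega>"
  have sj: "s j = sig_real u j \<omega> - \<tau>" by (simp add: s_def age_def)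
  let ?f = "\<lambda>b. haz s j b * exp (- cum (haz s j) (s j) b) * (G b * limit_forest_prob Gs (s(Suc j := b)) (Suc j))"
  have [measurable]: "G \<in> borel_measurable borel" using G by simp
  have upd: "(\<lambda>b. s(Suc j := b)) \<in> measurable borel seqs"
    by (rule measurable_fun_upd[where J=UNIV]) auto
  have [measurable]: "(\<lambda>b. limit_forest_prob Gs (s(Suc j := b)) (Suc j)) \<in> borel_measurable borel"
    by (rule limit_forest_prob_measurable[OF _ upd]) (use G in simp)
  have Rb: "0 \<le> G b * limit_forest_prob Gs s' i" for b s' i
    using limit_forest_prob_bounds(1)[of Gs s' i] G by (intro mult_nonneg_nonneg) auto
  have f_nonneg: "0 \<le> ?f b" for b
    by (rule mult_nonneg_nonneg[OF mult_nonneg_nonneg Rb]) (simp_all add: haz.g_nonneg)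
  have "(\<integral>\<^sup>+x. (if sig_real u j \<omega> + x \<le> \<tau>
        then ennreal (G (sig_real u j \<omega> + x - \<tau>) * limit_forest_prob Gs (s(Suc j := sig_real u j \<omega> + x - \<tau>)) (Suc j)) else 0)
        * ennreal (if 0 < x then gap_rate u j \<omega> x * exp (- cum (gap_rate u j \<omega>) 0 x) else 0) \<partial>lborel)
      = (\<integral>\<^sup>+x. (\<lambda>b. ennreal (if s j < b \<and> b \<le> 0 then ?f b else 0)) (s j + 1 * x) \<partial>lborel)"
  proof (intro nn_integral_cong)
    fix x
    have 1: "sig_real u j \<omega> + x - \<tau> = s j + x" "gap_rate u j \<omega> x = haz s j (s j + x)" "cum (gap_rate u j \<omega>) 0 x = cum (haz s j) (s j) (s j + x)"
      using gap_rate_shift[of u j \<omega> x \<tau>, folded s_def] cum_gap_rate[of u j \<omega> x \<tau>, folded s_def] by (simp_all add: sj)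
    show "(if sig_real u j \<omega> + x \<le> \<tau>
        then ennreal (G (sig_real u j \<omega> + x - \<tau>) * limit_forest_prob Gs (s(Suc j := sig_real u j \<omega> + x - \<tau>)) (Suc j)) else 0)
        * ennreal (if 0 < x then gap_rate u j \<omega> x * exp (- cum (gap_rate u j \<omega>) 0 x) else 0)
        = (\<lambda>b. ennreal (if s j < b \<and> b \<le> 0 then ?f b else 0)) (s j + 1 * x)"
    proof (cases "0 < x \<and> s j + x \<le> 0")
      case True
      then show ?thesis unfolding 1
        using sj by (simp add: ennreal_mult'[OF Rb, symmetric] mult_ac)
    next
      case False
      then show ?thesis unfolding 1 using sj by auto
    qed
  qed
  also have "\<dots> = (\<integral>\<^sup>+b. ennreal (if s j < b \<and> b \<le> 0 then ?f b else 0) \<partial>lborel)"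
    by (subst nn_integral_real_affine[where c=1 and t="s j"]) auto
  also have "\<dots> = (\<integral>\<^sup>+b. ennreal (if s j < b \<and> b < 0 then ?f b else 0) \<partial>lborel)"
    by (rule nn_integral_cong_AE) (use AE_lborel_singleton[of 0] in eventually_elim, auto)
  also have "\<dots> = ennreal (\<integral>b. (if s j < b \<and> b < 0 then ?f b else 0) \<partial>lborel)"
    using limit_forest_prob_bounds(2)[OF G refl, of s j] f_nonneg by (intro nn_integral_eq_integral) auto
  also have "\<dots> = ennreal (limit_forest_prob (G # Gs) s j)" by simp
  also have "limit_forest_prob (G # Gs) s j = limit_forest_prob (G # Gs) (\<lambda>k. sig_real u k \<omega> - \<tau>) j"
    by (rule limit_forest_prob_cong) (simp add: s_def age_def)
  finally show ?thesis unfolding s_def .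
qed

text \<open>An identity of conditional means, stated as equality of integrals against every bounded
  weight W measurable in the past. In the induction the factor of the next child is absorbed into W,
  since it is known once the next gap is; the hypothesis treats the later gaps, and
  \<open>gap.joint_law\<close> then integrates out gap j.\<close>

lemma path_law:
  assumes "\<forall>G\<in>set Gs. G \<in> borel_measurable borel \<and> (\<forall>b. 0 \<le> G b \<and> G b \<le> 1)"
    and "W \<in> borel_measurable (past_alg M E u j)" and "\<And>\<omega>. W \<omega> \<le> 1"
  shows "(\<integral>\<^sup>+\<omega>. W \<omega> * (if sig_rv u j \<omega> \<le> ereal \<tau> then forest_weight Gs (\<lambda>k. sig_rv u k \<omega>) \<tau> j else 0) \<partial>M)
    = (\<integral>\<^sup>+\<omega>. W \<omega> * (if sig_rv u j \<omega> \<le> ereal \<tau> then ennreal (limit_forest_prob Gs (\<lambda>k. sig_real u k \<omega> - \<tau>) j) else 0) \<partial>M)"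
  using assms
proof (induction Gs arbitrary: j W)
  case Nil
  define V where "V \<omega> = W \<omega> * (if sig_rv u j \<omega> \<le> ereal \<tau> then 1 else 0)" for \<omega>
  note [measurable] = Nil(2) sig_rv_past_measurable[OF order_refl, of u j] sig_real_past_measurable[OF order_refl, of u j]
  have V_past [measurable]: "V \<in> borel_measurable (past_alg M E u j)" unfolding V_def by measurable
  have VM [measurable]: "V \<in> borel_measurable M" by (rule gap.F_to_M) measurable
  have V1: "V \<omega> \<le> 1" for \<omega> using Nil(3) by (simp add: V_def)
  define c where "c \<omega> = cum (gap_rate u j \<omega>) 0 (\<tau> - sig_real u j \<omega>)" for \<omega>
  have c0: "0 \<le> c \<omega>" for \<omega> unfolding c_def gap_rate_def by (rule haz.cum_nonneg)
  have [measurable]: "c \<in> borel_measurable M"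
  proof -
    have "c \<in> borel_measurable (past_alg M E u j)"
      unfolding c_def using gap.g_meas by (rule cum_param_measurable) measurable
    then show ?thesis by (rule gap.F_to_M)
  qed
  \<comment> \<open>Survival beyond \<tau> includes an infinite gap, which
    \<open>gap.joint_law\<close> does not see. So the complementary event is computed and
    subtracted, which is legitimate in \<open>ennreal\<close> because ?b is finite.\<close>
  let ?b = "\<integral>\<^sup>+\<omega>. V \<omega> * (if sig_rv u (Suc j) \<omega> \<le> ereal \<tau> then 1 else 0) \<partial>M"
  have b_fin: "?b \<noteq> \<infinity>"
  proof -
    have "?b \<le> (\<integral>\<^sup>+\<omega>. 1 \<partial>M)" using V1 by (intro nn_integral_mono) auto
    then show ?thesis by (auto simp: M.emeasure_space_1 top_unique)
  qed
  define \<Psi> where "\<Psi> = (\<lambda>(\<omega>, x). V \<omega> * indicator {..\<tau> - sig_real u j \<omega>} x)"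
  have "?b = (\<integral>\<^sup>+\<omega>. indicator {\<omega> \<in> space M. sig_rv u j \<omega> < \<infinity>} \<omega> *
      (if E u j \<omega> < \<infinity> then \<Psi> (\<omega>, real_of_ereal (E u j \<omega>)) else 0) \<partial>M)"
  proof (rule nn_integral_cong_AE)
    show "AE \<omega> in M. V \<omega> * (if sig_rv u (Suc j) \<omega> \<le> ereal \<tau> then 1 else 0) = indicator {\<omega> \<in> space M. sig_rv u j \<omega> < \<infinity>} \<omega> *
      (if E u j \<omega> < \<infinity> then \<Psi> (\<omega>, real_of_ereal (E u j \<omega>)) else 0)"
      using AE_positive_gaps AE_space
    proof eventually_elim
      case (elim \<omega>)
      show ?case
      proof (cases "sig_rv u j \<omega> \<le> ereal \<tau>")
        case True
        then have fin: "sig_rv u j \<omega> < \<infinity>" by auto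
        moreover have "0 \<le> sig_rv u j \<omega>" using sig_nonneg[OF elim(1)] by (simp add: sig_rv_def)
        moreover have "0 < E u j \<omega>" using elim(1) fin by (simp add: positive_gaps_def sig_rv_def)
        moreover have "sig_rv u (Suc j) \<omega> = sig_rv u j \<omega> + E u j \<omega>" by (simp add: sig_rv_def sig_Suc)
        ultimately show ?thesis
          using elim(2) by (cases "sig_rv u j \<omega>"; cases "E u j \<omega>") (auto simp: sig_real_def indicator_def \<Psi>_def)
      next
        case False
        then show ?thesis by (simp add: V_def \<Psi>_def)
      qed
    qed
  qed
  also have "\<dots> = (\<integral>\<^sup>+\<omega>. indicator {\<omega> \<in> space M. sig_rv u j \<omega> < \<infinity>} \<omega> * (\<integral>\<^sup>+x. \<Psi> (\<omega>, x)
       * ennreal (if 0 < x then gap_rate u j \<omega> x * exp (- cum (gap_rate u j \<omega>) 0 x) else 0) \<partial>lborel) \<partial>M)"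
  proof (rule gap.joint_law[where \<Psi>=\<Psi> and u=u and j=j])
    let ?N = "past_alg M E u j \<Otimes>\<^sub>M (borel :: real measure)"
    have V: "(\<lambda>y. V (fst y)) \<in> borel_measurable ?N"
      by (rule measurable_compose[OF measurable_fst V_past])
    have "(\<lambda>y. sig_real u j (fst y)) \<in> borel_measurable ?N"
      by (rule measurable_compose[OF measurable_fst sig_real_past_measurable]) simp
    then have "(\<lambda>y. snd y - (\<tau> - sig_real u j (fst y))) \<in> borel_measurable ?N"
      by (intro borel_measurable_diff measurable_snd borel_measurable_const)
    then have "{y \<in> space ?N. snd y - (\<tau> - sig_real u j (fst y)) \<le> 0} \<in> sets ?N"
      by (rule borel_measurable_iff_le[THEN iffD1, rule_format])
    then have "(\<lambda>y. V (fst y) * indicator {y \<in> space ?N. snd y - (\<tau> - sig_real u j (fst y)) \<le> 0} y) \<in> borel_measurable ?N"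
      by (intro borel_measurable_times_ennreal V borel_measurable_indicator)
    then show "\<Psi> \<in> borel_measurable ?N"
      by (rule measurable_cong[THEN iffD1, rotated]) (auto simp: \<Psi>_def indicator_def)
  qed
  also have "\<dots> = (\<integral>\<^sup>+\<omega>. V \<omega> * ennreal (1 - exp (- c \<omega>)) \<partial>M)"
  proof (rule nn_integral_cong_AE)
    show "AE \<omega> in M. indicator {\<omega> \<in> space M. sig_rv u j \<omega> < \<infinity>} \<omega> * (\<integral>\<^sup>+x. \<Psi> (\<omega>, x)
       * ennreal (if 0 < x then gap_rate u j \<omega> x * exp (- cum (gap_rate u j \<omega>) 0 x) else 0) \<partial>lborel) = V \<omega> * ennreal (1 - exp (- c \<omega>))"
      using AE_positive_gaps AE_space
    proof eventually_elim
      case (elim \<omega>)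
      interpret rate "gap_rate u j \<omega>" by (rule gap.g_rate)
      have "(\<integral>\<^sup>+x. \<Psi> (\<omega>, x)
         * ennreal (if 0 < x then gap_rate u j \<omega> x * exp (- cum (gap_rate u j \<omega>) 0 x) else 0) \<partial>lborel)
         = V \<omega> * (\<integral>\<^sup>+x. indicator {..\<tau> - sig_real u j \<omega>} x * ennreal (if 0 < x then gap_rate u j \<omega> x * exp (- cum (gap_rate u j \<omega>) 0 x) else 0) \<partial>lborel)"
        by (subst nn_integral_cmult[symmetric]) (auto simp: mult.assoc \<Psi>_def)
      also have "\<dots> = V \<omega> * (if 0 \<le> \<tau> - sig_real u j \<omega> then ennreal (1 - exp (- c \<omega>)) else 0)"
        unfolding first_event_nn_integral c_def ..
      finally have inner: "(\<integral>\<^sup>+x. \<Psi> (\<omega>, x)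
         * ennreal (if 0 < x then gap_rate u j \<omega> x * exp (- cum (gap_rate u j \<omega>) 0 x) else 0) \<partial>lborel)
         = V \<omega> * (if 0 \<le> \<tau> - sig_real u j \<omega> then ennreal (1 - exp (- c \<omega>)) else 0)" .
      show ?case
      proof (cases "sig_rv u j \<omega> \<le> ereal \<tau>")
        case True
        moreover have "0 \<le> sig_rv u j \<omega>" using sig_nonneg[OF elim(1)] by (simp add: sig_rv_def)
        ultimately have "sig_rv u j \<omega> < \<infinity>" "sig_real u j \<omega> \<le> \<tau>" by (cases "sig_rv u j \<omega>"; auto simp: sig_real_def)+
        then show ?thesis unfolding inner using elim(2) by simp
      next
        case False
        then show ?thesis unfolding inner by (simp add: V_def)
      qed
    qed
  qed
  finally have b: "?b = (\<integral>\<^sup>+\<omega>. V \<omega> * ennreal (1 - exp (- c \<omega>)) \<partial>M)" .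
  have limit_forest_prob: "limit_forest_prob [] (\<lambda>k. sig_real u k \<omega> - \<tau>) j = exp (- c \<omega>)" for \<omega>
  proof -
    have "limit_forest_prob [] (\<lambda>k. sig_real u k \<omega> - \<tau>) j = limit_forest_prob [] (age u j \<tau> \<omega>) j"
      by (rule limit_forest_prob_cong) (simp add: age_def)
    moreover have "age u j \<tau> \<omega> j = sig_real u j \<omega> - \<tau>" by (simp add: age_def)
    ultimately show ?thesis using cum_gap_rate[of u j \<omega> "\<tau> - sig_real u j \<omega>" \<tau>] by (simp add: c_def)
  qed
  have "(\<integral>\<^sup>+\<omega>. V \<omega> * (if ereal \<tau> < sig_rv u (Suc j) \<omega> then 1 else 0) \<partial>M) + ?b
      = (\<integral>\<^sup>+\<omega>. V \<omega> * (if ereal \<tau> < sig_rv u (Suc j) \<omega> then 1 else 0) + V \<omega> * (if sig_rv u (Suc j) \<omega> \<le> ereal \<tau> then 1 else 0) \<partial>M)"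
    by (rule nn_integral_add[symmetric]) measurable
  also have "\<dots> = (\<integral>\<^sup>+\<omega>. V \<omega> * ennreal (exp (- c \<omega>)) + V \<omega> * ennreal (1 - exp (- c \<omega>)) \<partial>M)"
  proof (intro nn_integral_cong)
    fix \<omega>
    have "ennreal (exp (- c \<omega>)) + ennreal (1 - exp (- c \<omega>)) = 1"
      using c0[of \<omega>] by (simp flip: ennreal_plus)
    then show "V \<omega> * (if ereal \<tau> < sig_rv u (Suc j) \<omega> then 1 else 0) + V \<omega> * (if sig_rv u (Suc j) \<omega> \<le> ereal \<tau> then 1 else 0)
       = V \<omega> * ennreal (exp (- c \<omega>)) + V \<omega> * ennreal (1 - exp (- c \<omega>))"
      by (auto simp: distrib_left[symmetric] not_less)
  qed
  also have "\<dots> = (\<integral>\<^sup>+\<omega>. V \<omega> * ennreal (exp (- c \<omega>)) \<partial>M) + ?b"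
    unfolding b by (rule nn_integral_add) measurable
  finally have "(\<integral>\<^sup>+\<omega>. V \<omega> * (if ereal \<tau> < sig_rv u (Suc j) \<omega> then 1 else 0) \<partial>M) = (\<integral>\<^sup>+\<omega>. V \<omega> * ennreal (exp (- c \<omega>)) \<partial>M)"
    using b_fin by (rule ennreal_add_right_imp_eq)
  moreover have "W \<omega> * (if sig_rv u j \<omega> \<le> ereal \<tau> then forest_weight [] (\<lambda>k. sig_rv u k \<omega>) \<tau> j else 0) = V \<omega> * (if ereal \<tau> < sig_rv u (Suc j) \<omega> then 1 else 0)" for \<omega>
    by (simp add: V_def)
  moreover have "W \<omega> * (if sig_rv u j \<omega> \<le> ereal \<tau> then ennreal (limit_forest_prob [] (\<lambda>k. sig_real u k \<omega> - \<tau>) j) else 0) = V \<omega> * ennreal (exp (- c \<omega>))" for \<omega>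
    unfolding limit_forest_prob by (simp add: V_def)
  ultimately show ?case by simp
next
  case (Cons G Gs)
  have G01: "0 \<le> G b" "G b \<le> 1" for b using Cons.prems(1) by auto
  note [measurable] = Cons.prems(2)
  have [measurable]: "G \<in> borel_measurable borel" using Cons.prems(1) by simp
  define V where "V \<omega> = W \<omega> * (if sig_rv u j \<omega> \<le> ereal \<tau> then 1 else 0)" for \<omega>
  have V_meas [measurable]: "V \<in> borel_measurable (past_alg M E u j)"
  proof -
    note [measurable] = sig_rv_past_measurable[OF order_refl, of u j]
    show ?thesis unfolding V_def by measurable
  qed
  \<comment> \<open>The weight for the induction hypothesis at \<open>Suc j\<close>: the old weight,
    the condition on the j-th birth and the value at the next birth.\<close>
  define W' where "W' \<omega> = V \<omega> * ennreal (G (sig_real u (Suc j) \<omega> - \<tau>))" for \<omega>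
  have mono: "f \<in> borel_measurable (past_alg M E u (Suc j))" if "f \<in> borel_measurable (past_alg M E u j)" for f :: "'a \<Rightarrow> ennreal"
  proof (rule measurable_from_subalg[OF _ that])
    have "sigma_sets (space M) {E u k -` A \<inter> space M | k A. k < j \<and> A \<in> sets borel}
      \<subseteq> sigma_sets (space M) {E u k -` A \<inter> space M | k A. k < Suc j \<and> A \<in> sets borel}"
      by (rule sigma_sets_mono') (blast intro: less_SucI)
    then show "subalgebra (past_alg M E u (Suc j)) (past_alg M E u j)"
      by (simp add: subalgebra_def past_alg_sets)
  qed
  have W'_meas: "W' \<in> borel_measurable (past_alg M E u (Suc j))"
  proof -
    have "(\<lambda>\<omega>. sig_real u (Suc j) \<omega> - \<tau>) \<in> borel_measurable (past_alg M E u (Suc j))"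
      by (intro borel_measurable_diff sig_real_past_measurable borel_measurable_const) simp
    then have "(\<lambda>\<omega>. ennreal (G (sig_real u (Suc j) \<omega> - \<tau>))) \<in> borel_measurable (past_alg M E u (Suc j))"
      by (rule measurable_compose) simp
    then show ?thesis unfolding W'_def by (intro borel_measurable_times_ennreal mono[OF V_meas])
  qed
  have W'1: "W' \<omega> \<le> 1" for \<omega>
    unfolding W'_def V_def using Cons.prems(3)[of \<omega>] G01
    by (auto intro!: mult_le_one simp: ennreal_le_1)
  define \<Psi> where "\<Psi> = (\<lambda>(\<omega>, x). V \<omega> * (if sig_real u j \<omega> + x \<le> \<tau>
        then ennreal (G (sig_real u j \<omega> + x - \<tau>) * limit_forest_prob Gs ((age u j \<tau> \<omega>)(Suc j := sig_real u j \<omega> + x - \<tau>)) (Suc j)) else 0))"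
  have \<Psi>_meas: "\<Psi> \<in> borel_measurable (past_alg M E u j \<Otimes>\<^sub>M borel)"
  proof -
    let ?N = "past_alg M E u j \<Otimes>\<^sub>M (borel :: real measure)"
    have V: "(\<lambda>y. V (fst y)) \<in> borel_measurable ?N"
      by (rule measurable_compose[OF measurable_fst V_meas])
    have "(\<lambda>\<omega>. age u j \<tau> \<omega>) \<in> measurable (past_alg M E u j) seqs"
      by (rule age_measurable) simp
    from measurable_compose[OF measurable_fst this]
    have age: "(\<lambda>y. age u j \<tau> (fst y)) \<in> measurable ?N seqs" .
    have "(\<lambda>y. sig_real u j (fst y)) \<in> borel_measurable ?N"
      by (rule measurable_compose[OF measurable_fst sig_real_past_measurable]) simp
    then have x: "(\<lambda>y. sig_real u j (fst y) + snd y - \<tau>) \<in> borel_measurable ?N"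
      by (intro borel_measurable_diff borel_measurable_add measurable_snd borel_measurable_const)
    have upd: "(\<lambda>y. (age u j \<tau> (fst y))(Suc j := sig_real u j (fst y) + snd y - \<tau>)) \<in> measurable ?N seqs"
      using age x by (intro measurable_fun_upd[where J=UNIV]) auto
    have "(\<lambda>y. limit_forest_prob Gs ((age u j \<tau> (fst y))(Suc j := sig_real u j (fst y) + snd y - \<tau>)) (Suc j)) \<in> borel_measurable ?N"
      by (rule limit_forest_prob_measurable[OF _ upd]) (use Cons.prems(1) in simp)
    moreover have "(\<lambda>y. G (sig_real u j (fst y) + snd y - \<tau>)) \<in> borel_measurable ?N"
      by (rule measurable_compose[OF x]) simp
    ultimately have GR: "(\<lambda>y. ennreal (G (sig_real u j (fst y) + snd y - \<tau>) * limit_forest_prob Gs ((age u j \<tau> (fst y))(Suc j := sig_real u j (fst y) + snd y - \<tau>)) (Suc j))) \<in> borel_measurable ?N"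
      by (intro measurable_compose[OF _ measurable_ennreal] borel_measurable_times)
    from x have "{y \<in> space ?N. sig_real u j (fst y) + snd y - \<tau> \<le> 0} \<in> sets ?N"
      by (rule borel_measurable_iff_le[THEN iffD1, rule_format])
    with V GR have "(\<lambda>y. V (fst y) * (ennreal (G (sig_real u j (fst y) + snd y - \<tau>) * limit_forest_prob Gs ((age u j \<tau> (fst y))(Suc j := sig_real u j (fst y) + snd y - \<tau>)) (Suc j))
        * indicator {y \<in> space ?N. sig_real u j (fst y) + snd y - \<tau> \<le> 0} y)) \<in> borel_measurable ?N"
      by (intro borel_measurable_times_ennreal borel_measurable_indicator)
    then show ?thesis
      by (rule measurable_cong[THEN iffD1, rotated]) (auto simp: \<Psi>_def indicator_def)
  qed
  have "(\<integral>\<^sup>+\<omega>. W \<omega> * (if sig_rv u j \<omega> \<le> ereal \<tau> then forest_weight (G # Gs) (\<lambda>k. sig_rv u k \<omega>) \<tau> j else 0) \<partial>M)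
      = (\<integral>\<^sup>+\<omega>. W' \<omega> * (if sig_rv u (Suc j) \<omega> \<le> ereal \<tau> then forest_weight Gs (\<lambda>k. sig_rv u k \<omega>) \<tau> (Suc j) else 0) \<partial>M)"
    by (intro nn_integral_cong) (simp add: W'_def V_def sig_real_def mult.assoc)
  also have "\<dots> = (\<integral>\<^sup>+\<omega>. W' \<omega> * (if sig_rv u (Suc j) \<omega> \<le> ereal \<tau> then ennreal (limit_forest_prob Gs (\<lambda>k. sig_real u k \<omega> - \<tau>) (Suc j)) else 0) \<partial>M)"
    by (rule Cons.IH[OF _ W'_meas W'1]) (use Cons.prems(1) in simp)
  also have "\<dots> = (\<integral>\<^sup>+\<omega>. indicator {\<omega> \<in> space M. sig_rv u j \<omega> < \<infinity>} \<omega> *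
      (if E u j \<omega> < \<infinity> then \<Psi> (\<omega>, real_of_ereal (E u j \<omega>)) else 0) \<partial>M)"
  proof (rule nn_integral_cong_AE)
    show "AE \<omega> in M. W' \<omega> * (if sig_rv u (Suc j) \<omega> \<le> ereal \<tau> then ennreal (limit_forest_prob Gs (\<lambda>k. sig_real u k \<omega> - \<tau>) (Suc j)) else 0)
      = indicator {\<omega> \<in> space M. sig_rv u j \<omega> < \<infinity>} \<omega> *
      (if E u j \<omega> < \<infinity> then \<Psi> (\<omega>, real_of_ereal (E u j \<omega>)) else 0)"
      using AE_positive_gaps AE_space
    proof eventually_elim
      case (elim \<omega>)
      have sig_rv_Suc: "sig_rv u (Suc j) \<omega> = sig_rv u j \<omega> + E u j \<omega>" by (simp add: sig_rv_def sig_Suc)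
      show ?case
      proof (cases "sig_rv u j \<omega> \<le> ereal \<tau> \<and> E u j \<omega> < \<infinity>")
        case True
        then have fin: "sig_rv u j \<omega> < \<infinity>" by auto
        moreover have "0 \<le> sig_rv u j \<omega>" using sig_nonneg[OF elim(1)] by (simp add: sig_rv_def)
        moreover have "0 < E u j \<omega>" using elim(1) fin by (simp add: positive_gaps_def sig_rv_def)
        ultimately obtain a x where ax: "sig_rv u j \<omega> = ereal a" "E u j \<omega> = ereal x"
          using True by (cases "sig_rv u j \<omega>"; cases "E u j \<omega>") auto
        then have sig_real: "sig_real u j \<omega> = a" "sig_real u (Suc j) \<omega> = a + x" by (simp_all add: sig_real_def sig_rv_Suc)
        have "limit_forest_prob Gs (\<lambda>k. sig_real u k \<omega> - \<tau>) (Suc j) = limit_forest_prob Gs ((age u j \<tau> \<omega>)(Suc j := a + x - \<tau>)) (Suc j)"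
          by (rule limit_forest_prob_cong) (auto simp: age_def sig_real le_Suc_eq)
        then show ?thesis
          using ax elim(2) G01 limit_forest_prob_bounds(1)[of Gs] Cons.prems(1)
          by (simp add: sig_real W'_def sig_rv_Suc ennreal_mult' mult.assoc \<Psi>_def)
      next
        case False
        then consider "\<not> sig_rv u j \<omega> \<le> ereal \<tau>" | "E u j \<omega> = \<infinity>" by auto
        then show ?thesis by cases (simp_all add: W'_def V_def sig_rv_Suc \<Psi>_def)
      qed
    qed
  qed
  also have "\<dots> = (\<integral>\<^sup>+\<omega>. indicator {\<omega> \<in> space M. sig_rv u j \<omega> < \<infinity>} \<omega> * (\<integral>\<^sup>+x. \<Psi> (\<omega>, x)
       * ennreal (if 0 < x then gap_rate u j \<omega> x * exp (- cum (gap_rate u j \<omega>) 0 x) else 0) \<partial>lborel) \<partial>M)"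
    by (rule gap.joint_law[OF \<Psi>_meas])
  also have "\<dots> = (\<integral>\<^sup>+\<omega>. W \<omega> * (if sig_rv u j \<omega> \<le> ereal \<tau> then ennreal (limit_forest_prob (G # Gs) (\<lambda>k. sig_real u k \<omega> - \<tau>) j) else 0) \<partial>M)"
  proof (rule nn_integral_cong)
    fix \<omega> assume \<omega>: "\<omega> \<in> space M"
    have [measurable]: "(\<lambda>x. limit_forest_prob Gs ((age u j \<tau> \<omega>)(Suc j := sig_real u j \<omega> + x - \<tau>)) (Suc j)) \<in> borel_measurable borel"
    proof (rule limit_forest_prob_measurable)
      show "(\<lambda>x. (age u j \<tau> \<omega>)(Suc j := sig_real u j \<omega> + x - \<tau>)) \<in> measurable borel seqs"
        by (rule measurable_fun_upd[where J=UNIV]) auto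
    qed (use Cons.prems(1) in simp)
    interpret rate "gap_rate u j \<omega>" by (rule gap.g_rate)
    define r where "r = ennreal (limit_forest_prob (G # Gs) (\<lambda>k. sig_real u k \<omega> - \<tau>) j)"
    have int: "(\<integral>\<^sup>+x. \<Psi> (\<omega>, x)
       * ennreal (if 0 < x then gap_rate u j \<omega> x * exp (- cum (gap_rate u j \<omega>) 0 x) else 0) \<partial>lborel) = V \<omega> * r"
      unfolding r_def nn_integral_jump[OF Cons.prems(1), symmetric]
      by (subst nn_integral_cmult[symmetric]) (auto simp: mult.assoc \<Psi>_def)
    have "indicator {\<omega> \<in> space M. sig_rv u j \<omega> < \<infinity>} \<omega> * (V \<omega> * r) = W \<omega> * (if sig_rv u j \<omega> \<le> ereal \<tau> then r else 0)"
    proof (cases "sig_rv u j \<omega> \<le> ereal \<tau>")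
      case True
      then have "\<omega> \<in> {\<omega> \<in> space M. sig_rv u j \<omega> < \<infinity>}" using \<omega> by auto
      then show ?thesis using True by (simp add: V_def)
    qed (simp add: V_def)
    then show "indicator {\<omega> \<in> space M. sig_rv u j \<omega> < \<infinity>} \<omega> * (\<integral>\<^sup>+x. \<Psi> (\<omega>, x)
       * ennreal (if 0 < x then gap_rate u j \<omega> x * exp (- cum (gap_rate u j \<omega>) 0 x) else 0) \<partial>lborel)
      = W \<omega> * (if sig_rv u j \<omega> \<le> ereal \<tau> then ennreal (limit_forest_prob (G # Gs) (\<lambda>k. sig_real u k \<omega> - \<tau>) j) else 0)"
      unfolding int r_def .
  qed
  finally show ?case .
qed

end

subsection \<open>Genealogies of the branching process\<close>

text \<open>The time remaining after the birth of u is r.\<close>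

primrec pop_matches :: "(nat list \<Rightarrow> nat \<Rightarrow> ereal) \<Rightarrow> pattern \<Rightarrow> nat list \<Rightarrow> real \<Rightarrow> bool" where
  "pop_matches e Any = (\<lambda>u r. True)"
| "pop_matches e (Tree ts) = (\<lambda>u r. sig e u (length ts) \<le> ereal r \<and> ereal r < sig e u (Suc (length ts)) \<and>
     (\<forall>i<length ts. (map (pop_matches e) ts ! i) (u @ [i]) (r - real_of_ereal (sig e u (Suc i)))))"

lemma pop_matches_Tree:
  "pop_matches e (Tree ts) u r \<longleftrightarrow> sig e u (length ts) \<le> ereal r \<and> ereal r < sig e u (Suc (length ts)) \<and>
     (\<forall>i<length ts. pop_matches e (ts ! i) (u @ [i]) (r - real_of_ereal (sig e u (Suc i))))"
  by simp

lemma sig_cong: "e u = e' u \<Longrightarrow> sig e u k = sig e' u k"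
  by (simp add: sig_def)

text \<open>A match below u inspects only the gaps of u and its descendants. Together with the
  independence of individuals this makes disjoint families independent.\<close>

lemma pop_matches_cong: "(\<And>w. e (u @ w) = e' (u @ w)) \<Longrightarrow> pop_matches e P u r = pop_matches e' P u r"
proof (induction P arbitrary: u r)
  case (Tree ts)
  have "sig e u k = sig e' u k" for k using Tree.prems[of "[]"] by (intro sig_cong) simp
  moreover have "pop_matches e (ts ! i) (u @ [i]) r = pop_matches e' (ts ! i) (u @ [i]) r" if "i < length ts" for i r
    by (rule Tree.IH) (use that Tree.prems in simp_all)
  ultimately show ?case unfolding pop_matches_Tree by auto
qed simp

abbreviation paths :: "(nat \<Rightarrow> ereal) measure" where "paths \<equiv> PiM UNIV (\<lambda>_. borel)"

lemma sig_measurable: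
  assumes "u \<in> K"
  shows "(\<lambda>x. sig x u k) \<in> borel_measurable (PiM K (\<lambda>_. paths))"
proof -
  have "(\<lambda>x. x u j) \<in> borel_measurable (PiM K (\<lambda>_. paths))" for j
    using measurable_compose[OF measurable_component_singleton[OF assms]
        measurable_component_singleton[of j UNIV "\<lambda>_. borel"]] by simp
  then show ?thesis unfolding sig_def by (intro borel_measurable_ereal_sum)
qed

text \<open>Stated on the gaps indexed by any K containing the descendants of u, so that it applies
  to the restricted families used for independence. The time is a variable too, because below a
  child it depends on earlier gaps.\<close>

lemma pop_matches_measurable:
  "(\<And>w. u @ w \<in> K) \<Longrightarrow> Measurable.pred ((borel :: real measure) \<Otimes>\<^sub>M PiM K (\<lambda>_. paths)) (\<lambda>p. pop_matches (snd p) P u (fst p))"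
proof (induction P arbitrary: u)
  case (Tree ts)
  let ?N = "(borel :: real measure) \<Otimes>\<^sub>M PiM K (\<lambda>_. paths)"
  have uK: "u \<in> K" using Tree.prems[of "[]"] by simp
  have sm [measurable]: "(\<lambda>p. sig (snd p) u k) \<in> borel_measurable ?N" for k
    by (rule measurable_compose[OF measurable_snd sig_measurable[OF uK]])
  have [measurable]: "(\<lambda>p. ereal (fst p)) \<in> borel_measurable ?N"
    by (rule measurable_compose[OF measurable_fst]) simp
  have "Measurable.pred ?N (\<lambda>p. pop_matches (snd p) (ts ! i) (u @ [i]) (fst p - real_of_ereal (sig (snd p) u (Suc i))))"
    if i: "i < length ts" for i
  proof -
    have "(\<lambda>p. real_of_ereal (sig (snd p) u (Suc i))) \<in> borel_measurable ?N"
      by (rule measurable_compose[OF sm]) simp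
    then have pm: "(\<lambda>p. (fst p - real_of_ereal (sig (snd p) u (Suc i)), snd p)) \<in> measurable ?N ?N"
      by (intro measurable_Pair borel_measurable_diff measurable_fst measurable_snd)
    have IH: "Measurable.pred ?N (\<lambda>p. pop_matches (snd p) (ts ! i) (u @ [i]) (fst p))"
      by (rule Tree.IH) (use i Tree.prems in simp_all)
    show ?thesis using measurable_compose[OF pm IH] unfolding fst_conv snd_conv .
  qed
  then have "Measurable.pred ?N (\<lambda>p. \<forall>i\<in>{..<length ts}. pop_matches (snd p) (ts ! i) (u @ [i]) (fst p - real_of_ereal (sig (snd p) u (Suc i))))"
    by (intro pred_intros_finite) auto
  moreover have "Measurable.pred ?N (\<lambda>p. sig (snd p) u (length ts) \<le> ereal (fst p))"
    "Measurable.pred ?N (\<lambda>p. ereal (fst p) < sig (snd p) u (Suc (length ts)))"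
    by measurable
  ultimately show ?case unfolding pop_matches_Tree Ball_def lessThan_iff by (intro pred_intros_logic)
qed simp

lemma pop_matches_measurable':
  assumes "\<And>w. u @ w \<in> K" "f \<in> borel_measurable N" "g \<in> measurable N (PiM K (\<lambda>_. paths))"
  shows "Measurable.pred N (\<lambda>x. pop_matches (g x) P u (f x))"
  using measurable_compose[OF measurable_Pair[OF assms(2,3)] pop_matches_measurable[OF assms(1)]]
  unfolding fst_conv snd_conv .

text \<open>For increasing birth times the condition on the last child implies the conditions on all
  earlier ones, so the nested conditions collapse to the one in \<open>pop_matches\<close>.\<close>

lemma forest_weight_eq_prod:
  assumes "\<And>k. \<sigma> k \<le> \<sigma> (Suc k)"
  shows "(if \<sigma> j \<le> ereal \<tau> then forest_weight Gs \<sigma> \<tau> j else 0) =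
    (if \<sigma> (j + length Gs) \<le> ereal \<tau> \<and> ereal \<tau> < \<sigma> (Suc (j + length Gs))
     then (\<Prod>i<length Gs. ennreal ((Gs ! i) (real_of_ereal (\<sigma> (Suc (j + i))) - \<tau>))) else 0)"
proof (induction Gs arbitrary: j)
  case (Cons G Gs)
  have "(if \<sigma> j \<le> ereal \<tau> then forest_weight (G # Gs) \<sigma> \<tau> j else 0)
     = ennreal (G (real_of_ereal (\<sigma> (Suc j)) - \<tau>)) * (if \<sigma> (Suc j) \<le> ereal \<tau> then forest_weight Gs \<sigma> \<tau> (Suc j) else 0)"
    using order_trans[OF assms[of j], of "ereal \<tau>"] by auto
  also have "\<dots> = (if \<sigma> (j + length (G # Gs)) \<le> ereal \<tau> \<and> ereal \<tau> < \<sigma> (Suc (j + length (G # Gs)))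
     then (\<Prod>i<length (G # Gs). ennreal (((G # Gs) ! i) (real_of_ereal (\<sigma> (Suc (j + i))) - \<tau>))) else 0)"
    unfolding Cons.IH by (simp add: prod.lessThan_Suc_shift del: prod.lessThan_Suc)
  finally show ?case .
qed simp

lemma (in prob_space) exponential_nonneg_AE:
  assumes "distributed M lborel X (exponential_density 1)"
  shows "AE \<omega> in M. 0 \<le> X \<omega>"
proof -
  have X: "X \<in> borel_measurable M" and law: "distr M borel X = density lborel (exponential_density 1)"
    using assms by (simp_all add: distributed_def cong: distr_cong)
  have "AE t in density lborel (exponential_density 1). 0 \<le> t"
    by (subst AE_density) (auto simp: exponential_density_def)
  then have "AE t in distr M borel X. 0 \<le> t" unfolding law .
  then show ?thesis by (subst (asm) AE_distr_iff[OF X]) auto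
qed

context branching
begin

lemma paths_measurable: "(\<lambda>\<omega>. restrict (\<lambda>v i. E v i \<omega>) K) \<in> measurable M (PiM K (\<lambda>_. paths))"
  by (rule measurable_restrict) (rule path_measurable)

lemma pop_matches_event:
  assumes [measurable]: "f \<in> borel_measurable M"
  shows "{\<omega> \<in> space M. pop_matches (ev \<omega>) P u (f \<omega>)} \<in> sets M"
proof -
  have "Measurable.pred M (\<lambda>\<omega>. pop_matches (restrict (\<lambda>v i. E v i \<omega>) UNIV) P u (f \<omega>))"
    by (rule pop_matches_measurable'[OF _ assms paths_measurable]) simp
  then show ?thesis unfolding restrict_UNIV pred_def .
qed

text \<open>The labels below different children of u form disjoint sets, and functions of disjoint
  blocks of an independent family are independent. The times \<open>r i\<close> are constants here;
  they become random only after conditioning on u in \<open>pop_matches_prob\<close>.\<close>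

lemma pop_matches_siblings:
  "emeasure M {\<omega> \<in> space M. \<forall>i<c. pop_matches (ev \<omega>) (P i) (u @ [i]) (r i)}
    = (\<Prod>i<c. emeasure M {\<omega> \<in> space M. pop_matches (ev \<omega>) (P i) (u @ [i]) (r i)})"
proof (cases "c = 0")
  case True
  then show ?thesis by (simp add: M.emeasure_space_1)
next
  case False
  define K where "K i = {v. \<exists>w. v = u @ [i] @ w}" for i :: nat
  define A where "A i = {y \<in> space (PiM (K i) (\<lambda>_. paths)). pop_matches y (P i) (u @ [i]) (r i)}" for i
  let ?X = "\<lambda>i \<omega>. restrict (\<lambda>v i. E v i \<omega>) (K i)"
  have ind: "M.indep_vars (\<lambda>i. PiM (K i) (\<lambda>_. paths)) ?X {..<c}"
    by (rule M.indep_vars_restrict[OF E_indep]) (auto simp: K_def disjoint_family_on_def)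
  have A: "A i \<in> sets (PiM (K i) (\<lambda>_. paths))" for i
  proof -
    have "Measurable.pred (PiM (K i) (\<lambda>_. paths)) (\<lambda>y. pop_matches y (P i) (u @ [i]) (r i))"
      by (rule pop_matches_measurable'[OF _ borel_measurable_const measurable_ident_sets[OF refl]]) (auto simp: K_def)
    then show ?thesis unfolding A_def pred_def .
  qed
  have vim: "?X i -` A i \<inter> space M = {\<omega> \<in> space M. pop_matches (ev \<omega>) (P i) (u @ [i]) (r i)}" for i
  proof -
    have "pop_matches (?X i \<omega>) (P i) (u @ [i]) (r i) = pop_matches (ev \<omega>) (P i) (u @ [i]) (r i)" for \<omega>
      by (rule pop_matches_cong) (auto simp: K_def)
    then show ?thesis
      using measurable_space[OF paths_measurable[of "K i"]] by (auto simp: A_def)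
  qed
  have "M.prob (\<Inter>i\<in>{..<c}. ?X i -` A i \<inter> space M) = (\<Prod>i\<in>{..<c}. M.prob (?X i -` A i \<inter> space M))"
    by (rule M.indep_varsD_finite[OF ind]) (use A False in auto)
  also have "(\<Inter>i\<in>{..<c}. ?X i -` A i \<inter> space M) = {\<omega> \<in> space M. \<forall>i<c. pop_matches (ev \<omega>) (P i) (u @ [i]) (r i)}"
    unfolding vim using False by auto
  finally show ?thesis
    unfolding vim M.emeasure_eq_measure by (simp add: prod_ennreal)
qed

text \<open>Induction on the pattern. The gaps of u are independent of those of all its proper
  descendants, so by Fubini the birth times of the children may be frozen; then the siblings are
  independent and each has the probability of the induction hypothesis at its remaining time. What
  is left is a mean over the gaps of u, given by \<open>path_law\<close> with j = 0 and W =
  1.\<close>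

lemma pop_matches_prob:
  "0 \<le> \<tau> \<Longrightarrow> emeasure M {\<omega> \<in> space M. pop_matches (ev \<omega>) P u \<tau>} = ennreal (limit_prob P (- \<tau>))"
proof (induction P arbitrary: u \<tau>)
  case Any
  then show ?case by (simp add: M.emeasure_space_1)
next
  case (Tree ts)
  define c where "c = length ts"
  \<comment> \<open>The labels strictly below u, disjoint from the block {u}.\<close>
  define K where "K = {v. \<exists>i w. v = u @ [i] @ (w :: nat list)}"
  let ?PK = "PiM K (\<lambda>_. paths)" and ?PX = "PiM {u} (\<lambda>_. paths)"
  define X where "X \<omega> = restrict (\<lambda>v i. E v i \<omega>) {u}" for \<omega>
  define Y where "Y \<omega> = restrict (\<lambda>v i. E v i \<omega>) K" for \<omega>
  define s where "s x k = sig x u k" for x k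
  define a where "a x \<longleftrightarrow> s x c \<le> ereal \<tau> \<and> ereal \<tau> < s x (Suc c)" for x
  define b where "b x y \<longleftrightarrow> (\<forall>i<c. pop_matches y (ts ! i) (u @ [i]) (\<tau> - real_of_ereal (s x (Suc i))))" for x y
  have sX: "s (X \<omega>) k = sig_rv u k \<omega>" for \<omega> k by (simp add: s_def X_def sig_rv_def sig_def)
  have s_meas: "(\<lambda>x. s x k) \<in> borel_measurable ?PX" for k
    unfolding s_def by (rule sig_measurable) simp
  have X: "X \<in> measurable M ?PX" unfolding X_def by (rule paths_measurable)
  have Y: "Y \<in> measurable M ?PK" unfolding Y_def by (rule paths_measurable)
  have ind: "M.indep_var ?PX X ?PK Y"
    unfolding X_def Y_def by (rule M.indep_var_restrict[OF E_indep]) (auto simp: K_def)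
  have ab_meas: "{p \<in> space (?PX \<Otimes>\<^sub>M ?PK). a (fst p) \<and> b (fst p) (snd p)} \<in> sets (?PX \<Otimes>\<^sub>M ?PK)"
  proof -
    have s1: "(\<lambda>p. s (fst p) k) \<in> borel_measurable (?PX \<Otimes>\<^sub>M ?PK)" for k
      by (rule measurable_compose[OF measurable_fst s_meas])
    have "Measurable.pred (?PX \<Otimes>\<^sub>M ?PK) (\<lambda>p. pop_matches (snd p) (ts ! i) (u @ [i]) (\<tau> - real_of_ereal (s (fst p) (Suc i))))" for i
    proof (rule pop_matches_measurable'[OF _ _ measurable_snd])
      have "(\<lambda>p. real_of_ereal (s (fst p) (Suc i))) \<in> borel_measurable (?PX \<Otimes>\<^sub>M ?PK)"
        by (rule measurable_compose[OF s1]) simp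
      then show "(\<lambda>p. \<tau> - real_of_ereal (s (fst p) (Suc i))) \<in> borel_measurable (?PX \<Otimes>\<^sub>M ?PK)"
        by (intro borel_measurable_diff borel_measurable_const)
    qed (auto simp: K_def)
    then have "Measurable.pred (?PX \<Otimes>\<^sub>M ?PK) (\<lambda>p. \<forall>i\<in>{..<c}. pop_matches (snd p) (ts ! i) (u @ [i]) (\<tau> - real_of_ereal (s (fst p) (Suc i))))"
      by (intro pred_intros_finite) auto
    moreover have "Measurable.pred (?PX \<Otimes>\<^sub>M ?PK) (\<lambda>p. s (fst p) c \<le> ereal \<tau>)"
      "Measurable.pred (?PX \<Otimes>\<^sub>M ?PK) (\<lambda>p. ereal \<tau> < s (fst p) (Suc c))"
      using s1 by (measurable, measurable)
    ultimately have "Measurable.pred (?PX \<Otimes>\<^sub>M ?PK) (\<lambda>p. a (fst p) \<and> b (fst p) (snd p))"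
      unfolding a_def b_def Ball_def lessThan_iff by (intro pred_intros_logic)
    then show ?thesis unfolding pred_def .
  qed
  interpret DX: prob_space "distr M ?PX X" by (rule M.prob_space_distr[OF X])
  interpret DY: prob_space "distr M ?PK Y" by (rule M.prob_space_distr[OF Y])
  define D where "D = {p \<in> space (?PX \<Otimes>\<^sub>M ?PK). a (fst p) \<and> b (fst p) (snd p)}"
  have XY: "(\<lambda>\<omega>. (X \<omega>, Y \<omega>)) \<in> measurable M (?PX \<Otimes>\<^sub>M ?PK)" using X Y by (rule measurable_Pair)
  have bY: "b x (Y \<omega>) \<longleftrightarrow> (\<forall>i<c. pop_matches (ev \<omega>) (ts ! i) (u @ [i]) (\<tau> - real_of_ereal (s x (Suc i))))" for x \<omega>
    unfolding b_def Y_def by (intro all_cong pop_matches_cong) (auto simp: K_def)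
  have "{\<omega> \<in> space M. pop_matches (ev \<omega>) (Tree ts) u \<tau>} = (\<lambda>\<omega>. (X \<omega>, Y \<omega>)) -` D \<inter> space M"
    using measurable_space[OF XY] unfolding D_def pop_matches_Tree
    by (auto simp: bY a_def sX c_def[symmetric] sig_rv_def)
  then have "emeasure M {\<omega> \<in> space M. pop_matches (ev \<omega>) (Tree ts) u \<tau>} = emeasure (distr M (?PX \<Otimes>\<^sub>M ?PK) (\<lambda>\<omega>. (X \<omega>, Y \<omega>))) D"
    using XY ab_meas by (simp add: emeasure_distr D_def)
  also have "\<dots> = emeasure (distr M ?PX X \<Otimes>\<^sub>M distr M ?PK Y) D"
    using ind unfolding M.indep_var_distribution_eq by simp
  also have "\<dots> = (\<integral>\<^sup>+x. emeasure (distr M ?PK Y) (Pair x -` D) \<partial>distr M ?PX X)"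
  proof (rule DY.emeasure_pair_measure_alt)
    have "sets (distr M ?PX X \<Otimes>\<^sub>M distr M ?PK Y) = sets (?PX \<Otimes>\<^sub>M ?PK)"
      by (rule sets_pair_measure_cong) (rule sets_distr)+
    then show "D \<in> sets (distr M ?PX X \<Otimes>\<^sub>M distr M ?PK Y)" using ab_meas unfolding D_def by blast
  qed
  also have "\<dots> = (\<integral>\<^sup>+x. (if a x then (\<Prod>i<c. emeasure M {\<omega> \<in> space M. pop_matches (ev \<omega>) (ts ! i) (u @ [i]) (\<tau> - real_of_ereal (s x (Suc i)))}) else 0) \<partial>distr M ?PX X)"
  proof (rule nn_integral_cong)
    fix x assume "x \<in> space (distr M ?PX X)"
    then have x: "x \<in> space ?PX" by simp
    have Dx: "Pair x -` D \<in> sets ?PK" using ab_meas unfolding D_def by (rule sets_Pair1)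
    have "emeasure (distr M ?PK Y) (Pair x -` D) = emeasure M (Y -` (Pair x -` D) \<inter> space M)"
      by (rule emeasure_distr[OF Y Dx])
    also have "Y -` (Pair x -` D) \<inter> space M = {\<omega> \<in> space M. a x \<and> b x (Y \<omega>)}"
      using x measurable_space[OF Y] by (auto simp: D_def space_pair_measure)
    finally show "emeasure (distr M ?PK Y) (Pair x -` D) = (if a x then (\<Prod>i<c. emeasure M {\<omega> \<in> space M. pop_matches (ev \<omega>) (ts ! i) (u @ [i]) (\<tau> - real_of_ereal (s x (Suc i)))}) else 0)"
      unfolding bY pop_matches_siblings[symmetric] by simp
  qed
  also have "\<dots> = (\<integral>\<^sup>+x. (if a x then (\<Prod>i<c. ennreal (limit_prob (ts ! i) (- max 0 (\<tau> - real_of_ereal (s x (Suc i)))))) else 0) \<partial>distr M ?PX X)"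
  proof (rule nn_integral_cong_AE)
    have "AE x in distr M ?PX X. \<forall>k. s x k \<le> s x (Suc k)"
    proof (subst AE_distr_iff[OF X])
      have "Measurable.pred ?PX (\<lambda>x. s x k \<le> s x (Suc k))" for k
        unfolding pred_def by (rule borel_measurable_le[OF s_meas s_meas])
      then have "Measurable.pred ?PX (\<lambda>x. \<forall>k. s x k \<le> s x (Suc k))" by (intro pred_intros_countable)
      then show "{x \<in> space ?PX. \<forall>k. s x k \<le> s x (Suc k)} \<in> sets ?PX" unfolding pred_def .
      show "AE \<omega> in M. \<forall>k. s (X \<omega>) k \<le> s (X \<omega>) (Suc k)"
        using AE_positive_gaps by eventually_elim (auto simp: sX sig_rv_def intro!: sig_mono)
    qed
    then show "AE x in distr M ?PX X. (if a x then (\<Prod>i<c. emeasure M {\<omega> \<in> space M. pop_matches (ev \<omega>) (ts ! i) (u @ [i]) (\<tau> - real_of_ereal (s x (Suc i)))}) else 0)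
      = (if a x then (\<Prod>i<c. ennreal (limit_prob (ts ! i) (- max 0 (\<tau> - real_of_ereal (s x (Suc i)))))) else 0)"
    proof eventually_elim
      case (elim x)
      then have inc: "s x i \<le> s x k" if "i \<le> k" for i k using lift_Suc_mono_le[of "s x" i k] elim that by auto
      show ?case
      proof (cases "a x")
        case True
        have "emeasure M {\<omega> \<in> space M. pop_matches (ev \<omega>) (ts ! i) (u @ [i]) (\<tau> - real_of_ereal (s x (Suc i)))}
           = ennreal (limit_prob (ts ! i) (- max 0 (\<tau> - real_of_ereal (s x (Suc i)))))" if i: "i < c" for i
        proof -
          \<comment> \<open>Partial sums increase for almost every x, so each of the first c
            children is born by time \<tau> and the remaining time is nonnegative, as the induction
            hypothesis requires.\<close>
          have "s x (Suc i) \<le> ereal \<tau>" using inc[of "Suc i" c] i True by (auto simp: a_def)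
          moreover have "0 \<le> s x (Suc i)" using inc[of 0 "Suc i"] by (simp add: s_def)
          ultimately have "0 \<le> \<tau> - real_of_ereal (s x (Suc i))" by (cases "s x (Suc i)") auto
          then show ?thesis using i by (subst Tree.IH) (auto simp: c_def max_def)
        qed
        then show ?thesis by simp
      qed simp
    qed
  qed
  also have "\<dots> = (\<integral>\<^sup>+\<omega>. (if a (X \<omega>) then (\<Prod>i<c. ennreal (limit_prob (ts ! i) (- max 0 (\<tau> - real_of_ereal (s (X \<omega>) (Suc i)))))) else 0) \<partial>M)"
  proof (rule nn_integral_distr[OF X])
    have "(\<lambda>x. limit_prob (ts ! i) (- max 0 (\<tau> - real_of_ereal (s x (Suc i))))) \<in> borel_measurable ?PX" for i
      using s_meas[of "Suc i"] by measurable
    moreover have "Measurable.pred ?PX a"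
      unfolding a_def using s_meas[of c] s_meas[of "Suc c"] by measurable
    ultimately have "(\<lambda>x. if a x then (\<Prod>i<c. ennreal (limit_prob (ts ! i) (- max 0 (\<tau> - real_of_ereal (s x (Suc i)))))) else 0) \<in> borel_measurable ?PX"
      by measurable
    then show "(\<lambda>x. if a x then (\<Prod>i<c. ennreal (limit_prob (ts ! i) (- max 0 (\<tau> - real_of_ereal (s x (Suc i)))))) else 0) \<in> borel_measurable (distr M ?PX X)"
      unfolding measurable_distr_eq1 .
  qed
  also have "\<dots> = (\<integral>\<^sup>+\<omega>. 1 * (if sig_rv u 0 \<omega> \<le> ereal \<tau> then forest_weight (map limit_prob ts) (\<lambda>k. sig_rv u k \<omega>) \<tau> 0 else 0) \<partial>M)"
  proof (rule nn_integral_cong_AE)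
    show "AE \<omega> in M. (if a (X \<omega>) then (\<Prod>i<c. ennreal (limit_prob (ts ! i) (- max 0 (\<tau> - real_of_ereal (s (X \<omega>) (Suc i)))))) else 0)
      = 1 * (if sig_rv u 0 \<omega> \<le> ereal \<tau> then forest_weight (map limit_prob ts) (\<lambda>k. sig_rv u k \<omega>) \<tau> 0 else 0)"
      using AE_positive_gaps
    proof eventually_elim
      case (elim \<omega>)
      have inc: "sig_rv u i \<omega> \<le> sig_rv u k \<omega>" if "i \<le> k" for i k unfolding sig_rv_def by (rule sig_mono[OF elim that])
      have "limit_prob (ts ! i) (- max 0 (\<tau> - real_of_ereal (sig_rv u (Suc i) \<omega>))) = limit_prob (ts ! i) (real_of_ereal (sig_rv u (Suc i) \<omega>) - \<tau>)"
        if "i < c" "a (X \<omega>)" for i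
      proof -
        have "sig_rv u (Suc i) \<omega> \<le> ereal \<tau>" using inc[of "Suc i" c] that by (auto simp: a_def sX)
        moreover have "0 \<le> sig_rv u (Suc i) \<omega>" using inc[of 0 "Suc i"] by simp
        ultimately have "0 \<le> \<tau> - real_of_ereal (sig_rv u (Suc i) \<omega>)" by (cases "sig_rv u (Suc i) \<omega>") auto
        then show ?thesis by (simp add: max_def)
      qed
      then show ?case
        unfolding mult_1 by (subst forest_weight_eq_prod) (auto simp: inc sX a_def c_def)
    qed
  qed
  also have "\<dots> = (\<integral>\<^sup>+\<omega>. 1 * (if sig_rv u 0 \<omega> \<le> ereal \<tau> then ennreal (limit_forest_prob (map limit_prob ts) (\<lambda>k. sig_real u k \<omega> - \<tau>) 0) else 0) \<partial>M)"
    by (rule path_law) (auto simp: limit_prob_bounds)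
  also have "\<dots> = (\<integral>\<^sup>+\<omega>. ennreal (limit_forest_prob (map limit_prob ts) (\<lambda>_. - \<tau>) 0) \<partial>M)"
  proof (rule nn_integral_cong)
    fix \<omega>
    have "limit_forest_prob (map limit_prob ts) (\<lambda>k. sig_real u k \<omega> - \<tau>) 0 = limit_forest_prob (map limit_prob ts) (\<lambda>_. - \<tau>) 0"
      by (rule limit_forest_prob_cong) simp
    then show "1 * (if sig_rv u 0 \<omega> \<le> ereal \<tau> then ennreal (limit_forest_prob (map limit_prob ts) (\<lambda>k. sig_real u k \<omega> - \<tau>) 0) else 0) = ennreal (limit_forest_prob (map limit_prob ts) (\<lambda>_. - \<tau>) 0)"
      using Tree.prems by simp
  qed
  also have "\<dots> = ennreal (limit_prob (Tree ts) (- \<tau>))"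
    by (simp add: M.emeasure_space_1)
  finally show ?case .
qed

text \<open>By independence T1 may be frozen, and \<open>pop_matches_prob\<close> applies with
  remaining time T1. The reflection t \<mapsto> - t turns the exponential density into exp t on the
  negative half-line, giving the integral of \<open>fringe_matches_average_limit\<close>.\<close>

theorem pop_matches_exponential_prob:
  assumes T1_indep: "M.indep_set
         (sigma_sets (space M) {(\<lambda>\<omega> u i. E u i \<omega>) -` A \<inter> space M | A. A \<in> sets (PiM UNIV (\<lambda>_. paths))})
         (sigma_sets (space M) {T1 -` A \<inter> space M | A. A \<in> sets borel})"
    and T1_exp: "distributed M lborel T1 (exponential_density 1)"
  shows "measure M {\<omega> \<in> space M. pop_matches (ev \<omega>) P [] (T1 \<omega>)} = (\<integral>t. (if t < 0 then exp t * limit_prob P t else 0) \<partial>lborel)"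
proof -
  (* Independence of variables requires a common codomain, so T1 is embedded as a constant family. *)
  let ?PZ = "PiM UNIV (\<lambda>_ :: nat list. paths)"
  define q where "q t = (\<lambda>(_ :: nat list) (_ :: nat). ereal t)" for t
  define rl where "rl y = real_of_ereal (y ([] :: nat list) (0 :: nat))" for y
  define T' where "T' \<omega> = q (T1 \<omega>)" for \<omega>
  have rl_T' [simp]: "rl (T' \<omega>) = T1 \<omega>" for \<omega> by (simp add: rl_def T'_def q_def)
  have T1 [measurable]: "T1 \<in> borel_measurable M" using T1_exp by (simp add: distributed_def)
  have Z: "(\<lambda>\<omega> u i. E u i \<omega>) \<in> measurable M ?PZ" using paths_measurable[of UNIV] unfolding restrict_UNIV .
  have q: "q \<in> measurable borel ?PZ"
    unfolding q_def by (intro measurable_PiM_single') (auto simp: space_PiM)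
  have T': "T' \<in> measurable M ?PZ" unfolding T'_def by (rule measurable_compose[OF T1 q])
  have rl: "rl \<in> borel_measurable ?PZ"
  proof -
    have "(\<lambda>y. y [] 0) \<in> borel_measurable ?PZ"
      using measurable_compose[OF measurable_component_singleton[of "[]" UNIV "\<lambda>_. paths"]
          measurable_component_singleton[of 0 UNIV "\<lambda>_. borel"]] by simp
    then show ?thesis unfolding rl_def by (rule measurable_compose) simp
  qed
  have ind: "M.indep_var ?PZ (\<lambda>\<omega> u i. E u i \<omega>) ?PZ T'"
    unfolding M.indep_var_eq
  proof (intro conjI Z T')
    have "{T' -` A \<inter> space M | A. A \<in> sets ?PZ} \<subseteq> {T1 -` A \<inter> space M | A. A \<in> sets borel}"
    proof safe
      fix A assume "A \<in> sets ?PZ"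
      then have "q -` A \<inter> space borel \<in> sets borel" by (rule measurable_sets[OF q])
      moreover have "T' -` A \<inter> space M = T1 -` (q -` A \<inter> space borel) \<inter> space M" by (auto simp: T'_def)
      ultimately show "\<exists>B. T' -` A \<inter> space M = T1 -` B \<inter> space M \<and> B \<in> sets borel" by blast
    qed
    then have "sigma_sets (space M) {T' -` A \<inter> space M | A. A \<in> sets ?PZ} \<subseteq> sigma_sets (space M) {T1 -` A \<inter> space M | A. A \<in> sets borel}"
      by (rule sigma_sets_mono')
    then show "M.indep_set (sigma_sets (space M) {(\<lambda>\<omega> u i. E u i \<omega>) -` A \<inter> space M | A. A \<in> sets ?PZ})
         (sigma_sets (space M) {T' -` A \<inter> space M | A. A \<in> sets ?PZ})"
      using T1_indep unfolding M.indep_set_def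
      by (elim M.indep_sets_mono_sets) (auto split: bool.split)
  qed
  define D where "D = {p \<in> space (?PZ \<Otimes>\<^sub>M ?PZ). pop_matches (fst p) P [] (rl (snd p))}"
  have D: "D \<in> sets (?PZ \<Otimes>\<^sub>M ?PZ)"
  proof -
    have "Measurable.pred (?PZ \<Otimes>\<^sub>M ?PZ) (\<lambda>p. pop_matches (fst p) P [] (rl (snd p)))"
      by (rule pop_matches_measurable'[OF _ measurable_compose[OF measurable_snd rl] measurable_fst]) simp
    then show ?thesis unfolding D_def pred_def .
  qed
  interpret DZ: prob_space "distr M ?PZ (\<lambda>\<omega> u i. E u i \<omega>)" by (rule M.prob_space_distr[OF Z])
  interpret DT: prob_space "distr M ?PZ T'" by (rule M.prob_space_distr[OF T'])
  interpret DZT: pair_sigma_finite "distr M ?PZ (\<lambda>\<omega> u i. E u i \<omega>)" "distr M ?PZ T'" ..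
  have ZT: "(\<lambda>\<omega>. (\<lambda>u i. E u i \<omega>, T' \<omega>)) \<in> measurable M (?PZ \<Otimes>\<^sub>M ?PZ)" using Z T' by (rule measurable_Pair)
  have law_T1: "distr M borel T1 = density lborel (exponential_density 1)"
    using T1_exp by (simp add: distributed_def cong: distr_cong)
  have "{\<omega> \<in> space M. pop_matches (ev \<omega>) P [] (T1 \<omega>)} = (\<lambda>\<omega>. (\<lambda>u i. E u i \<omega>, T' \<omega>)) -` D \<inter> space M"
    using measurable_space[OF ZT] by (auto simp: D_def)
  then have "emeasure M {\<omega> \<in> space M. pop_matches (ev \<omega>) P [] (T1 \<omega>)} = emeasure (distr M (?PZ \<Otimes>\<^sub>M ?PZ) (\<lambda>\<omega>. (\<lambda>u i. E u i \<omega>, T' \<omega>))) D"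
    by (simp add: emeasure_distr[OF ZT D])
  also have "\<dots> = emeasure (distr M ?PZ (\<lambda>\<omega> u i. E u i \<omega>) \<Otimes>\<^sub>M distr M ?PZ T') D"
    using ind unfolding M.indep_var_distribution_eq by simp
  also have "\<dots> = (\<integral>\<^sup>+y. emeasure (distr M ?PZ (\<lambda>\<omega> u i. E u i \<omega>)) ((\<lambda>z. (z, y)) -` D) \<partial>distr M ?PZ T')"
  proof (rule DZT.emeasure_pair_measure_alt2)
    have "sets (distr M ?PZ (\<lambda>\<omega> u i. E u i \<omega>) \<Otimes>\<^sub>M distr M ?PZ T') = sets (?PZ \<Otimes>\<^sub>M ?PZ)"
      by (rule sets_pair_measure_cong) (rule sets_distr)+
    then show "D \<in> sets (distr M ?PZ (\<lambda>\<omega> u i. E u i \<omega>) \<Otimes>\<^sub>M distr M ?PZ T')" using D by blast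
  qed
  also have "\<dots> = (\<integral>\<^sup>+y. ennreal (limit_prob P (- rl y)) \<partial>distr M ?PZ T')"
  proof (rule nn_integral_cong_AE)
    have "AE y in distr M ?PZ T'. 0 \<le> rl y"
    proof (subst AE_distr_iff[OF T'])
      show "{y \<in> space ?PZ. 0 \<le> rl y} \<in> sets ?PZ"
        using rl by (rule borel_measurable_iff_ge[THEN iffD1, rule_format])
    qed (use M.exponential_nonneg_AE[OF T1_exp] in simp)
    then show "AE y in distr M ?PZ T'. emeasure (distr M ?PZ (\<lambda>\<omega> u i. E u i \<omega>)) ((\<lambda>z. (z, y)) -` D) = ennreal (limit_prob P (- rl y))"
      using AE_space
    proof eventually_elim
      case (elim y)
      then have y: "y \<in> space ?PZ" by simp
      have "emeasure (distr M ?PZ (\<lambda>\<omega> u i. E u i \<omega>)) ((\<lambda>z. (z, y)) -` D) = emeasure M ((\<lambda>\<omega> u i. E u i \<omega>) -` ((\<lambda>z. (z, y)) -` D) \<inter> space M)"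
        by (rule emeasure_distr[OF Z sets_Pair2[OF D]])
      also have "(\<lambda>\<omega> u i. E u i \<omega>) -` ((\<lambda>z. (z, y)) -` D) \<inter> space M = {\<omega> \<in> space M. pop_matches (ev \<omega>) P [] (rl y)}"
        using y measurable_space[OF Z] by (auto simp: D_def space_pair_measure)
      finally show ?case using elim(1) by (simp add: pop_matches_prob)
    qed
  qed
  also have "\<dots> = (\<integral>\<^sup>+\<omega>. ennreal (limit_prob P (- T1 \<omega>)) \<partial>M)"
  proof -
    have "(\<lambda>y. ennreal (limit_prob P (- rl y))) \<in> borel_measurable ?PZ" using rl by measurable
    then have "(\<lambda>y. ennreal (limit_prob P (- rl y))) \<in> borel_measurable (distr M ?PZ T')"
      unfolding measurable_distr_eq1 .
    from nn_integral_distr[OF T' this] show ?thesis by simp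
  qed
  also have "\<dots> = (\<integral>\<^sup>+t. ennreal (limit_prob P (- t)) \<partial>distr M borel T1)"
    by (subst nn_integral_distr[OF T1]) auto
  also have "\<dots> = (\<integral>\<^sup>+t. ennreal (exponential_density 1 t) * ennreal (limit_prob P (- t)) \<partial>lborel)"
    unfolding law_T1 by (rule nn_integral_density) auto
  also have "\<dots> = (\<integral>\<^sup>+t. (\<lambda>t. ennreal (if t \<le> 0 then exp t * limit_prob P t else 0)) (0 + (-1) * t) \<partial>lborel)"
    using limit_prob_bounds by (intro nn_integral_cong) (auto simp: exponential_density_def ennreal_mult)
  also have "\<dots> = (\<integral>\<^sup>+t. ennreal (if t \<le> 0 then exp t * limit_prob P t else 0) \<partial>lborel)"
    by (subst nn_integral_real_affine[where c="-1" and t=0]) auto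
  also have "\<dots> = (\<integral>\<^sup>+t. ennreal (if t < 0 then exp t * limit_prob P t else 0) \<partial>lborel)"
    by (rule nn_integral_cong_AE) (use AE_lborel_singleton[of 0] in eventually_elim, auto)
  finally have eq: "ennreal (measure M {\<omega> \<in> space M. pop_matches (ev \<omega>) P [] (T1 \<omega>)}) = (\<integral>\<^sup>+t. ennreal (if t < 0 then exp t * limit_prob P t else 0) \<partial>lborel)"
    by (simp add: M.emeasure_eq_measure)
  have "(\<integral>t. (if t < 0 then exp t * limit_prob P t else 0) \<partial>lborel) = enn2real (\<integral>\<^sup>+t. ennreal (if t < 0 then exp t * limit_prob P t else 0) \<partial>lborel)"
    using limit_prob_bounds by (intro integral_eq_nn_integral) auto
  then show ?thesis by (simp flip: eq)
qed

end

subsection \<open>Fringe trees, degrees and the limit theorem\<close>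

primrec wildcard_free :: "pattern \<Rightarrow> bool" where
  "wildcard_free Any = False"
| "wildcard_free (Tree ts) = list_all id (map wildcard_free ts)"

primrec shape :: "pattern \<Rightarrow> rtree" where
  "shape Any = Node {#}"
| "shape (Tree ts) = Node (mset (map shape ts))"

text \<open>The planar versions of t, that is, the possible birth orders of siblings. Without
  wildcards a match determines the whole subtree.\<close>

definition patterns_of :: "rtree \<Rightarrow> pattern set" where
  "patterns_of t = {P. wildcard_free P \<and> shape P = t}"

lemma wildcard_free_Tree: "wildcard_free (Tree ts) \<longleftrightarrow> (\<forall>P\<in>set ts. wildcard_free P)"
  by (simp add: list_all_iff)

text \<open>A planar version of a node is a list of planar versions of its children, of fixed length
  and with entries from a finite set by induction.\<close>

lemma finite_patterns_of: "finite (patterns_of t)"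
proof (induction t)
  case (Node M)
  let ?A = "\<Union>t\<in>set_mset M. patterns_of t"
  have "patterns_of (Node M) \<subseteq> Tree ` {ts. set ts \<subseteq> ?A \<and> length ts = size M}"
  proof
    fix P assume P: "P \<in> patterns_of (Node M)"
    then obtain ts where ts: "P = Tree ts" by (cases P) (auto simp: patterns_of_def)
    then have M: "M = mset (map shape ts)" and "\<forall>Q\<in>set ts. wildcard_free Q"
      using P by (auto simp: patterns_of_def wildcard_free_Tree simp del: wildcard_free.simps)
    then have "set ts \<subseteq> ?A" "length ts = size M" by (auto simp: patterns_of_def)
    then show "P \<in> Tree ` {ts. set ts \<subseteq> ?A \<and> length ts = size M}" using ts by blast
  qed
  moreover have "finite {ts. set ts \<subseteq> ?A \<and> length ts = size M}"
    by (rule finite_lists_length_eq) (use Node in auto)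
  ultimately show ?case by (meson finite_imageI finite_subset)
qed

primrec planar :: "nat \<Rightarrow> nat list \<Rightarrow> nat \<Rightarrow> pattern" where
  "planar 0 ps v = Tree []"
| "planar (Suc f) ps v = Tree (map (planar f ps) (children ps v))"

lemma fr_planar: "fr f ps v = shape (planar f ps v)"
  by (induction f arbitrary: v) (auto simp: comp_def intro!: image_mset_cong)

lemma wildcard_free_planar: "wildcard_free (planar f ps v)"
  by (induction f arbitrary: v) (auto simp: list_all_iff)

section \<open>Convergence of fringe and degree counts\<close>

context macro_delay
begin

text \<open>Labels increase strictly from parent to child, so each unit of fuel spent is repaid by a
  larger v and the condition m \<le> f + v survives the descent. Fuel 0 would force v \<ge>
  m.\<close>

lemma fringe_matches_planar:
  assumes ps: "ps \<in> rtrees m" "1 \<le> m"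
  shows "v < m \<Longrightarrow> m \<le> f + v \<Longrightarrow> fringe_matches ps (planar f ps v) v"
proof (induction f arbitrary: v)
  case (Suc f)
  have "fringe_matches ps (planar f ps c) c" if "c \<in> set (children ps v)" for c
    using children_bounds[OF ps that] Suc.prems by (intro Suc.IH) auto
  then show ?case by (auto simp: fringe_matches_Tree simp del: fringe_matches.simps)
qed simp

lemma fringe_matches_unique: "fringe_matches ps P v \<Longrightarrow> fringe_matches ps Q v \<Longrightarrow> wildcard_free P \<Longrightarrow> wildcard_free Q \<Longrightarrow> P = Q"
proof (induction P arbitrary: Q v)
  case (Tree ts)
  then obtain us where Q: "Q = Tree us" by (cases Q) auto
  have "length ts = length us" using Tree.prems unfolding Q by (auto simp: fringe_matches_Tree simp del: fringe_matches.simps)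
  moreover have "ts ! i = us ! i" if "i < length ts" for i
    by (rule Tree.IH[of _ "children ps v ! i"])
      (use Tree.prems that in \<open>auto simp: Q fringe_matches_Tree wildcard_free_Tree simp del: fringe_matches.simps wildcard_free.simps\<close>)
  ultimately show ?case by (simp add: Q list_eq_iff_nth_eq)
qed simp

text \<open>Each vertex matches exactly one wildcard-free pattern, its own subtree with siblings in
  order of arrival. So at most one summand is 1, and it occurs iff that pattern is a planar version
  of t.\<close>

lemma fringe_indicator:
  assumes ps: "ps \<in> rtrees m" "1 \<le> m" and v: "v < m"
  shows "of_bool (fringe ps v = t) = (\<Sum>P\<in>patterns_of t. of_bool (fringe_matches ps P v) :: real)"
proof -
  define Q where "Q = planar m ps v"
  have Q: "fringe ps v = shape Q" "wildcard_free Q" "fringe_matches ps Q v"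
    using rtrees_length[OF ps] fringe_matches_planar[OF ps v]
    by (auto simp: fringe_def Q_def fr_planar wildcard_free_planar simp del: planar.simps)
  have "fringe_matches ps P v \<longleftrightarrow> P = Q" if "P \<in> patterns_of t" for P
    using Q fringe_matches_unique[of ps P v Q] that by (auto simp: patterns_of_def)
  then have "(\<Sum>P\<in>patterns_of t. of_bool (fringe_matches ps P v) :: real) = (\<Sum>P\<in>patterns_of t. if P = Q then 1 else 0)"
    by (intro sum.cong) auto
  also have "\<dots> = of_bool (fringe ps v = t)"
    using finite_patterns_of Q by (auto simp: sum.delta patterns_of_def)
  finally show ?thesis by simp
qed

lemma expect_count: "(\<Sum>ps\<in>rtrees n. tprob \<mu> \<alpha> n ps * (real (card {v. v < n \<and> p ps v}) / real n))
    = (\<Sum>v<n. expect n (\<lambda>ps. of_bool (p ps v)) / real n)"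
proof -
  have count: "real (card {v. v < n \<and> p ps v}) = (\<Sum>v<n. of_bool (p ps v))" for ps
  proof -
    have "{v. v < n \<and> p ps v} = {..<n} \<inter> {v. p ps v}" by auto
    then show ?thesis by simp
  qed
  show ?thesis
    unfolding expect_divide[symmetric] expect_sum[symmetric] by (simp only: expect_def count sum_divide_distrib)
qed

lemma fringe_count_limit:
  "(\<lambda>n. \<Sum>ps\<in>rtrees n. tprob \<mu> \<alpha> n ps * (real (card {v. v < n \<and> fringe ps v = t}) / real n))
    \<longlonglongrightarrow> (\<Sum>P\<in>patterns_of t. \<integral>x. (if x < 0 then exp x * limit_prob P x else 0) \<partial>lborel)"
proof -
  have "(\<lambda>n. \<Sum>P\<in>patterns_of t. \<Sum>v<n. expect n (\<lambda>ps. of_bool (fringe_matches ps P v)) / real n)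
      \<longlonglongrightarrow> (\<Sum>P\<in>patterns_of t. \<integral>x. (if x < 0 then exp x * limit_prob P x else 0) \<partial>lborel)"
    by (intro tendsto_sum fringe_matches_average_limit)
  moreover have "\<forall>\<^sub>F n in sequentially. (\<Sum>P\<in>patterns_of t. \<Sum>v<n. expect n (\<lambda>ps. of_bool (fringe_matches ps P v)) / real n)
      = (\<Sum>ps\<in>rtrees n. tprob \<mu> \<alpha> n ps * (real (card {v. v < n \<and> fringe ps v = t}) / real n))"
    using eventually_ge_at_top[of 1]
  proof eventually_elim
    case (elim n)
    have "expect n (\<lambda>ps. of_bool (fringe ps v = t)) = (\<Sum>P\<in>patterns_of t. expect n (\<lambda>ps. of_bool (fringe_matches ps P v)))" if "v < n" for v
      unfolding expect_sum[symmetric] by (rule expect_cong) (rule fringe_indicator[OF _ elim that])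
    then have "(\<Sum>v<n. expect n (\<lambda>ps. of_bool (fringe ps v = t)) / real n)
        = (\<Sum>v<n. \<Sum>P\<in>patterns_of t. expect n (\<lambda>ps. of_bool (fringe_matches ps P v)) / real n)"
      by (simp add: sum_divide_distrib)
    also have "\<dots> = (\<Sum>P\<in>patterns_of t. \<Sum>v<n. expect n (\<lambda>ps. of_bool (fringe_matches ps P v)) / real n)"
      by (rule sum.swap)
    finally show ?case unfolding expect_count by (rule sym)
  qed
  ultimately show ?thesis by (rule Lim_transform_eventually)
qed

definition star_pattern :: "nat \<Rightarrow> pattern" where
  "star_pattern k = Tree (replicate k Any)"

text \<open>One of the k edges at a non-root vertex leads to its parent, leaving k - 1 children with
  arbitrary subtrees.\<close>

lemma deg_eq_matches_star_pattern:
  assumes ps: "ps \<in> rtrees n" and n: "2 \<le> n" and v: "1 \<le> v" "v < n" and k: "1 \<le> k"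
  shows "deg ps v n = k \<longleftrightarrow> fringe_matches ps (star_pattern (k - 1)) v"
proof -
  have "Suc (length ps) = n" using rtrees_length[OF ps] n by simp
  then have "{j \<in> {1..<n}. ps ! (j - 1) = v} = set (children ps v)"
    by (auto simp: set_children)
  then have "deg ps v n = length (children ps v) + 1"
    using n v by (simp add: deg_def distinct_card[OF distinct_children])
  then show ?thesis using k by (auto simp: star_pattern_def fringe_matches_Tree simp del: fringe_matches.simps(2))
qed

text \<open>The degree of the root is its number of children without the extra 1, so the two counts
  may disagree there. One vertex changes the average by at most 1/n.\<close>

lemma degree_count_limit:
  assumes k: "1 \<le> k"
  shows "(\<lambda>n. \<Sum>ps\<in>rtrees n. tprob \<mu> \<alpha> n ps * (real (card {v. v < n \<and> deg ps v n = k}) / real n))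
    \<longlonglongrightarrow> (\<integral>x. (if x < 0 then exp x * limit_prob (star_pattern (k - 1)) x else 0) \<partial>lborel)"
proof -
  define a where "a n v = expect n (\<lambda>ps. of_bool (deg ps v n = k))" for n v
  define b where "b n v = expect n (\<lambda>ps. of_bool (fringe_matches ps (star_pattern (k - 1)) v))" for n v
  have "(\<lambda>n. (\<Sum>v<n. a n v / real n) - (\<Sum>v<n. b n v / real n)) \<longlonglongrightarrow> 0"
  proof (rule Lim_null_comparison)
    show "\<forall>\<^sub>F n in sequentially. norm ((\<Sum>v<n. a n v / real n) - (\<Sum>v<n. b n v / real n)) \<le> 1 / real n"
      using eventually_ge_at_top[of 2]
    proof eventually_elim
      case (elim n)
      have eq: "a n v = b n v" if "1 \<le> v" "v < n" for v
        unfolding a_def b_def by (rule expect_cong) (simp add: deg_eq_matches_star_pattern[OF _ elim that k])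
      have "(\<Sum>v<n. a n v / real n) - (\<Sum>v<n. b n v / real n) = (\<Sum>v<n. (a n v - b n v) / real n)"
        by (simp add: sum_subtractf diff_divide_distrib)
      also have "\<dots> = (\<Sum>v\<in>{0}. (a n v - b n v) / real n)"
        using elim eq by (intro sum.mono_neutral_right) auto
      also have "\<dots> = (a n 0 - b n 0) / real n" by simp
      finally have "norm ((\<Sum>v<n. a n v / real n) - (\<Sum>v<n. b n v / real n)) = \<bar>a n 0 - b n 0\<bar> / real n" by simp
      moreover have "\<bar>a n 0 - b n 0\<bar> \<le> 1"
        unfolding a_def b_def expect_diff[symmetric] by (rule expect_abs_le[OF elim]) auto
      ultimately show ?case by (simp add: divide_right_mono)
    qed
  qed (rule lim_1_over_n)
  from tendsto_add[OF this fringe_matches_average_limit[of "star_pattern (k - 1)"]]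
  show ?thesis unfolding expect_count by (simp add: a_def b_def)
qed

end

section \<open>The genealogy at a given time as a pattern match\<close>

primrec labels :: "pattern \<Rightarrow> nat list set" where
  "labels Any = {[]}"
| "labels (Tree ts) = insert [] (\<Union>i<length ts. (#) i ` (map labels ts ! i))"

lemma labels_Tree: "labels (Tree ts) = insert [] (\<Union>i<length ts. (#) i ` labels (ts ! i))"
  by auto

lemma finite_labels: "finite (labels P)"
  by (induction P) (auto simp: labels_Tree simp del: labels.simps(2))

lemma birth_Nil [simp]: "birth e [] = 0"
  by (simp add: birth_def)

lemma birth_snoc: "birth e (u @ [i]) = birth e u + sig e u (Suc i)"
proof -
  have "(\<Sum>k<length u. sig e (take k (u @ [i])) ((u @ [i]) ! k + 1)) = (\<Sum>k<length u. sig e (take k u) (u ! k + 1))"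
    by (intro sum.cong) (auto simp: nth_append)
  then show ?thesis by (simp add: birth_def)
qed

lemma birth_mono:
  assumes "positive_gaps e" shows "birth e u \<le> birth e (u @ w)"
proof (induction w rule: rev_induct)
  case (snoc i w)
  have "birth e (u @ w) \<le> birth e ((u @ w) @ [i])"
    unfolding birth_snoc using sig_nonneg[OF assms] by (metis add.right_neutral add_left_mono)
  then show ?case using snoc by simp
qed simp

text \<open>The match tells at every individual how many children are born by T, hence which labels
  exist below u; in particular the population is finite. The number of labels is enough fuel,
  because a child has at least one label fewer below it than its parent.\<close>

lemma pop_matches_labels:
  assumes gaps: "positive_gaps e"
  shows "wildcard_free P \<Longrightarrow> birth e u = ereal b \<Longrightarrow> pop_matches e P u (T - b) \<Longrightarrow>
    {w. birth e (u @ w) \<le> ereal T} = labels P \<and> (\<forall>f\<ge>card (labels P). gt f e T u = shape P)"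
proof (induction P arbitrary: u b)
  case (Tree ts)
  let ?c = "length ts"
  have le: "sig e u ?c \<le> ereal (T - b)" and gr: "ereal (T - b) < sig e u (Suc ?c)"
    and sub: "\<And>i. i < ?c \<Longrightarrow> pop_matches e (ts ! i) (u @ [i]) (T - b - real_of_ereal (sig e u (Suc i)))"
    using Tree.prems(3) unfolding pop_matches_Tree by auto
  have child: "{w. birth e ((u @ [i]) @ w) \<le> ereal T} = labels (ts ! i) \<and> (\<forall>f\<ge>card (labels (ts ! i)). gt f e T (u @ [i]) = shape (ts ! i))"
    if i: "i < ?c" for i
  proof -
    have "sig e u (Suc i) \<le> ereal (T - b)" using order_trans[OF sig_mono[OF gaps, of "Suc i" ?c] le] i by simp
    then obtain x where x: "sig e u (Suc i) = ereal x"
      using sig_nonneg[OF gaps, of u "Suc i"] by (cases "sig e u (Suc i)") auto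
    show ?thesis
    proof (rule Tree.IH)
      show "birth e (u @ [i]) = ereal (b + x)" using Tree.prems(2) x by (simp add: birth_snoc)
      show "pop_matches e (ts ! i) (u @ [i]) (T - (b + x))" using sub[OF i] x by (simp add: algebra_simps)
    qed (use i Tree.prems(1) in \<open>auto simp: wildcard_free_Tree simp del: wildcard_free.simps\<close>)
  qed
  \<comment> \<open>The strict inequality in the match says that the child with index ?c, the one
    after the last, is born after T; later children are born no earlier.\<close>
  have late: "\<not> birth e (u @ [i]) \<le> ereal T" if "?c \<le> i" for i
  proof -
    have "ereal (T - b) < sig e u (Suc i)" using gr sig_mono[OF gaps, of "Suc ?c" "Suc i" u] that by (auto intro: less_le_trans)
    then show ?thesis using Tree.prems(2) by (cases "sig e u (Suc i)") (auto simp: birth_snoc)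
  qed
  have root: "birth e u \<le> ereal T"
    using order_trans[OF sig_nonneg[OF gaps] le] Tree.prems(2) by simp
  have set_eq: "{w. birth e (u @ w) \<le> ereal T} = labels (Tree ts)"
  proof (rule set_eqI)
    fix w
    show "w \<in> {w. birth e (u @ w) \<le> ereal T} \<longleftrightarrow> w \<in> labels (Tree ts)"
    proof (cases w)
      case Nil
      then show ?thesis using root by (simp add: labels_Tree)
    next
      case (Cons i w')
      show ?thesis
      proof (cases "i < ?c")
        case True
        then have "birth e (u @ w) \<le> ereal T \<longleftrightarrow> w' \<in> labels (ts ! i)" using child[OF True] Cons by auto
        then show ?thesis using True Cons by (auto simp: labels_Tree simp del: labels.simps)
      next
        case False
        then have "\<not> birth e (u @ w) \<le> ereal T"
          using late[of i] birth_mono[OF gaps, of "u @ [i]" w'] Cons by (auto dest: order_trans)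
        then show ?thesis using False Cons by (auto simp: labels_Tree simp del: labels.simps)
      qed
    qed
  qed
  have kids: "{i. birth e (u @ [i]) \<le> ereal T} = {..<?c}"
  proof -
    have early: "birth e (u @ [i]) \<le> ereal T" if "i < ?c" for i
    proof -
      have "[] \<in> labels (ts ! i)" by (cases "ts ! i") auto
      then show ?thesis using child[OF that] by auto
    qed
    show ?thesis
    proof (rule set_eqI)
      show "i \<in> {i. birth e (u @ [i]) \<le> ereal T} \<longleftrightarrow> i \<in> {..<?c}" for i
        using early[of i] late[of i] by (cases "i < ?c") auto
    qed
  qed
  have "gt f e T u = shape (Tree ts)" if f: "card (labels (Tree ts)) \<le> f" for f
  proof -
    \<comment> \<open>The empty label of the parent is not among the labels extended by i.\<close>
    have fuel: "Suc (card (labels (ts ! i))) \<le> card (labels (Tree ts))" if "i < ?c" for i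
    proof -
      have "Suc (card (labels (ts ! i))) = card (insert [] ((#) i ` labels (ts ! i)))"
        using finite_labels[of "ts ! i"] by (subst card_insert_disjoint) (auto simp: card_image)
      also have "\<dots> \<le> card (labels (Tree ts))"
        using that by (intro card_mono finite_labels) (auto simp: labels_Tree simp del: labels.simps)
      finally show ?thesis .
    qed
    have "0 < card (labels (Tree ts))" using finite_labels[of "Tree ts"] by (auto simp: card_gt_0_iff)
    then obtain f' where f': "f = Suc f'" using f by (cases f) auto
    have "map (\<lambda>i. gt f' e T (u @ [i])) [0..<?c] = map (\<lambda>i. shape (ts ! i)) [0..<?c]"
      using child fuel f f' by (intro map_cong refl) fastforce
    also have "\<dots> = map shape ts" by (intro nth_equalityI) auto
    finally show ?thesis by (simp add: f' kids lessThan_atLeast0)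
  qed
  then show ?case using set_eq by blast
qed simp

text \<open>Induction on the number of descendants alive by T, which drops strictly from parent to
  child because u is not a descendant of its child. Finiteness of the population makes it well
  defined.\<close>

lemma pop_matches_exists:
  assumes gaps: "positive_gaps e" and fin: "finite (pop e T)"
  shows "birth e u = ereal b \<Longrightarrow> b \<le> T \<Longrightarrow> \<exists>P. wildcard_free P \<and> pop_matches e P u (T - b)"
proof (induction "card {w. birth e (u @ w) \<le> ereal T}" arbitrary: u b rule: less_induct)
  case less
  let ?W = "\<lambda>u. {w. birth e (u @ w) \<le> ereal T}"
  have finW: "finite (?W u)" for u
  proof (rule finite_imageD)
    show "finite ((@) u ` ?W u)" by (rule finite_subset[OF _ fin]) (auto simp: pop_def)
  qed (simp add: inj_on_def)
  define I where "I = {i. birth e (u @ [i]) \<le> ereal T}"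
  have "finite I"
  proof (rule finite_imageD)
    show "finite ((\<lambda>i. [i]) ` I)" by (rule finite_subset[OF _ finW[of u]]) (auto simp: I_def)
  qed (simp add: inj_on_def)
  have I_iff: "i \<in> I \<longleftrightarrow> sig e u (Suc i) \<le> ereal (T - b)" for i
    unfolding I_def using less.prems by (cases "sig e u (Suc i)") (auto simp: birth_snoc)
  \<comment> \<open>Indices start at 0: child c - 1 is born at \<sigma>_c and child c at
    \<sigma>_(c+1). The first index outside I is thus the number of children required by the two
    inequalities of a match.\<close>
  define c where "c = (LEAST i. i \<notin> I)"
  have cI: "c \<notin> I" unfolding c_def by (rule LeastI_ex[OF ex_new_if_finite[OF infinite_UNIV_nat \<open>finite I\<close>]])
  have lt: "i \<in> I" if "i < c" for i using not_less_Least that unfolding c_def by blast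
  have "\<exists>P. wildcard_free P \<and> pop_matches e P (u @ [i]) (T - b - real_of_ereal (sig e u (Suc i)))" if i: "i < c" for i
  proof -
    have le: "sig e u (Suc i) \<le> ereal (T - b)" using lt[OF i] I_iff by simp
    then obtain x where x: "sig e u (Suc i) = ereal x"
      using sig_nonneg[OF gaps, of u "Suc i"] by (cases "sig e u (Suc i)") auto
    have "card (?W (u @ [i])) < card (?W u)"
    proof -
      have "card (?W (u @ [i])) = card ((#) i ` ?W (u @ [i]))" by (simp add: card_image)
      also have "\<dots> < card (?W u)"
      proof (rule psubset_card_mono[OF finW])
        have "[] \<in> ?W u" using less.prems by simp
        then show "(#) i ` ?W (u @ [i]) \<subset> ?W u" by auto
      qed
      finally show ?thesis .
    qed
    moreover have "birth e (u @ [i]) = ereal (b + x)" using less.prems x by (simp add: birth_snoc)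
    moreover have "b + x \<le> T" using le x by simp
    ultimately have "\<exists>P. wildcard_free P \<and> pop_matches e P (u @ [i]) (T - (b + x))" by (rule less.hyps)
    then show ?thesis using x by (simp add: algebra_simps)
  qed
  then obtain Q where Q: "\<And>i. i < c \<Longrightarrow> wildcard_free (Q i) \<and> pop_matches e (Q i) (u @ [i]) (T - b - real_of_ereal (sig e u (Suc i)))"
    by metis
  have "sig e u c \<le> ereal (T - b)"
  proof (cases c)
    case 0
    then show ?thesis using less.prems by simp
  next
    case (Suc i)
    then show ?thesis using lt[of i] I_iff by simp
  qed
  moreover have "ereal (T - b) < sig e u (Suc c)" using cI I_iff[of c] by (simp add: not_le)
  ultimately have "pop_matches e (Tree (map Q [0..<c])) u (T - b)"
    unfolding pop_matches_Tree using Q by simp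
  moreover have "wildcard_free (Tree (map Q [0..<c]))" using Q by (simp add: wildcard_free_Tree del: wildcard_free.simps)
  ultimately show ?case by blast
qed

text \<open>The intervals from \<sigma>_c to \<sigma>_(c+1), closed on the left and open on the
  right, are disjoint for increasing birth times. So r fixes the number of children, and induction
  does the rest.\<close>

lemma pop_matches_unique:
  assumes gaps: "positive_gaps e"
  shows "pop_matches e P u r \<Longrightarrow> pop_matches e Q u r \<Longrightarrow> wildcard_free P \<Longrightarrow> wildcard_free Q \<Longrightarrow> P = Q"
proof (induction P arbitrary: Q u r)
  case (Tree ts)
  then obtain us where Q: "Q = Tree us" by (cases Q) auto
  have no: False if "pop_matches e (Tree xs) u r" "pop_matches e (Tree ys) u r" "length xs < length ys" for xs ys
    using that sig_mono[OF gaps, of "Suc (length xs)" "length ys" u]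
    unfolding pop_matches_Tree by (meson Suc_leI leD order_trans)
  have "length ts = length us"
    using no[of ts us] no[of us ts] Tree.prems(1,2) unfolding Q by (meson linorder_neqE_nat)
  moreover have "ts ! i = us ! i" if "i < length ts" for i
    by (rule Tree.IH[of _ "u @ [i]" "r - real_of_ereal (sig e u (Suc i))"])
      (use Tree.prems that calculation in \<open>auto simp: Q wildcard_free_Tree simp del: wildcard_free.simps\<close>)
  ultimately show ?case by (simp add: Q list_eq_iff_nth_eq)
qed simp

text \<open>Replaces the fuel-bounded \<open>gen_tree\<close>, meaningful only for finite
  populations, by conditions on gaps whose probabilities are known. A match with a wildcard-free
  pattern already entails finiteness.\<close>

lemma gen_tree_iff_pop_matches:
  assumes gaps: "positive_gaps e" and T: "0 \<le> T"
  shows "finite (pop e T) \<and> gen_tree e T = t \<longleftrightarrow> (\<exists>P\<in>patterns_of t. pop_matches e P [] T)"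
proof -
  have gen: "finite (pop e T) \<and> gen_tree e T = shape P" if "wildcard_free P" "pop_matches e P [] T" for P
  proof -
    have *: "{w. birth e ([] @ w) \<le> ereal T} = labels P \<and> (\<forall>f\<ge>card (labels P). gt f e T [] = shape P)"
      by (rule pop_matches_labels[OF gaps, where b=0]) (use that in \<open>simp_all add: zero_ereal_def\<close>)
    then have "pop e T = labels P" by (simp add: pop_def)
    then show ?thesis using * finite_labels unfolding gen_tree_def by (metis le_SucI order_refl)
  qed
  show ?thesis
  proof
    assume fin: "finite (pop e T) \<and> gen_tree e T = t"
    have "\<exists>P. wildcard_free P \<and> pop_matches e P [] (T - 0)"
      by (rule pop_matches_exists[OF gaps]) (use fin T in \<open>auto simp: zero_ereal_def\<close>)
    then obtain P where P: "wildcard_free P" "pop_matches e P [] T" by auto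
    then show "\<exists>P\<in>patterns_of t. pop_matches e P [] T" using gen[OF P] fin by (auto simp: patterns_of_def)
  next
    assume "\<exists>P\<in>patterns_of t. pop_matches e P [] T"
    then show "finite (pop e T) \<and> gen_tree e T = t" using gen by (auto simp: patterns_of_def)
  qed
qed

text \<open>The tree is read off from the set of labels alone. This reduces measurability of the
  tree to that of countably many finite populations.\<close>

lemma gen_tree_cong:
  assumes "pop e T = pop e' T'"
  shows "gen_tree e T = gen_tree e' T'"
proof -
  have eq: "{i. birth e (u @ [i]) \<le> ereal T} = {i. birth e' (u @ [i]) \<le> ereal T'}" for u
    using assms by (auto simp: pop_def set_eq_iff)
  have "gt f e T u = gt f e' T' u" for f u
    by (induction f arbitrary: u) (simp_all add: eq)
  then show ?thesis unfolding gen_tree_def assms by simp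
qed

section \<open>Measurability and law of the genealogical tree\<close>

context branching
begin

lemma birth_measurable [measurable]: "(\<lambda>\<omega>. birth (ev \<omega>) u) \<in> borel_measurable M"
proof -
  have "(\<lambda>\<omega>. \<Sum>k<length u. sig_rv (take k u) (u ! k + 1) \<omega>) \<in> borel_measurable M"
    by (intro borel_measurable_ereal_sum sig_rv_measurable)
  then show ?thesis by (simp add: birth_def sig_rv_def)
qed

lemma gen_tree_event:
  assumes [measurable]: "T \<in> borel_measurable M"
  shows "{\<omega> \<in> space M. finite (pop (ev \<omega>) (T \<omega>)) \<and> gen_tree (ev \<omega>) (T \<omega>) = t} \<in> sets M"
proof -
  (* A finite population determines its tree, and there are countably many finite populations. *)
  define \<S> where "\<S> = {A. finite A \<and> (\<exists>e r. pop e r = A \<and> gen_tree e r = t)}"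
  have "{\<omega> \<in> space M. finite (pop (ev \<omega>) (T \<omega>)) \<and> gen_tree (ev \<omega>) (T \<omega>) = t}
    = (\<Union>A\<in>\<S>. {\<omega> \<in> space M. \<forall>u. birth (ev \<omega>) u \<le> ereal (T \<omega>) \<longleftrightarrow> u \<in> A})"
  proof (intro equalityI subsetI)
    fix \<omega> assume \<omega>: "\<omega> \<in> {\<omega> \<in> space M. finite (pop (ev \<omega>) (T \<omega>)) \<and> gen_tree (ev \<omega>) (T \<omega>) = t}"
    then have "pop (ev \<omega>) (T \<omega>) \<in> \<S>" unfolding \<S>_def by blast
    then show "\<omega> \<in> (\<Union>A\<in>\<S>. {\<omega> \<in> space M. \<forall>u. birth (ev \<omega>) u \<le> ereal (T \<omega>) \<longleftrightarrow> u \<in> A})"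
      using \<omega> by (auto simp: pop_def)
  next
    fix \<omega> assume "\<omega> \<in> (\<Union>A\<in>\<S>. {\<omega> \<in> space M. \<forall>u. birth (ev \<omega>) u \<le> ereal (T \<omega>) \<longleftrightarrow> u \<in> A})"
    then obtain A where A: "A \<in> \<S>" "\<omega> \<in> space M" "pop (ev \<omega>) (T \<omega>) = A" by (auto simp: pop_def)
    then obtain e r where er: "finite A" "pop e r = A" "gen_tree e r = t" by (auto simp: \<S>_def)
    have "gen_tree (ev \<omega>) (T \<omega>) = gen_tree e r" by (rule gen_tree_cong) (simp add: A er)
    then show "\<omega> \<in> {\<omega> \<in> space M. finite (pop (ev \<omega>) (T \<omega>)) \<and> gen_tree (ev \<omega>) (T \<omega>) = t}"
      using A er by simp
  qed
  moreover have "\<dots> \<in> sets M"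
  proof (rule sets.countable_UN'')
    show "countable \<S>" unfolding \<S>_def by (rule countable_subset[OF _ countable_Collect_finite]) auto
    show "{\<omega> \<in> space M. \<forall>u. birth (ev \<omega>) u \<le> ereal (T \<omega>) \<longleftrightarrow> u \<in> A} \<in> sets M" for A
      by measurable
  qed
  ultimately show ?thesis by simp
qed

text \<open>Planar versions exclude each other only where gaps are positive, that is almost surely.
  Therefore indicators are added almost everywhere instead of decomposing the event into disjoint
  sets.\<close>

lemma gen_tree_prob:
  assumes T: "T \<in> borel_measurable M" and T_nonneg: "AE \<omega> in M. 0 \<le> T \<omega>"
  shows "measure M {\<omega> \<in> space M. finite (pop (ev \<omega>) (T \<omega>)) \<and> gen_tree (ev \<omega>) (T \<omega>) = t}
    = (\<Sum>P\<in>patterns_of t. measure M {\<omega> \<in> space M. pop_matches (ev \<omega>) P [] (T \<omega>)})"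
proof -
  let ?A = "{\<omega> \<in> space M. finite (pop (ev \<omega>) (T \<omega>)) \<and> gen_tree (ev \<omega>) (T \<omega>) = t}"
  let ?C = "\<lambda>P. {\<omega> \<in> space M. pop_matches (ev \<omega>) P [] (T \<omega>)}"
  note [measurable] = gen_tree_event[OF T, of t] pop_matches_event[OF T, of _ "[]"]
  have "measure M ?A = (\<integral>\<omega>. indicator ?A \<omega> \<partial>M)" by simp
  also have "\<dots> = (\<integral>\<omega>. (\<Sum>P\<in>patterns_of t. indicator (?C P) \<omega>) \<partial>M)"
  proof (rule integral_cong_AE)
    show "AE \<omega> in M. indicator ?A \<omega> = (\<Sum>P\<in>patterns_of t. indicator (?C P) \<omega> :: real)"
      using AE_positive_gaps T_nonneg AE_space
    proof eventually_elim
      case (elim \<omega>)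
      note iff = gen_tree_iff_pop_matches[OF elim(1,2), of t]
      show ?case
      proof (cases "\<exists>P\<in>patterns_of t. pop_matches (ev \<omega>) P [] (T \<omega>)")
        case True
        then obtain P where P: "P \<in> patterns_of t" "pop_matches (ev \<omega>) P [] (T \<omega>)" by blast
        have "indicator (?C Q) \<omega> = (if Q = P then 1 else 0 :: real)" if "Q \<in> patterns_of t" for Q
        proof (cases "Q = P")
          case False
          then have "\<not> pop_matches (ev \<omega>) Q [] (T \<omega>)"
            using pop_matches_unique[OF elim(1) P(2), of Q] P(1) that unfolding patterns_of_def by blast
          then have "\<omega> \<notin> ?C Q" by simp
          then have "indicator (?C Q) \<omega> = (0 :: real)" by (rule indicator_simps(2))
          then show ?thesis using False by (simp only: if_False)
        next
          case True
          then have "\<omega> \<in> ?C Q" using P elim(3) by simp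
          then have "indicator (?C Q) \<omega> = (1 :: real)" by (rule indicator_simps(1))
          then show ?thesis using True by simp
        qed
        then have "(\<Sum>Q\<in>patterns_of t. indicator (?C Q) \<omega> :: real) = (\<Sum>Q\<in>patterns_of t. if Q = P then 1 else 0)"
          by (rule sum.cong[OF refl])
        also have "\<dots> = 1" using P finite_patterns_of by (simp add: sum.delta)
        also have "\<dots> = indicator ?A \<omega>"
        proof -
          have "\<omega> \<in> ?A" using iff True elim(3) by blast
          then have "indicator ?A \<omega> = (1 :: real)" by (rule indicator_simps(1))
          then show ?thesis by (rule sym)
        qed
        finally show ?thesis by (rule sym)
      next
        case False
        then have "\<omega> \<notin> ?A" using iff by blast
        then have A: "indicator ?A \<omega> = (0 :: real)" by (rule indicator_simps(2))
        have "indicator (?C P) \<omega> = (0 :: real)" if "P \<in> patterns_of t" for P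
          by (rule indicator_simps(2)) (use False that in blast)
        then have "(\<Sum>P\<in>patterns_of t. indicator (?C P) \<omega> :: real) = 0" by (rule sum.neutral[OF ballI])
        then show ?thesis unfolding A by (rule sym)
      qed
    qed
  qed measurable
  also have "\<dots> = (\<Sum>P\<in>patterns_of t. \<integral>\<omega>. indicator (?C P) \<omega> \<partial>M)"
    by (rule Bochner_Integration.integral_sum) (simp add: M.emeasure_eq_measure)
  finally show ?thesis by simp
qed

end

theorem theorem4p1:
  fixes \<mu> :: "real measure" and \<alpha> :: real
    and M :: "'a measure" and E :: "nat list \<Rightarrow> nat \<Rightarrow> 'a \<Rightarrow> ereal" and T1 :: "'a \<Rightarrow> real"
  assumes alpha: "\<alpha> \<ge> 0"
    and mu_prob: "prob_space \<mu>" and mu_borel: "sets \<mu> = sets borel"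
    and mu_supp: "measure \<mu> {0..1} = 1"
    and mu_0: "measure \<mu> {0} < 1" and mu_1: "measure \<mu> {1} < 1"
    and M_prob: "prob_space M"
    and E_indep: "prob_space.indep_vars M (\<lambda>_. PiM UNIV (\<lambda>_. borel)) (\<lambda>u \<omega> i. E u i \<omega>) UNIV"
    and T1_indep: "prob_space.indep_set M
         (sigma_sets (space M) {(\<lambda>\<omega> u i. E u i \<omega>) -` A \<inter> space M | A. A \<in> sets (PiM UNIV (\<lambda>_. PiM UNIV (\<lambda>_. borel)))})
         (sigma_sets (space M) {T1 -` A \<inter> space M | A. A \<in> sets borel})"
    and T1_exp: "distributed M lborel T1 (exponential_density 1)"
    and E_law: "\<And>u i s. s \<ge> 0 \<Longrightarrow>
       AE \<omega> in M. sig (\<lambda>v j. E v j \<omega>) u i < \<infinity> \<longrightarrow>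
         real_cond_exp M (past_alg M E u i) (indicator {\<omega>' \<in> space M. E u i \<omega>' > ereal s}) \<omega>
         = exp (- (LINT x:{0..s}|lborel. hazard \<mu> \<alpha> (\<lambda>j. real_of_ereal (sig (\<lambda>v j. E v j \<omega>) u j)) i x))"
  shows "(\<forall>t :: rtree.
           (\<lambda>n. \<Sum>ps\<in>rtrees n. tprob \<mu> \<alpha> n ps * (real (card {v. v < n \<and> fringe ps v = t}) / real n))
           \<longlonglongrightarrow> measure M {\<omega> \<in> space M. finite (pop (\<lambda>u i. E u i \<omega>) (T1 \<omega>))
                                       \<and> gen_tree (\<lambda>u i. E u i \<omega>) (T1 \<omega>) = t})
       \<and> (\<forall>k \<ge> 1.
           (\<lambda>n. \<Sum>ps\<in>rtrees n. tprob \<mu> \<alpha> n ps * (real (card {v. v < n \<and> deg ps v n = k}) / real n))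
           \<longlonglongrightarrow> measure M {\<omega> \<in> space M. sig (\<lambda>u i. E u i \<omega>) [] (k - 1) \<le> ereal (T1 \<omega>)
                                       \<and> ereal (T1 \<omega>) < sig (\<lambda>u i. E u i \<omega>) [] k})"
proof -
  interpret P: prob_space M by (rule M_prob)
  interpret branching \<mu> \<alpha> M E
    by (intro branching.intro macro_delay.intro branching_axioms.intro alpha mu_prob mu_borel mu_supp M_prob E_indep E_law)
  have T1: "T1 \<in> borel_measurable M" using T1_exp by (simp add: distributed_def)
  have T1_nonneg: "AE \<omega> in M. 0 \<le> T1 \<omega>"
    using P.exponential_nonneg_AE[OF T1_exp] .
  note law = pop_matches_exponential_prob[OF T1_indep T1_exp]
  show ?thesis
  proof (intro conjI allI impI)
    fix t
    show "(\<lambda>n. \<Sum>ps\<in>rtrees n. tprob \<mu> \<alpha> n ps * (real (card {v. v < n \<and> fringe ps v = t}) / real n))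
           \<longlonglongrightarrow> measure M {\<omega> \<in> space M. finite (pop (\<lambda>u i. E u i \<omega>) (T1 \<omega>)) \<and> gen_tree (\<lambda>u i. E u i \<omega>) (T1 \<omega>) = t}"
      unfolding gen_tree_prob[OF T1 T1_nonneg] law by (rule fringe_count_limit)
  next
    fix k :: nat assume k: "1 \<le> k"
    \<comment> \<open>The children of a star pattern are wildcards, so only the two inequalities on
      the birth times of the root remain; k \<ge> 1 makes \<open>Suc (k - 1)\<close> equal to
      k.\<close>
    have "{\<omega> \<in> space M. sig (\<lambda>u i. E u i \<omega>) [] (k - 1) \<le> ereal (T1 \<omega>) \<and> ereal (T1 \<omega>) < sig (\<lambda>u i. E u i \<omega>) [] k}
      = {\<omega> \<in> space M. pop_matches (\<lambda>u i. E u i \<omega>) (star_pattern (k - 1)) [] (T1 \<omega>)}"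
      using k by (auto simp: star_pattern_def)
    then show "(\<lambda>n. \<Sum>ps\<in>rtrees n. tprob \<mu> \<alpha> n ps * (real (card {v. v < n \<and> deg ps v n = k}) / real n))
           \<longlonglongrightarrow> measure M {\<omega> \<in> space M. sig (\<lambda>u i. E u i \<omega>) [] (k - 1) \<le> ereal (T1 \<omega>) \<and> ereal (T1 \<omega>) < sig (\<lambda>u i. E u i \<omega>) [] k}"
      using degree_count_limit[OF k] by (simp only: law)
  qed
qed

end
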